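(* The function $\lambda\mapsto E_\lambda$, $\lambda\in[0,1]$, where $E_\lambda$ is the expected number of real lines on the zero set $Z(P_\lambda)\subset\mathbb{R}\mathrm{P}^3$ of the random cubic polynomial $P_\lambda$, is monotone increasing and attains its maximum at $\lambda=1$: $$E_1=24\sqrt{\tfrac{2}{5}}-3 .$$
   Context: Let $W=\mathbb{R}[x_0,\ldots,x_3]_{(3)}$ be the space of real homogeneous polynomials of degree $3$ in $x=(x_0,\ldots,x_3)$. Let $\mathcal{H}_d$ be the space of real homogeneous harmonic polynomials of degree $d$ in $x_0,\ldots,x_3$ (those $H$ with $\Delta H=0$, $\Delta$ the Euclidean Laplacian on $\mathbb{R}^4$), so that $W=\mathcal{H}_3\oplus\|x\|^2\mathcal{H}_1$, with $\dim\mathcal{H}_3=16$, $\dim\mathcal{H}_1=4$. Endow $W$ with the $L^2$ scalar product $$(f,g)_{L^2}=\frac{1}{2\pi^2}\int_{\mathbb{R}^4}f(x)g(x)e^{-\|x\|^2/2}\,dx .$$ Fix a basis $\{H_{3,j}\}_{j=1}^{16}$ of $\mathcal{H}_3$ and a basis $\{H_{1,j}\}_{j=1}^4$ of $\mathcal{H}_1$ such that $\{H_{3,j}\}_{j}$ and $\{\|x\|^2H_{1,j}\}_{j}$ are orthonormal for $(\cdot,\cdot)_{L^2}$. For $\lambda\in[0,1]$ (the limit cases $\lambda=0$ and $\lambda=1$ of pure harmonics of degree $1$ and $3$ are included) define the random polynomial $$P_\lambda(x)=\lambda\sum_{j=1}^{16}\xi_{3,j}H_{3,j}(x)+(1-\lambda)\sum_{j=1}^{4}\xi_{1,j}\|x\|^2H_{1,j}(x),$$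 where all $\xi_{3,j},\xi_{1,j}$ are independent standard Gaussian random variables. The case $\lambda=1$ is that of random purely harmonic cubics. For $P\in W$, $Z(P)\subset\mathbb{R}\mathrm{P}^3$ denotes its real projective zero set. A real line on $Z(P)$ is a real projective line contained in $Z(P)$, equivalently a $2$-dimensional linear subspace of $\mathbb{R}^4$ on which $P$ vanishes identically.
   Formalization: At λ=0 the zero set is almost surely a projective plane, which contains infinitely many lines, so the literal expectation is infinite and the claim fails there; E_0 is instead taken to be the limit of E_λ as λ decreases to 0, whose existence is proved. *)

theory Defs
  imports "HOL-Probability.Probability"
begin

definition homogeneous_poly :: "nat \<Rightarrow> (real^4 \<Rightarrow> real) set" where
  "homogeneous_poly d =
     {f. \<exists>c :: (4 \<Rightarrow> nat) \<Rightarrow> real.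
           f = (\<lambda>x. \<Sum>a | (\<Sum>i\<in>UNIV. a i) = d. c a * (\<Prod>i\<in>UNIV. (x $ i) ^ a i))}"

definition partial_deriv :: "4 \<Rightarrow> (real^4 \<Rightarrow> real) \<Rightarrow> real^4 \<Rightarrow> real" where
  "partial_deriv i f x = deriv (\<lambda>t. f (x + t *\<^sub>R axis i 1)) 0"

definition laplacian :: "(real^4 \<Rightarrow> real) \<Rightarrow> real^4 \<Rightarrow> real" where
  "laplacian f x = (\<Sum>i\<in>UNIV. partial_deriv i (partial_deriv i f) x)"

definition harmonic_poly :: "nat \<Rightarrow> (real^4 \<Rightarrow> real) set" where
  "harmonic_poly d = {f \<in> homogeneous_poly d. \<forall>x. laplacian f x = 0}"

definition L2_prod :: "(real^4 \<Rightarrow> real) \<Rightarrow> (real^4 \<Rightarrow> real) \<Rightarrow> real" where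
  "L2_prod f g =
     1 / (2 * pi\<^sup>2) * (LINT x|lborel. f x * g x * exp (- (norm x)\<^sup>2 / 2))"

definition basis_family ::
    "(real^4 \<Rightarrow> real) set \<Rightarrow> nat set \<Rightarrow> (nat \<Rightarrow> real^4 \<Rightarrow> real) \<Rightarrow> bool" where
  "basis_family V I B \<longleftrightarrow>
     (\<forall>j\<in>I. B j \<in> V) \<and>
     (\<forall>c. (\<forall>x. (\<Sum>j\<in>I. c j * B j x) = 0) \<longrightarrow> (\<forall>j\<in>I. c j = 0)) \<and>
     (\<forall>f\<in>V. \<exists>c. \<forall>x. f x = (\<Sum>j\<in>I. c j * B j x))"

definition orthonormal_family :: "nat set \<Rightarrow> (nat \<Rightarrow> real^4 \<Rightarrow> real) \<Rightarrow> bool" where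
  "orthonormal_family I B \<longleftrightarrow>
     (\<forall>i\<in>I. \<forall>j\<in>I. L2_prod (B i) (B j) = (if i = j then 1 else 0))"

definition RP3 :: "(real^4) set set" where
  "RP3 = {p. subspace p \<and> dim p = 1}"

definition proj_zero_set :: "(real^4 \<Rightarrow> real) \<Rightarrow> (real^4) set set" where
  "proj_zero_set P = {p \<in> RP3. \<forall>x\<in>p. P x = 0}"

definition proj_lines :: "(real^4) set set set" where
  "proj_lines = {{p \<in> RP3. p \<subseteq> V} | V. subspace V \<and> dim V = 2}"

text \<open>Counting measure rather than \<^const>\<open>card\<close>, so that an infinite set of lines counts
  as infinity and not as zero.\<close>

definition num_lines :: "(real^4 \<Rightarrow> real) \<Rightarrow> ennreal" where
  "num_lines P = emeasure (count_space UNIV) {l \<in> proj_lines. l \<subseteq> proj_zero_set P}"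

definition random_cubic ::
    "(nat \<Rightarrow> real^4 \<Rightarrow> real) \<Rightarrow> (nat \<Rightarrow> real^4 \<Rightarrow> real) \<Rightarrow>
     (nat \<Rightarrow> 'w \<Rightarrow> real) \<Rightarrow> (nat \<Rightarrow> 'w \<Rightarrow> real) \<Rightarrow> real \<Rightarrow> 'w \<Rightarrow> real^4 \<Rightarrow> real" where
  "random_cubic H3 H1 \<xi>3 \<xi>1 lam \<omega> x =
     lam * (\<Sum>j=1..16. \<xi>3 j \<omega> * H3 j x) +
     (1 - lam) * (\<Sum>j=1..4. \<xi>1 j \<omega> * ((norm x)\<^sup>2 * H1 j x))"

definition mean_lines ::
    "'w measure \<Rightarrow> (real \<Rightarrow> 'w \<Rightarrow> real^4 \<Rightarrow> real) \<Rightarrow> real \<Rightarrow> ennreal" where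
  "mean_lines M P lam = (\<integral>\<^sup>+\<omega>. num_lines (P lam \<omega>) \<partial>M)"

text \<open>At \<open>lam = 0\<close> the random cubic is the squared norm times a linear form. Almost surely its
  real zero set is a projective plane, which contains infinitely many lines, so the
  expectation itself is infinite there. The limit case is therefore read as the limit of the
  expectations as \<open>lam\<close> decreases to \<open>0\<close>; at every other parameter \<open>E_lines\<close> is the
  expectation.\<close>

definition E_lines ::
    "'w measure \<Rightarrow> (real \<Rightarrow> 'w \<Rightarrow> real^4 \<Rightarrow> real) \<Rightarrow> real \<Rightarrow> ennreal" where
  "E_lines M P lam =
     (if lam = 0 then Lim (at_right 0) (mean_lines M P) else mean_lines M P lam)"

end

theory Submission
  imports Defs
begin

text \<open>The Gaussian law on cubics is determined by its covariance kernel, which is invariant under rotations. A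
  pair of a plane and a cubic vanishing on it is a rotation of the base plane together with a cubic vanishing there,
  so pairs form a space of the same dimension as the space of cubics, and the area formula turns the expected number
  of fibre points over a random cubic into the integral of the Jacobian of the projection. At the base plane the
  Jacobian is the resultant of the two quadratic forms giving the normal derivative of the cubic, which depends
  on six independent Gaussian coefficients only. Conditionally on one quadratic coefficient of each form, its
  absolute moment reduces to that of \<open>A (x\<^sup>2 + y\<^sup>2) - C p\<^sup>2\<close> with Gaussian \<open>x\<close>, \<open>y\<close>, \<open>p\<close>, and the expectation becomes
  \<open>6 sqrt ((1 + 6 t)^3 / (1 + 18 t)) - 3\<close>, increasing in \<open>t = l\<^sup>2 / (2 l\<^sup>2 + (1 - l)\<^sup>2)\<close>.\<close>

section \<open>The area formula with multiplicities\<close>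

text \<open>Planes of four-space correspond to pairs of imaginary unit quaternions modulo a common
  sign, so four angles parametrise them up to a null set, matching the four coefficients of a cubic
  restricted to a plane. Left and right multiplication decouple: the angles enter the Jacobian only
  through factors \<open>sin (2 * t)\<close>, the cubic only through the resultant. Moving a cubic
  to another plane is an isometry of coefficient space that is never written down. Equality of Gram
  kernels yields it, and the smoothness of the resulting map is read off from values of cubics at
  points; this also makes the result independent of the orthonormal bases chosen. The kernel has
  rank 20 for \<open>0 < l < 1\<close> but only 16 at \<open>l = 1\<close>, so the dimension stays a
  parameter. The count itself is compared with measurable functions only almost everywhere, outside
  critical values and images of the faces of the parameter box. The final constant -3 arises because
  \<open>12 * l^2 - 2 * wgt' l m = - 2 * wgt l m\<close>, and as \<open>l\<close> tends to 0 the
  mean tends to 3.\<close>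

lemma onorm_le_sum_Basis:
  fixes f :: "'a::euclidean_space \<Rightarrow> 'b::real_normed_vector"
  assumes "bounded_linear f"
  shows "onorm f \<le> (\<Sum>b\<in>Basis. norm (f b))"
proof (rule onorm_le)
  fix x
  interpret bounded_linear f by fact
  have "norm (f x) = norm (\<Sum>b\<in>Basis. (x \<bullet> b) *\<^sub>R f b)"
    by (subst euclidean_representation[symmetric, of x]) (simp add: sum scaleR del: euclidean_representation)
  also have "\<dots> \<le> (\<Sum>b\<in>Basis. norm ((x \<bullet> b) *\<^sub>R f b))" by (rule norm_sum)
  also have "\<dots> \<le> (\<Sum>b\<in>Basis. norm (f b) * norm x)"
    by (intro sum_mono) (simp add: mult.commute[of _ "norm x"] mult_right_mono Basis_le_norm)
  finally show "norm (f x) \<le> (\<Sum>b\<in>Basis. norm (f b)) * norm x"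
    by (simp add: sum_distrib_right)
qed

text \<open>The injectivity half of the inverse function theorem. Continuity of the derivative is
  assumed direction by direction; in finite dimension the bound on \<open>onorm\<close> by values at
  basis vectors upgrades this to the operator norm.\<close>

lemma locally_injective_if_det_nonzero:
  fixes f :: "real^'n::{finite,wellorder} \<Rightarrow> real^'n::_"
  assumes der: "\<And>x. (f has_derivative f' x) (at x)"
    and cont: "\<And>h. continuous_on UNIV (\<lambda>x. f' x h)"
    and nz: "det (matrix (f' a)) \<noteq> 0"
  obtains r where "r > 0" "inj_on f (ball a r)"
proof -
  have bl: "bounded_linear (f' x)" for x using der has_derivative_bounded_linear by blast
  have lin: "linear (f' x)" for x using bl by (simp add: linear_conv_bounded_linear)
  have "inj (f' a)" using nz lin det_nz_iff_inj by blast
  then obtain g' where g': "linear g'" "g' \<circ> f' a = id"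
    using linear_injective_left_inverse[OF lin] by blast
  show thesis
  proof (rule has_derivative_locally_injective[of a UNIV g' f' f])
    show "bounded_linear g'" using g' by (simp add: linear_conv_bounded_linear)
    fix e :: real assume e: "e > 0"
    have "continuous_on UNIV (\<lambda>x. \<Sum>b\<in>Basis. norm (f' x b - f' a b))"
      by (intro continuous_intros cont)
    then have "isCont (\<lambda>x. \<Sum>b\<in>Basis. norm (f' x b - f' a b)) a"
      by (simp add: continuous_on_eq_continuous_at)
    then obtain d where d: "d > 0"
      "\<forall>x. dist x a < d \<longrightarrow> dist (\<Sum>b\<in>Basis. norm (f' x b - f' a b)) (\<Sum>b\<in>Basis. norm (f' a b - f' a b)) < e"
      using e unfolding continuous_at_eps_delta by blast
    show "\<exists>d>0. \<forall>x. dist a x < d \<longrightarrow> onorm (\<lambda>v. f' x v - f' a v) < e"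
    proof (intro exI[of _ d] conjI d allI impI)
      fix x assume "dist a x < d"
      then have "(\<Sum>b\<in>Basis. norm (f' x b - f' a b)) < e"
        using d(2)[rule_format, of x] by (simp add: dist_commute dist_real_def sum_nonneg)
      moreover have "onorm (\<lambda>v. f' x v - f' a v) \<le> (\<Sum>b\<in>Basis. norm (f' x b - f' a b))"
        by (rule onorm_le_sum_Basis) (intro bounded_linear_sub bl)
      ultimately show "onorm (\<lambda>v. f' x v - f' a v) < e" by simp
    qed
  qed (use der g' that in auto)
qed

lemma nn_integral_image_injective:
  fixes f :: "real^'n::{finite,wellorder} \<Rightarrow> real^'n::_"
  assumes S: "S \<in> sets lebesgue"
    and der: "\<And>x. (f has_derivative f' x) (at x)"
    and inj: "inj_on f S"
    and g: "integrable lborel g" "\<And>x. 0 \<le> g x"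
  shows "f ` S \<in> sets lebesgue"
    and "(\<integral>\<^sup>+y. indicator (f ` S) y * ennreal (g y) \<partial>lebesgue) =
         (\<integral>\<^sup>+x. indicator S x * ennreal (\<bar>det (matrix (f' x))\<bar> * g (f x)) \<partial>lebesgue)"
proof -
  show fS: "f ` S \<in> sets lebesgue"
    by (rule differentiable_image_in_sets_lebesgue[OF S])
       (use der in \<open>auto simp: differentiable_on_def differentiable_def intro: has_derivative_at_withinI\<close>)
  \<comment> \<open>The change of variables theorem takes integrands with values in a Cartesian
    power, so the scalar \<open>g\<close> is packed into \<open>real^1\<close> and component 1 is
    extracted afterwards.\<close>
  let ?G = "\<lambda>y. (vec (g y) :: real^1)"
  have gl: "integrable lebesgue g" using g(1) by (simp add: integrable_completion)
  have gS: "g absolutely_integrable_on f ` S"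
    unfolding set_integrable_def using gl fS
    using integrable_mult_indicator[of "f ` S" lebesgue g] by simp
  have G: "?G absolutely_integrable_on f ` S"
    using absolutely_integrable_componentwise_iff[where f="?G" and A="f ` S"] gS
    by (simp add: inner_axis Basis_vec_def)
  have *: "(\<lambda>x. \<bar>det (matrix (f' x))\<bar> *\<^sub>R ?G (f x)) absolutely_integrable_on S \<and>
      integral S (\<lambda>x. \<bar>det (matrix (f' x))\<bar> *\<^sub>R ?G (f x)) = integral (f ` S) ?G"
    by (subst has_absolute_integral_change_of_variables[OF S _ inj])
       (use der G in \<open>auto intro: has_derivative_at_withinI\<close>)
  let ?h = "\<lambda>x. \<bar>det (matrix (f' x))\<bar> * g (f x)"
  have h: "?h absolutely_integrable_on S"
    using absolutely_integrable_componentwise_iff[where f="\<lambda>x. \<bar>det (matrix (f' x))\<bar> *\<^sub>R ?G (f x)" and A=S] *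
    by (simp add: inner_axis Basis_vec_def)
  have hi: "?h integrable_on S" and gi: "g integrable_on f ` S"
    using h gS set_lebesgue_integral_eq_integral(1) by blast+
  have "integral S ?h = integral (f ` S) g"
  proof -
    have "integral S (\<lambda>x. \<bar>det (matrix (f' x))\<bar> *\<^sub>R ?G (f x)) $ 1 = integral S ?h"
      using integral_component_eq_cart[where k=1 and f="\<lambda>x. \<bar>det (matrix (f' x))\<bar> *\<^sub>R ?G (f x)" and s=S] *
        set_lebesgue_integral_eq_integral(1)[where S=S and f="\<lambda>x. \<bar>det (matrix (f' x))\<bar> *\<^sub>R ?G (f x)"] by simp
    moreover have "integral (f ` S) ?G $ 1 = integral (f ` S) g"
      using integral_component_eq_cart[where k=1 and f="?G" and s="f ` S"] G
        set_lebesgue_integral_eq_integral(1)[where S="f ` S" and f="?G"] by simp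
    ultimately show ?thesis using * by simp
  qed
  moreover have "(\<integral>\<^sup>+y. indicator (f ` S) y * ennreal (g y) \<partial>lebesgue) = integral (f ` S) g"
  proof -
    have "(\<integral>\<^sup>+y. indicator (f ` S) y * ennreal (g y) \<partial>lebesgue) =
        (\<integral>\<^sup>+y. ennreal (indicator (f ` S) y *\<^sub>R g y) \<partial>lebesgue)"
      by (intro nn_integral_cong) (auto simp: indicator_def)
    also have "\<dots> = ennreal (LINT y|lebesgue. indicator (f ` S) y *\<^sub>R g y)"
      using gS g(2) unfolding set_integrable_def
      by (intro nn_integral_eq_integral) auto
    finally show ?thesis
      using set_lebesgue_integral_eq_integral(2)[OF gS] by (simp add: set_lebesgue_integral_def)
  qed
  moreover have "(\<integral>\<^sup>+x. indicator S x * ennreal (?h x) \<partial>lebesgue) = integral S ?h"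
  proof -
    have "(\<integral>\<^sup>+y. indicator S y * ennreal (?h y) \<partial>lebesgue) =
        (\<integral>\<^sup>+y. ennreal (indicator S y *\<^sub>R ?h y) \<partial>lebesgue)"
      by (intro nn_integral_cong) (auto simp: indicator_def)
    also have "\<dots> = ennreal (LINT y|lebesgue. indicator S y *\<^sub>R ?h y)"
      using h g(2) unfolding set_integrable_def
      by (intro nn_integral_eq_integral) auto
    finally show ?thesis
      using set_lebesgue_integral_eq_integral(2)[OF h] by (simp add: set_lebesgue_integral_def)
  qed
  ultimately show "(\<integral>\<^sup>+y. indicator (f ` S) y * ennreal (g y) \<partial>lebesgue) =
         (\<integral>\<^sup>+x. indicator S x * ennreal (?h x) \<partial>lebesgue)" by simp
qed

text \<open>Each piece on which \<open>f\<close> is injective contributes one preimage of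
  \<open>y\<close> or none, which writes the multiplicity as a sum of indicators and so makes it
  measurable.\<close>

lemma suminf_ennreal_count:
  fixes E :: "nat \<Rightarrow> 'a set"
  assumes "disjoint_family E" "\<And>i. inj_on f (E i)"
  shows "(\<Sum>i. indicator (f ` E i) y) = emeasure (count_space UNIV) {z\<in>(\<Union>i. E i). f z = y}"
proof -
  let ?F = "\<lambda>i. {z\<in>E i. f z = y}"
  have "emeasure (count_space UNIV) {z\<in>(\<Union>i. E i). f z = y} = emeasure (count_space UNIV) (\<Union>i. ?F i)"
    by (rule arg_cong[where f="emeasure _"]) auto
  also have "\<dots> = (\<Sum>i. emeasure (count_space UNIV) (?F i))"
    using assms(1) by (intro suminf_emeasure[symmetric]) (auto simp: disjoint_family_on_def)
  also have "\<dots> = (\<Sum>i. indicator (f ` E i) y)"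
  proof (intro suminf_cong)
    fix i
    show "emeasure (count_space UNIV) (?F i) = indicator (f ` E i) y"
    proof (cases "y \<in> f ` E i")
      case True
      then obtain z where "z \<in> E i" "f z = y" by auto
      then have "?F i = {z}" using assms(2)[of i] by (auto simp: inj_on_def)
      then show ?thesis using True by simp
    next
      case False
      then have e: "?F i = {}" by auto
      show ?thesis unfolding e using False by (simp add: indicator_def)
    qed
  qed
  finally show ?thesis ..
qed

text \<open>Regular points are covered by countably many balls of injectivity, and the injective
  change of variables is summed over disjoint pieces of them. Critical points are lost on both
  sides: their image is null by Sard, and the Jacobian vanishes there. Images of Borel sets are only
  Lebesgue measurable here, hence the mixture of \<open>lebesgue\<close> and
  \<open>lborel\<close>.\<close>

theorem area_formula:
  fixes f :: "real^'n::{finite,wellorder} \<Rightarrow> real^'n::_"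
  assumes D: "D \<in> sets borel"
    and der: "\<And>x. (f has_derivative f' x) (at x)"
    and cont: "\<And>h. continuous_on UNIV (\<lambda>x. f' x h)"
    and g: "integrable lborel g" "\<And>x. 0 \<le> g x"
  obtains N where "N \<in> borel_measurable lebesgue"
    "AE y in lebesgue. N y = emeasure (count_space UNIV) {z\<in>D. f z = y}"
    "(\<integral>\<^sup>+y. N y * ennreal (g y) \<partial>lebesgue) =
     (\<integral>\<^sup>+x. indicator D x * ennreal (\<bar>det (matrix (f' x))\<bar> * g (f x)) \<partial>lborel)"
proof -
  define J where "J x = det (matrix (f' x))" for x
  define U where "U = {x. J x \<noteq> 0}"
  have contJ: "continuous_on UNIV J"
    unfolding J_def det_def matrix_def
    by (intro continuous_intros cont[THEN continuous_on_component, simplified] | simp)+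
  have "\<exists>r>0. inj_on f (ball a r)" if "a \<in> U" for a
    using locally_injective_if_det_nonzero[OF der cont, of a] that unfolding U_def J_def by blast
  then obtain r where r: "\<And>a. a \<in> U \<Longrightarrow> r a > 0 \<and> inj_on f (ball a (r a))" by metis
  obtain F where F: "F \<subseteq> insert {} ((\<lambda>a. ball a (r a)) ` U)" "countable F" "\<Union>F = \<Union>(insert {} ((\<lambda>a. ball a (r a)) ` U))"
    using Lindelof[of "insert {} ((\<lambda>a. ball a (r a)) ` U)"] by auto
  \<comment> \<open>The empty set keeps the family nonempty even without regular points, as
    enumeration by \<open>from_nat_into\<close> requires.\<close>
  define F' where "F' = insert {} F"
  have F': "countable F'" "F' \<noteq> {}" "U \<subseteq> \<Union>F'" "\<And>B. B \<in> F' \<Longrightarrow> open B \<and> inj_on f B"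
    using F r unfolding F'_def by (auto intro!: centre_in_ball[THEN iffD2])
  define B where "B = from_nat_into F'"
  have B: "B i \<in> F'" "range B = F'" for i
    using F' by (auto simp: B_def from_nat_into range_from_nat_into)
  define E where "E i = disjointed B i \<inter> U \<inter> D" for i
  have Eb: "E i \<in> sets borel" for i
  proof -
    have "range B \<subseteq> sets borel" using B F' by auto
    then have "disjointed B i \<in> sets borel" using sets.range_disjointed_sets[of B borel] by auto
    moreover have "U \<in> sets borel"
      unfolding U_def using borel_measurable_continuous_onI[OF contJ] by measurable
    ultimately show ?thesis using D by (auto simp: E_def)
  qed
  have disj: "disjoint_family E"
    using disjoint_family_disjointed[of B] by (auto simp: E_def disjoint_family_on_def)
  have injE: "inj_on f (E i)" for i
    using F'(4)[OF B(1)[of i]] disjointed_subset[of B i] by (auto simp: E_def intro: inj_on_subset)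
  have UE: "(\<Union>i. E i) = U \<inter> D"
    using F'(3) B(2) UN_disjointed_eq[of B] by (auto simp: E_def)
  define N where "N y = (\<Sum>i. indicator (f ` E i) y :: ennreal)" for y
  have El: "E i \<in> sets lebesgue" for i using Eb[of i] by (auto intro!: sets_completionI_sets)
  note im = nn_integral_image_injective[OF El der injE g]
  have 1: "N \<in> borel_measurable lebesgue"
    unfolding N_def using im(1) by measurable
  have Neq: "N y = emeasure (count_space UNIV) {z\<in>U \<inter> D. f z = y}" for y
    unfolding N_def using suminf_ennreal_count[OF disj injE] UE by simp
  have "negligible (f ` (- U))"
  proof (rule baby_Sard)
    fix x assume x: "x \<in> - U"
    show "(f has_derivative f' x) (at x within - U)" using der by (rule has_derivative_at_withinI)
    have "linear (f' x)" using der has_derivative_linear by blast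
    then show "rank (matrix (f' x)) < CARD('n)"
      using x by (auto simp: U_def J_def less_rank_noninjective det_nz_iff_inj)
  qed auto
  then have "f ` (- U) \<in> null_sets lebesgue" by (simp add: negligible_iff_null_sets)
  then have 2: "AE y in lebesgue. N y = emeasure (count_space UNIV) {z\<in>D. f z = y}"
  proof (rule AE_I')
    show "{y \<in> space lebesgue. N y \<noteq> emeasure (count_space UNIV) {z \<in> D. f z = y}} \<subseteq> f ` (- U)"
    proof (safe, rule ccontr)
      fix y assume a: "N y \<noteq> emeasure (count_space UNIV) {z \<in> D. f z = y}" "y \<notin> f ` (- U)"
      then have "{z\<in>U \<inter> D. f z = y} = {z\<in>D. f z = y}" by auto
      with a Neq show False by simp
    qed
  qed
  have gl: "g \<in> borel_measurable lebesgue" using g(1) by (intro measurable_completion) auto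
  let ?h = "\<lambda>x. ennreal (\<bar>J x\<bar> * g (f x))"
  have cf: "f \<in> borel_measurable borel"
    using der by (intro borel_measurable_continuous_onI)
      (auto simp: continuous_on_eq_continuous_within intro: has_derivative_continuous)
  have gb: "g \<in> borel_measurable borel" using g(1) by auto
  have Jb: "J \<in> borel_measurable borel" by (rule borel_measurable_continuous_onI[OF contJ])
  have hb: "?h \<in> borel_measurable lborel"
    using cf gb Jb by measurable
  have "(\<integral>\<^sup>+y. N y * ennreal (g y) \<partial>lebesgue) = (\<integral>\<^sup>+y. (\<Sum>i. indicator (f ` E i) y * ennreal (g y)) \<partial>lebesgue)"
    by (simp add: N_def)
  also have "\<dots> = (\<Sum>i. \<integral>\<^sup>+y. indicator (f ` E i) y * ennreal (g y) \<partial>lebesgue)"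
    using im(1) gl by (intro nn_integral_suminf) auto
  also have "\<dots> = (\<Sum>i. \<integral>\<^sup>+x. indicator (E i) x * ?h x \<partial>lborel)"
    using im(2) unfolding nn_integral_completion J_def by simp
  also have "\<dots> = (\<integral>\<^sup>+x. (\<Sum>i. indicator (E i) x * ?h x) \<partial>lborel)"
    using Eb hb by (intro nn_integral_suminf[symmetric]) auto
  also have "\<dots> = (\<integral>\<^sup>+x. indicator (\<Union>i. E i) x * ?h x \<partial>lborel)"
    by (simp add: suminf_indicator[OF disj])
  also have "\<dots> = (\<integral>\<^sup>+x. indicator D x * ?h x \<partial>lborel)"
    unfolding UE by (intro nn_integral_cong) (auto simp: indicator_def U_def)
  finally have 3: "(\<integral>\<^sup>+y. N y * ennreal (g y) \<partial>lebesgue) = (\<integral>\<^sup>+x. indicator D x * ?h x \<partial>lborel)" .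
  from 1 2 3 show thesis using that unfolding J_def by blast
qed

section \<open>Gaussian moments and reproducing kernels of cubics\<close>

lemma measurable_vec_PiM[measurable]:
  fixes e :: "'n::finite \<Rightarrow> 'j"
  assumes e: "\<And>i. e i \<in> J"
  shows "(\<lambda>f. \<chi> i. f (e i)) \<in> measurable (\<Pi>\<^sub>M j\<in>J. (lborel :: real measure)) borel"
proof (rule borel_measurable_euclidean_space[THEN iffD2], safe)
  fix b :: "real^'n" assume "b \<in> Basis"
  then obtain i where b: "b = axis i 1" by (auto simp: Basis_vec_def)
  show "(\<lambda>x. (\<chi> i. x (e i)) \<bullet> b) \<in> borel_measurable (\<Pi>\<^sub>M j\<in>J. (lborel :: real measure))"
    unfolding b using e by (simp add: inner_axis) measurable
qed

text \<open>Lebesgue measure is characterised by its values on boxes, and these factorise. An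
  arbitrary index set \<open>J\<close> is allowed so that products over natural numbers can serve
  for every dimension type.\<close>

lemma lborel_eq_distr_PiM:
  fixes e :: "'n::finite \<Rightarrow> 'j"
  assumes e: "bij_betw e UNIV J"
  shows "(lborel :: (real^'n) measure) = distr (\<Pi>\<^sub>M j\<in>J. lborel) borel (\<lambda>f. \<chi> i. f (e i))"
proof (rule lborel_eqI)
  interpret product_sigma_finite "\<lambda>_::'j. lborel :: real measure" by standard
  have fin: "finite J" using bij_betw_finite[OF e] by simp
  have eJ: "e i \<in> J" for i using e by (auto simp: bij_betw_def)
  have meas: "(\<lambda>f. \<chi> i. f (e i)) \<in> measurable (\<Pi>\<^sub>M j\<in>J. (lborel :: real measure)) borel"
    by (rule measurable_vec_PiM) (rule eJ)
  fix l u :: "real^'n" assume lu: "\<And>b. b \<in> Basis \<Longrightarrow> l \<bullet> b \<le> u \<bullet> b"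
  define d where "d = inv_into UNIV e"
  have de: "d (e i) = i" for i using e by (auto simp: d_def bij_betw_def)
  have ed: "j \<in> J \<Longrightarrow> e (d j) = j" for j using e by (auto simp: d_def bij_betw_def f_inv_into_f)
  have sp: "space (\<Pi>\<^sub>M j\<in>J. (lborel :: real measure)) = extensional J"
    by (auto simp: space_PiM PiE_def)
  have A: "(\<lambda>f. \<chi> i. f (e i)) -` box l u \<inter> space (\<Pi>\<^sub>M j\<in>J. (lborel :: real measure))
      = (\<Pi>\<^sub>E j\<in>J. box (l $ d j) (u $ d j))" (is "?L = ?R")
  proof (intro set_eqI iffI)
    fix f assume f: "f \<in> ?L"
    then have "l $ i < f (e i) \<and> f (e i) < u $ i" for i
      by (auto simp: mem_box_cart)
    then have "\<forall>j\<in>J. l $ d j < f j \<and> f j < u $ d j"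
      using ed by metis
    moreover have "f \<in> extensional J" using f unfolding sp by blast
    ultimately show "f \<in> ?R" by (simp add: PiE_def)
  next
    fix f assume f: "f \<in> ?R"
    then have "l $ d (e i) < f (e i) \<and> f (e i) < u $ d (e i)" for i
      using eJ[of i] by (auto simp: PiE_iff)
    then have "(\<chi> i. f (e i)) \<in> box l u" by (simp add: mem_box_cart de)
    moreover have "f \<in> extensional J" using f by (simp add: PiE_def)
    ultimately show "f \<in> ?L" unfolding sp by blast
  qed
  have B: "emeasure (\<Pi>\<^sub>M j\<in>J. (lborel :: real measure)) ?R = (\<Prod>j\<in>J. emeasure lborel (box (l $ d j) (u $ d j)))"
    by (rule emeasure_PiM[OF fin]) simp
  also have "\<dots> = (\<Prod>j\<in>J. ennreal (u $ d j - l $ d j))"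
  proof (intro prod.cong refl)
    fix j
    have "l $ d j \<le> u $ d j" using lu[of "axis (d j) 1"] by (simp add: inner_axis)
    then show "emeasure lborel (box (l $ d j) (u $ d j)) = ennreal (u $ d j - l $ d j)" by simp
  qed
  also have "\<dots> = (\<Prod>i\<in>UNIV. ennreal (u $ i - l $ i))"
    using prod.reindex_bij_betw[OF e, of "\<lambda>j. ennreal (u $ d j - l $ d j)"] by (simp add: de)
  also have "\<dots> = ennreal (\<Prod>i\<in>UNIV. u $ i - l $ i)"
  proof (rule prod_ennreal)
    fix i show "0 \<le> u $ i - l $ i" using lu[of "axis i 1"] by (simp add: inner_axis)
  qed
  also have "(\<Prod>i\<in>UNIV. u $ i - l $ i) = (\<Prod>b\<in>Basis. (u - l) \<bullet> b)"
  proof -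
    have "bij_betw (\<lambda>i::'n. axis i (1::real)) UNIV Basis"
      by (auto simp: bij_betw_def Basis_vec_def inj_on_def axis_eq_axis)
    from prod.reindex_bij_betw[OF this, of "\<lambda>b. (u - l) \<bullet> b"] show ?thesis by (simp add: inner_axis)
  qed
  finally have C: "emeasure (\<Pi>\<^sub>M j\<in>J. (lborel :: real measure)) ?R = ennreal (\<Prod>b\<in>Basis. (u - l) \<bullet> b)" .
  have "emeasure (distr (\<Pi>\<^sub>M j\<in>J. lborel) borel (\<lambda>f. \<chi> i. f (e i))) (box l u)
      = emeasure (\<Pi>\<^sub>M j\<in>J. (lborel :: real measure)) ?R"
    unfolding A[symmetric] by (rule emeasure_distr[OF meas]) simp
  with C show "emeasure (distr (\<Pi>\<^sub>M j\<in>J. lborel) borel (\<lambda>f. \<chi> i. f (e i))) (box l u)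
      = ennreal (\<Prod>b\<in>Basis. (u - l) \<bullet> b)" by (rule trans[rotated])
qed simp

section \<open>Gaussian moments and Wick's formula\<close>

definition std_moment :: "nat \<Rightarrow> real" where
  "std_moment k = (LINT t|lborel. std_normal_density t * t ^ k)"

text \<open>Gaussian integration by parts, here read off from the closed forms of the moments. At
  \<open>k = 0\<close> the truncated \<open>k - 1\<close> is harmless because the factor
  \<open>k\<close> vanishes.\<close>

lemma std_moment_rec: "std_moment (Suc k) = real k * std_moment (k - 1)"
proof (cases "even k")
  case True
  then obtain m where "k = 2 * m" by auto
  then show ?thesis
  proof (cases m)
    case 0
    then show ?thesis using \<open>k = 2 * m\<close> integral_std_normal_moment_odd[of 0] by (simp add: std_moment_def)
  next
    case (Suc l)
    then have "k - 1 = 2 * l + 1" "Suc k = 2 * (Suc l) + 1" using \<open>k = 2 * m\<close> by auto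
    then show ?thesis using integral_std_normal_moment_odd[of l] integral_std_normal_moment_odd[of "Suc l"]
      by (simp only: std_moment_def)
  qed
next
  case False
  then obtain m where k: "k = 2 * m + 1" by (auto elim: oddE)
  then have "Suc k = 2 * (Suc m)" by simp
  then have "std_moment (Suc k) = fact (2 * Suc m) / (2 ^ Suc m * fact (Suc m))"
    using integral_std_normal_moment_even[of "Suc m"] by (simp only: std_moment_def)
  moreover have "std_moment (k - 1) = fact (2 * m) / (2 ^ m * fact m)"
    using k integral_std_normal_moment_even[of m] by (simp add: std_moment_def)
  moreover have "fact (2 * Suc m) / (2 ^ Suc m * fact (Suc m)) = real (2 * m + 1) * (fact (2 * m) / (2 ^ m * fact m))"
    by (simp add: divide_simps)
  ultimately show ?thesis using k by simp
qed

lemma std_moment_0: "std_moment 0 = 1"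
  using integral_std_normal_moment_even[of 0] by (simp add: std_moment_def)

lemma integrable_std_moment: "integrable lborel (\<lambda>t. std_normal_density t * t ^ k)"
  using integrable_std_normal_moment by simp

definition gauss_density :: "real^'n \<Rightarrow> real" where
  "gauss_density v = (\<Prod>i\<in>UNIV. std_normal_density (v $ i))"

lemma gauss_density_inner: "gauss_density v = (1 / sqrt (2 * pi)) ^ CARD('n) * exp (- (v \<bullet> v) / 2)" for v :: "real^'n"
proof -
  have "gauss_density v = (\<Prod>i\<in>(UNIV::'n set). 1 / sqrt (2 * pi)) * (\<Prod>i\<in>UNIV. exp (- (v $ i)\<^sup>2 / 2))"
    unfolding gauss_density_def std_normal_density_def by (rule prod.distrib)
  also have "(\<Prod>i\<in>UNIV. exp (- (v $ i)\<^sup>2 / 2)) = exp (- (v \<bullet> v) / 2)"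
    unfolding exp_sum[OF finite_class.finite_UNIV, symmetric] inner_vec_def inner_real_def
    by (simp add: sum_negf sum_divide_distrib power2_eq_square)
  finally show ?thesis by simp
qed

lemma gauss_density_nonneg: "0 \<le> gauss_density v"
  by (simp add: gauss_density_def prod_nonneg)

lemma gauss_density_borel[measurable]: "gauss_density \<in> borel_measurable borel"
  unfolding gauss_density_def[abs_def] by measurable

text \<open>This constant serves twice: as the normalisation on \<open>real^4\<close>, and as the
  density contributed by the four zero coordinates of a cubic vanishing on the base plane.\<close>

lemma std_normal_density_0_pow4: "std_normal_density 0 ^ 4 = 1 / (4 * pi\<^sup>2)"
proof -
  have "sqrt (2 * pi) ^ 4 = ((sqrt (2 * pi))\<^sup>2)\<^sup>2" by (simp only: power_mult[symmetric]) simp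
  also have "(sqrt (2 * pi))\<^sup>2 = 2 * pi" by simp
  also have "(2 * pi)\<^sup>2 = 4 * pi\<^sup>2" by (simp add: power2_eq_square)
  finally show ?thesis by (simp add: std_normal_density_def power_divide)
qed

definition gauss_int :: "(real^4 \<Rightarrow> real) \<Rightarrow> real" where
  "gauss_int f = (LINT x|lborel. f x * gauss_density x)"

lemma exp_eq_gauss_density: "exp (- (norm x)\<^sup>2 / 2) = 4 * pi\<^sup>2 * gauss_density x" for x :: "real^4"
  using std_normal_density_0_pow4
  by (simp add: gauss_density_inner power2_norm_eq_inner std_normal_density_def)

text \<open>The prefactor \<open>1 / (2 * pi^2)\<close> is twice the normalisation
  \<open>1 / (2 * pi)^2\<close> of the standard Gaussian on four-space.\<close>

lemma L2_prod_eq: "L2_prod f g = 2 * gauss_int (\<lambda>x. f x * g x)"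
proof -
  have "(LINT x|lborel. f x * g x * exp (- (norm x)\<^sup>2 / 2))
      = (LINT x|lborel. (4 * pi\<^sup>2) * (f x * g x * gauss_density x))"
    by (intro Bochner_Integration.integral_cong refl) (simp only: exp_eq_gauss_density mult_ac)
  also have "\<dots> = 4 * pi\<^sup>2 * gauss_int (\<lambda>x. f x * g x)"
    unfolding gauss_int_def by (rule integral_mult_right_zero)
  finally show ?thesis by (simp add: L2_prod_def field_simps)
qed

definition gauss_integrable :: "(real^4 \<Rightarrow> real) \<Rightarrow> bool" where
  "gauss_integrable f \<longleftrightarrow> integrable lborel (\<lambda>x. f x * gauss_density x)"

lemma gauss_integrable_sum:
  assumes "\<And>i. i \<in> A \<Longrightarrow> gauss_integrable (f i)"
  shows "gauss_integrable (\<lambda>x. \<Sum>i\<in>A. f i x)"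
    and "gauss_int (\<lambda>x. \<Sum>i\<in>A. f i x) = (\<Sum>i\<in>A. gauss_int (f i))"
  using assms by (auto simp: gauss_integrable_def gauss_int_def sum_distrib_right
      intro!: Bochner_Integration.integral_sum)

lemma gauss_integrable_cmult:
  assumes "gauss_integrable f"
  shows "gauss_integrable (\<lambda>x. c * f x)" and "gauss_int (\<lambda>x. c * f x) = c * gauss_int f"
  using assms by (auto simp: gauss_integrable_def gauss_int_def mult.assoc)

lemma gauss_monomial:
  fixes a :: "4 \<Rightarrow> nat"
  shows "gauss_integrable (\<lambda>x. \<Prod>i\<in>UNIV. (x $ i) ^ a i)"
    and "gauss_int (\<lambda>x. \<Prod>i\<in>UNIV. (x $ i) ^ a i) = (\<Prod>i\<in>UNIV. std_moment (a i))"
proof -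
  interpret product_sigma_finite "\<lambda>_::4. lborel :: real measure" by standard
  let ?g = "\<lambda>x::real^4. (\<Prod>i\<in>UNIV. (x $ i) ^ a i) * gauss_density x"
  have eq: "(lborel :: (real^4) measure) = distr (\<Pi>\<^sub>M j\<in>UNIV. lborel) borel (\<lambda>f. \<chi> i. f i)"
    using lborel_eq_distr_PiM[of "\<lambda>i::4. i" UNIV] by (simp add: bij_betw_def)
  have m: "(\<lambda>f. \<chi> i. f i) \<in> measurable (\<Pi>\<^sub>M j\<in>UNIV. (lborel :: real measure)) (borel :: (real^4) measure)"
    by (rule measurable_vec_PiM) simp
  have gm: "?g \<in> borel_measurable borel" unfolding gauss_density_def by measurable
  have g: "?g (\<chi> i. f i) = (\<Prod>i\<in>UNIV. std_normal_density (f i) * f i ^ a i)" for f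
    by (simp add: gauss_density_def prod.distrib mult.commute)
  have "integrable (\<Pi>\<^sub>M j\<in>UNIV. lborel) (\<lambda>f. \<Prod>i\<in>(UNIV::4 set). std_normal_density (f i) * f i ^ a i)"
    by (intro product_integrable_prod integrable_std_moment) simp
  then show "gauss_integrable (\<lambda>x. \<Prod>i\<in>UNIV. (x $ i) ^ a i)"
    unfolding gauss_integrable_def by (subst eq, subst integrable_distr_eq[OF m gm]) (simp only: g)
  show "gauss_int (\<lambda>x. \<Prod>i\<in>UNIV. (x $ i) ^ a i) = (\<Prod>i\<in>UNIV. std_moment (a i))"
    unfolding gauss_int_def
    apply (subst eq, subst integral_distr[OF m gm])
    apply (simp only: g std_moment_def)
    apply (intro product_integral_prod integrable_std_moment)
    apply simp
    done
qed

lemma prod_list_power: "(\<Prod>j\<leftarrow>L. y j) = (\<Prod>i\<in>UNIV. y i ^ count_list L i)"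
  for y :: "'i::finite \<Rightarrow> 'a::comm_monoid_mult"
proof (induction L)
  case (Cons k L)
  have "(\<Prod>i\<in>UNIV. y i ^ count_list (k # L) i) = (\<Prod>i\<in>UNIV. (if i = k then y i else 1) * y i ^ count_list L i)"
    by (intro prod.cong) auto
  also have "\<dots> = y k * (\<Prod>i\<in>UNIV. y i ^ count_list L i)"
    by (simp add: prod.distrib)
  finally show ?case using Cons by simp
qed simp

text \<open>Monomials are lists of indices rather than exponent vectors, since pairing off factors
  means deleting list entries.\<close>

definition wick :: "4 list \<Rightarrow> real" where
  "wick L = gauss_int (\<lambda>x. \<Prod>j\<leftarrow>L. x $ j)"

lemma gauss_integrable_list: "gauss_integrable (\<lambda>x. \<Prod>j\<leftarrow>L. x $ j)"
  by (simp add: prod_list_power gauss_monomial)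

lemma wick_eq: "wick L = (\<Prod>i\<in>UNIV. std_moment (count_list L i))"
  by (simp add: wick_def prod_list_power gauss_monomial)

lemma wick_Nil: "wick [] = 1"
  by (simp add: wick_eq std_moment_0)

text \<open>Isserlis' recursion: the first factor is paired with every later equal one. The moment
  recursion supplies the factor \<open>count_list L i\<close>, which is the number of such
  positions.\<close>

lemma wick_Cons:
  "wick (i # L) = (\<Sum>p<length L. if L ! p = i then wick (take p L @ drop (Suc p) L) else 0)"
proof -
  let ?R = "\<Prod>j\<in>UNIV - {i}. std_moment (count_list L j)"
  have split: "(\<Prod>j\<in>UNIV. h j) = h i * (\<Prod>j\<in>UNIV - {i}. h j)" for h :: "4 \<Rightarrow> real"
    by (rule prod.remove) auto
  have w: "wick (take p L @ drop (Suc p) L) = std_moment (count_list L i - 1) * ?R"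
    if p: "p < length L" "L ! p = i" for p
  proof -
    have L: "L = take p L @ i # drop (Suc p) L" using p id_take_nth_drop by metis
    have "count_list L j = count_list (take p L @ drop (Suc p) L) j + (if j = i then 1 else 0)" for j
      by (subst L) simp
    then have c: "count_list (take p L @ drop (Suc p) L) j = (if j = i then count_list L i - 1 else count_list L j)" for j
      by auto
    show ?thesis unfolding wick_eq split c by (auto intro!: prod.cong)
  qed
  have "wick (i # L) = std_moment (Suc (count_list L i)) * ?R"
    unfolding wick_eq split by (auto intro!: prod.cong)
  also have "\<dots> = real (count_list L i) * (std_moment (count_list L i - 1) * ?R)"
    by (simp add: std_moment_rec)
  also have "real (count_list L i) = (\<Sum>p<length L. if L ! p = i then 1 else 0)"
    by (simp add: count_list_eq_length_filter length_filter_conv_card sum.If_cases Int_def lessThan_def eq_commute)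
  also have "\<dots> * (std_moment (count_list L i - 1) * ?R) =
      (\<Sum>p<length L. if L ! p = i then wick (take p L @ drop (Suc p) L) else 0)"
    unfolding sum_distrib_right by (intro sum.cong) (auto simp: w)
  finally show ?thesis .
qed

definition dl :: "4 \<Rightarrow> 4 \<Rightarrow> real" where "dl i j = (if i = j then 1 else 0)"

lemma dl_same[simp]: "dl i i = 1"
  by (simp add: dl_def)

lemma dl_commute: "dl i j = dl j i"
  by (simp add: dl_def)

lemma wick_Cons_dl:
  "wick (i # L) = (\<Sum>p<length L. dl i (L ! p) * wick (take p L @ drop (Suc p) L))"
  unfolding wick_Cons by (intro sum.cong) (auto simp: dl_def)

lemma wick2: "wick [i, j] = dl i j"
  by (subst wick_Cons_dl, simp)+ (simp add: wick_Nil)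

lemma wick4: "wick [i, j, k, l] = dl i j * dl k l + dl i k * dl j l + dl i l * dl j k"
  by (subst wick_Cons_dl) (simp add: wick2 lessThan_Suc algebra_simps)

lemma wick6:
  "wick [i, j, k, l, m, n] =
    dl i j * (dl k l * dl m n + dl k m * dl l n + dl k n * dl l m) +
    dl i k * (dl j l * dl m n + dl j m * dl l n + dl j n * dl l m) +
    dl i l * (dl j k * dl m n + dl j m * dl k n + dl j n * dl k m) +
    dl i m * (dl j k * dl l n + dl j l * dl k n + dl j n * dl k l) +
    dl i n * (dl j k * dl l m + dl j l * dl k m + dl j m * dl k l)"
  by (subst wick_Cons_dl) (simp add: wick4 lessThan_Suc algebra_simps)

section \<open>Cubic forms as three-index arrays\<close>

lemma sum_dl: "(\<Sum>n\<in>UNIV. g n * dl i n) = g i" "(\<Sum>n\<in>UNIV. g n * dl n i) = g i"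
  "(\<Sum>n\<in>UNIV. dl i n * g n) = g i" "(\<Sum>n\<in>UNIV. dl n i * g n) = g i"
  for g :: "4 \<Rightarrow> real"
  by (simp_all add: dl_def if_distrib[where f="(*) _"] if_distrib[where f="\<lambda>x. x * _"] cong: if_cong)

definition tensor :: "(4 \<Rightarrow> 4 \<Rightarrow> 4 \<Rightarrow> real) \<Rightarrow> real^4 \<Rightarrow> real" where
  "tensor t x = (\<Sum>i\<in>UNIV. \<Sum>j\<in>UNIV. \<Sum>k\<in>UNIV. t i j k * (x $ i * x $ j * x $ k))"

text \<open>Three times the trace of the symmetrised array. Up to a factor 2 it gives the
  coefficients of the Laplacian of the cubic.\<close>

definition contr :: "(4 \<Rightarrow> 4 \<Rightarrow> 4 \<Rightarrow> real) \<Rightarrow> 4 \<Rightarrow> real" where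
  "contr t k = (\<Sum>m\<in>UNIV. t k m m + t m k m + t m m k)"

lemma tensor_add: "tensor t x + tensor u x = tensor (\<lambda>i j k. t i j k + u i j k) x"
  by (simp add: tensor_def sum.distrib distrib_right)

lemma tensor_cmult: "c * tensor t x = tensor (\<lambda>i j k. c * t i j k) x"
  by (simp add: tensor_def sum_distrib_left mult.assoc)

lemma contr_add: "contr (\<lambda>i j k. t i j k + u i j k) k = contr t k + contr u k"
  by (simp add: contr_def sum.distrib[symmetric] algebra_simps)

lemma contr_cmult: "contr (\<lambda>i j k. c * t i j k) k = c * contr t k"
  by (simp add: contr_def sum_distrib_left algebra_simps)

text \<open>Of the fifteen pairings, nine join two of \<open>i\<close>, \<open>j\<close>,
  \<open>k\<close> and therefore two of \<open>l\<close>, \<open>m\<close>, \<open>n\<close>; they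
  assemble into \<open>contr u\<close>. The other six match the two triples with each other and give
  the permutations of \<open>u\<close>.\<close>

lemma wick6_contract:
  "(\<Sum>l\<in>UNIV. \<Sum>m\<in>UNIV. \<Sum>n\<in>UNIV. u l m n * wick [i, j, k, l, m, n]) =
    dl i j * contr u k + dl i k * contr u j + dl j k * contr u i +
    (u i j k + u i k j + u j i k + u j k i + u k i j + u k j i)"
proof -
  have d0: "(\<Sum>n\<in>UNIV. c * g n) = c * (\<Sum>n\<in>UNIV. g n)" for c :: real and g :: "4 \<Rightarrow> real"
    by (simp add: sum_distrib_left)
  have e: "u l m n * wick [i, j, k, l, m, n] =
     dl i j * (u l m n * dl m n * dl k l + u l m n * dl l n * dl k m + u l m n * dl k n * dl l m) +
     dl i k * (u l m n * dl m n * dl j l + u l m n * dl l n * dl j m + u l m n * dl j n * dl l m) +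
     dl j k * (u l m n * dl m n * dl i l + u l m n * dl l n * dl i m + u l m n * dl i n * dl l m) +
     (u l m n * dl k n * dl j m * dl i l + u l m n * dl j n * dl k m * dl i l
    + u l m n * dl k n * dl i m * dl j l + u l m n * dl i n * dl k m * dl j l
    + u l m n * dl j n * dl i m * dl k l + u l m n * dl i n * dl j m * dl k l)" for l m n
    unfolding wick6 by (simp only: algebra_simps)
  have s: "(\<Sum>n\<in>UNIV. f n * c) = (\<Sum>n\<in>UNIV. f n) * c" for f :: "4 \<Rightarrow> real" and c
    by (simp add: sum_distrib_right)
  have c: "contr u k = (\<Sum>m\<in>UNIV. u k m m) + (\<Sum>m\<in>UNIV. u m k m) + (\<Sum>m\<in>UNIV. u m m k)" for k
    by (simp only: contr_def sum.distrib)
  show ?thesis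
    unfolding e c by (simp only: sum.distrib d0 sum_dl s)
qed

lemma gauss_int_tensor:
  shows "gauss_integrable (\<lambda>x. tensor t x * tensor u x)"
    and "gauss_int (\<lambda>x. tensor t x * tensor u x) =
      (\<Sum>i\<in>UNIV. \<Sum>j\<in>UNIV. \<Sum>k\<in>UNIV. t i j k *
        (dl i j * contr u k + dl i k * contr u j + dl j k * contr u i +
        (u i j k + u i k j + u j i k + u j k i + u k i j + u k j i)))"
proof -
  have e: "tensor t x * tensor u x = (\<Sum>i\<in>UNIV. \<Sum>j\<in>UNIV. \<Sum>k\<in>UNIV. t i j k *
      (\<Sum>l\<in>UNIV. \<Sum>m\<in>UNIV. \<Sum>n\<in>UNIV. u l m n * (\<Prod>p\<leftarrow>[i, j, k, l, m, n]. x $ p)))" for x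
  proof -
    have "(x $ i * x $ j * x $ k) * tensor u x =
      (\<Sum>l\<in>UNIV. \<Sum>m\<in>UNIV. \<Sum>n\<in>UNIV. u l m n * (\<Prod>p\<leftarrow>[i, j, k, l, m, n]. x $ p))" for i j k
      unfolding tensor_def sum_distrib_left by (simp add: ac_simps)
    moreover have "tensor t x * tensor u x = (\<Sum>i\<in>UNIV. \<Sum>j\<in>UNIV. \<Sum>k\<in>UNIV. t i j k *
        ((x $ i * x $ j * x $ k) * tensor u x))"
      by (simp only: tensor_def[of t] sum_distrib_right mult.assoc)
    ultimately show ?thesis by simp
  qed
  note gi = gauss_integrable_list gauss_integrable_sum(1) gauss_integrable_cmult(1)
  show "gauss_integrable (\<lambda>x. tensor t x * tensor u x)"
    unfolding e by (intro gi)
  show "gauss_int (\<lambda>x. tensor t x * tensor u x) =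
      (\<Sum>i\<in>UNIV. \<Sum>j\<in>UNIV. \<Sum>k\<in>UNIV. t i j k *
        (dl i j * contr u k + dl i k * contr u j + dl j k * contr u i +
        (u i j k + u i k j + u j i k + u j k i + u k i j + u k j i)))"
    unfolding e wick6_contract[symmetric] wick_def
    by (subst gauss_integrable_sum(2) gauss_integrable_cmult(2), (intro gi)[1])+ (rule refl)
qed

text \<open>The harmonic projection of the cube of \<open>x \<bullet> y\<close>, divided by 12. The
  cube has trace \<open>3 * y * (y \<bullet> y)\<close> and the radial array has trace
  \<open>6 * y\<close>, hence the correction with coefficient one half; the 12 normalises the
  reproducing property.\<close>

definition zonal :: "real^4 \<Rightarrow> 4 \<Rightarrow> 4 \<Rightarrow> 4 \<Rightarrow> real" where
  "zonal y i j k = (y $ i * y $ j * y $ k - (y $ i * dl j k) * (y \<bullet> y) / 2) / 12"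

definition radial :: "(real^4) \<Rightarrow> 4 \<Rightarrow> 4 \<Rightarrow> 4 \<Rightarrow> real" where
  "radial y i j k = y $ i * dl j k"

lemma tensor_radial: "tensor (radial y) x = (x \<bullet> y) * (x \<bullet> x)"
proof -
  have "tensor (radial y) x = (\<Sum>i\<in>UNIV. \<Sum>j\<in>UNIV. \<Sum>k\<in>UNIV. (y $ i * x $ i * x $ j * x $ k) * dl j k)"
    unfolding tensor_def radial_def by (simp only: ac_simps)
  also have "\<dots> = (\<Sum>i\<in>UNIV. \<Sum>j\<in>UNIV. y $ i * x $ i * x $ j * x $ j)"
    by (simp only: sum_dl)
  also have "\<dots> = (\<Sum>i\<in>UNIV. \<Sum>j\<in>UNIV. (y $ i * x $ i) * (x $ j * x $ j))"
    by (simp only: mult.assoc)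
  also have "\<dots> = (x \<bullet> y) * (x \<bullet> x)"
    by (simp only: inner_vec_def inner_real_def sum_product) (simp only: ac_simps)
  finally show ?thesis .
qed

lemma tensor_cube: "tensor (\<lambda>i j k. y $ i * y $ j * y $ k) x = (x \<bullet> y) ^ 3"
proof -
  have "(x \<bullet> y) ^ 3 = (x \<bullet> y) * ((x \<bullet> y) * (x \<bullet> y))" by (simp add: power3_eq_cube)
  also have "\<dots> = (\<Sum>i\<in>UNIV. x $ i * y $ i * (\<Sum>j\<in>UNIV. x $ j * y $ j * (\<Sum>k\<in>UNIV. x $ k * y $ k)))"
    by (simp only: inner_vec_def inner_real_def sum_distrib_right)
  finally show ?thesis unfolding tensor_def sum_distrib_left by (simp only: ac_simps)
qed

lemma tensor_zonal: "tensor (zonal y) x = ((x \<bullet> y) ^ 3 - (x \<bullet> y) * (x \<bullet> x) * (y \<bullet> y) / 2) / 12"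
proof -
  have "zonal y = (\<lambda>i j k. (1/12) * (y $ i * y $ j * y $ k) + (- (y \<bullet> y) / 24) * radial y i j k)"
    by (intro ext) (simp add: zonal_def radial_def)
  then have "tensor (zonal y) x = (1/12) * (x \<bullet> y) ^ 3 + (- (y \<bullet> y) / 24) * ((x \<bullet> y) * (x \<bullet> x))"
    by (simp only: tensor_add[symmetric] tensor_cmult[symmetric] tensor_cube tensor_radial)
  then show ?thesis by (simp add: field_simps)
qed

lemma contr_radial: "contr (radial y) k = 6 * y $ k"
proof -
  have "contr (radial y) k = (\<Sum>m\<in>UNIV. y $ k * dl m m) + (\<Sum>m\<in>UNIV. y $ m * dl k m) + (\<Sum>m\<in>UNIV. y $ m * dl m k)"
    unfolding contr_def radial_def by (simp only: sum.distrib)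
  then show ?thesis by (simp only: sum_dl) simp
qed

lemma contr_zonal: "contr (zonal y) k = 0"
proof -
  have 1: "zonal y = (\<lambda>i j k. (1/12) * (y $ i * y $ j * y $ k) + (- (y \<bullet> y) / 24) * radial y i j k)"
    by (intro ext) (simp add: zonal_def radial_def)
  have "contr (\<lambda>i j k. y $ i * y $ j * y $ k) k = (\<Sum>m\<in>UNIV. 3 * (y $ k * (y $ m * y $ m)))"
    unfolding contr_def by (intro sum.cong) auto
  then have 2: "contr (\<lambda>i j k. y $ i * y $ j * y $ k) k = 3 * y $ k * (y \<bullet> y)"
    by (simp add: inner_vec_def sum_distrib_left mult.assoc)
  show ?thesis unfolding 1 contr_add contr_cmult 2 contr_radial by simp
qed

lemma sum_contr:
  "(\<Sum>i\<in>UNIV. \<Sum>j\<in>UNIV. \<Sum>k\<in>UNIV. t i j k * (dl i j * g k + dl i k * g j + dl j k * g i)) =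
   (\<Sum>k\<in>UNIV. contr t k * g k)"
proof -
  have s: "(\<Sum>i\<in>UNIV. \<Sum>j\<in>UNIV. h i j) = (\<Sum>j\<in>UNIV. \<Sum>i\<in>UNIV. h i j)" for h :: "4 \<Rightarrow> 4 \<Rightarrow> real"
    by (rule sum.swap)
  have "(\<Sum>i\<in>UNIV. \<Sum>j\<in>UNIV. \<Sum>k\<in>UNIV. t i j k * (dl i j * g k + dl i k * g j + dl j k * g i)) =
    (\<Sum>i\<in>UNIV. \<Sum>j\<in>UNIV. \<Sum>k\<in>UNIV. (t i j k * g j) * dl i k) +
    (\<Sum>i\<in>UNIV. \<Sum>j\<in>UNIV. \<Sum>k\<in>UNIV. (t i j k * g i) * dl j k) +
    (\<Sum>i\<in>UNIV. \<Sum>j\<in>UNIV. (\<Sum>k\<in>UNIV. (t i j k * g k)) * dl i j)"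
    by (simp only: sum.distrib[symmetric] sum_distrib_right) (simp only: algebra_simps)
  also have "\<dots> = (\<Sum>i\<in>UNIV. \<Sum>j\<in>UNIV. t i j i * g j) + (\<Sum>i\<in>UNIV. \<Sum>j\<in>UNIV. t i j j * g i)
     + (\<Sum>i\<in>UNIV. \<Sum>k\<in>UNIV. t i i k * g k)"
    by (simp only: sum_dl)
  also have "\<dots> = (\<Sum>k\<in>UNIV. \<Sum>m\<in>UNIV. t m k m * g k) + (\<Sum>k\<in>UNIV. \<Sum>m\<in>UNIV. t k m m * g k)
     + (\<Sum>k\<in>UNIV. \<Sum>m\<in>UNIV. t m m k * g k)"
    by (subst (1) s, subst (5) s) (rule refl)
  also have "\<dots> = (\<Sum>k\<in>UNIV. contr t k * g k)"
    by (simp add: contr_def sum.distrib sum_distrib_right distrib_right add_ac)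
  finally show ?thesis .
qed

text \<open>When both arrays are traceless, the contracted pairings disappear and only the six
  matchings survive; they evaluate \<open>t\<close> at \<open>y\<close>. Against a radial array the
  whole integral reduces to the trace of \<open>t\<close>, so harmonic cubics are orthogonal to
  multiples of the squared norm.\<close>

lemma reproducing:
  assumes "\<And>k. contr t k = 0"
  shows "L2_prod (tensor t) (tensor (zonal y)) = tensor t y"
    and "L2_prod (tensor t) (tensor (radial y)) = 0"
    and "L2_prod (tensor (radial y)) (tensor (zonal z)) = 0"
proof -
  have 1: "t i j k * (dl i j * 0 + dl i k * 0 + dl j k * 0 + (zonal y i j k + zonal y i k j + zonal y j i k + zonal y j k i + zonal y k i j + zonal y k j i))
    = (1/2) * (t i j k * (y $ i * y $ j * y $ k))
     + (- (y \<bullet> y) / 12) * (t i j k * (dl i j * y $ k + dl i k * y $ j + dl j k * y $ i))" for t :: "4 \<Rightarrow> 4 \<Rightarrow> 4 \<Rightarrow> real" and y i j k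
    unfolding zonal_def by (simp add: field_simps dl_commute)
  have 2: "t i j k * (dl i j * (6 * y $ k) + dl i k * (6 * y $ j) + dl j k * (6 * y $ i) + (radial y i j k + radial y i k j + radial y j i k + radial y j k i + radial y k i j + radial y k j i))
    = 8 * (t i j k * (dl i j * y $ k + dl i k * y $ j + dl j k * y $ i))" for t :: "4 \<Rightarrow> 4 \<Rightarrow> 4 \<Rightarrow> real" and y i j k
    unfolding radial_def by (simp add: algebra_simps dl_commute)
  have z: "gauss_int (\<lambda>x. tensor t x * tensor (zonal y) x) = (1/2) * tensor t y + (- (y \<bullet> y) / 12) * (\<Sum>k\<in>UNIV. contr t k * y $ k)" for t y
    unfolding gauss_int_tensor contr_zonal 1 sum.distrib sum_distrib_left[symmetric] sum_contr by (simp add: tensor_def)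
  have r: "gauss_int (\<lambda>x. tensor t x * tensor (radial y) x) = 8 * (\<Sum>k\<in>UNIV. contr t k * y $ k)" for t y
    unfolding gauss_int_tensor contr_radial 2 sum.distrib sum_distrib_left[symmetric] sum_contr by (simp add: tensor_def)
  show "L2_prod (tensor t) (tensor (zonal y)) = tensor t y"
    "L2_prod (tensor t) (tensor (radial y)) = 0"
    unfolding L2_prod_eq z r using assms by auto
  show "L2_prod (tensor (radial y)) (tensor (zonal z)) = 0"
    unfolding L2_prod_eq mult.commute[of "tensor (radial y) _"] r contr_zonal by simp
qed

text \<open>The constant is \<open>2 * 8 * 6\<close>: 2 from the normalisation of
  \<open>L2_prod\<close>, 8 from six units of trace plus two of matching, and 6 from the trace of a
  radial array.\<close>

lemma L2_radial: "L2_prod (tensor (radial y)) (tensor (radial z)) = 96 * (y \<bullet> z)"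
proof -
  have 2: "t i j k * (dl i j * (6 * y $ k) + dl i k * (6 * y $ j) + dl j k * (6 * y $ i) + (radial y i j k + radial y i k j + radial y j i k + radial y j k i + radial y k i j + radial y k j i))
    = 8 * (t i j k * (dl i j * y $ k + dl i k * y $ j + dl j k * y $ i))" for t :: "4 \<Rightarrow> 4 \<Rightarrow> 4 \<Rightarrow> real" and y i j k
    unfolding radial_def by (simp add: algebra_simps dl_commute)
  show ?thesis
    unfolding L2_prod_eq gauss_int_tensor contr_radial 2 sum_distrib_left[symmetric] sum_contr
    by (simp add: inner_vec_def sum_distrib_left)
qed

section \<open>Homogeneous and harmonic polynomials of degrees 1 and 3\<close>

lemma finite_exponents: "finite {a :: 4 \<Rightarrow> nat. (\<Sum>i\<in>UNIV. a i) = d}"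
proof (rule finite_subset)
  show "{a :: 4 \<Rightarrow> nat. (\<Sum>i\<in>UNIV. a i) = d} \<subseteq> PiE UNIV (\<lambda>_. {..d})"
    by (auto simp: PiE_iff intro: member_le_sum)
qed (intro finite_PiE; simp)

lemma homogeneous_poly_monomial:
  assumes "(\<Sum>i\<in>UNIV. a i) = d"
  shows "(\<lambda>x. \<Prod>i\<in>UNIV. (x $ i) ^ a i) \<in> homogeneous_poly d"
  unfolding homogeneous_poly_def
proof (rule CollectI, rule exI[of _ "\<lambda>b. if b = a then 1 else 0"], rule ext)
  fix x :: "real^4"
  have "(\<Sum>b | (\<Sum>i\<in>UNIV. b i) = d. (if b = a then 1 else 0) * (\<Prod>i\<in>UNIV. (x $ i) ^ b i))
     = (\<Sum>b | (\<Sum>i\<in>UNIV. b i) = d. if b = a then (\<Prod>i\<in>UNIV. (x $ i) ^ a i) else 0)"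
    by (intro sum.cong) auto
  also have "\<dots> = (\<Prod>i\<in>UNIV. (x $ i) ^ a i)"
    using assms by (subst sum.delta[OF finite_exponents]) simp
  finally show "(\<Prod>i\<in>UNIV. (x $ i) ^ a i) = (\<Sum>b | (\<Sum>i\<in>UNIV. b i) = d. (if b = a then 1 else 0) * (\<Prod>i\<in>UNIV. (x $ i) ^ b i))" ..
qed

lemma homogeneous_poly_cmult:
  assumes "f \<in> homogeneous_poly d" shows "(\<lambda>x. k * f x) \<in> homogeneous_poly d"
proof -
  obtain c where "f = (\<lambda>x. \<Sum>a | (\<Sum>i\<in>UNIV. a i) = d. c a * (\<Prod>i\<in>UNIV. (x $ i) ^ a i))"
    using assms by (auto simp: homogeneous_poly_def)
  then have "(\<lambda>x. k * f x) = (\<lambda>x. \<Sum>a | (\<Sum>i\<in>UNIV. a i) = d. (k * c a) * (\<Prod>i\<in>UNIV. (x $ i) ^ a i))"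
    by (simp add: sum_distrib_left mult.assoc)
  then show ?thesis unfolding homogeneous_poly_def mem_Collect_eq by (intro exI[of _ "\<lambda>a. k * c a"])
qed

lemma homogeneous_poly_add:
  assumes "f \<in> homogeneous_poly d" "g \<in> homogeneous_poly d"
  shows "(\<lambda>x. f x + g x) \<in> homogeneous_poly d"
proof -
  obtain c c' where "f = (\<lambda>x. \<Sum>a | (\<Sum>i\<in>UNIV. a i) = d. c a * (\<Prod>i\<in>UNIV. (x $ i) ^ a i))"
    "g = (\<lambda>x. \<Sum>a | (\<Sum>i\<in>UNIV. a i) = d. c' a * (\<Prod>i\<in>UNIV. (x $ i) ^ a i))"
    using assms by (auto simp: homogeneous_poly_def)
  then have "(\<lambda>x. f x + g x) = (\<lambda>x. \<Sum>a | (\<Sum>i\<in>UNIV. a i) = d. (c a + c' a) * (\<Prod>i\<in>UNIV. (x $ i) ^ a i))"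
    by (simp add: sum.distrib distrib_right)
  then show ?thesis unfolding homogeneous_poly_def mem_Collect_eq by (intro exI[of _ "\<lambda>a. c a + c' a"])
qed

lemma homogeneous_poly_sum:
  assumes "finite I" "I \<noteq> {}" "\<And>i. i \<in> I \<Longrightarrow> f i \<in> homogeneous_poly d"
  shows "(\<lambda>x. \<Sum>i\<in>I. f i x) \<in> homogeneous_poly d"
  using assms
proof (induction I rule: finite_ne_induct)
  case (singleton i)
  then show ?case using homogeneous_poly_cmult[of "f i" d 1] by simp
next
  case (insert i I)
  then show ?case using homogeneous_poly_add[of "f i" d "\<lambda>x. \<Sum>i\<in>I. f i x"] by simp
qed

lemma sum_count_list_UNIV: "(\<Sum>i\<in>UNIV. count_list L i) = length (L :: 'i::finite list)"
proof (induction L)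
  case (Cons k L)
  have "(\<Sum>i\<in>UNIV. count_list (k # L) i) = (\<Sum>i\<in>UNIV. (if i = k then 1 else 0) + count_list L i)"
    by (intro sum.cong) auto
  then show ?case using Cons by (simp add: sum.distrib)
qed simp

lemma homogeneous_poly_list:
  "(\<lambda>x. \<Prod>j\<leftarrow>L. x $ j) \<in> homogeneous_poly (length L)"
  unfolding prod_list_power by (rule homogeneous_poly_monomial) (simp add: sum_count_list_UNIV)

text \<open>An exponent vector is a multiset of indices, and any enumeration of that multiset gives
  the list.\<close>

lemma monomial_list:
  fixes a :: "4 \<Rightarrow> nat"
  assumes "(\<Sum>i\<in>UNIV. a i) = d"
  obtains L where "length L = d" "\<And>x::real^4. (\<Prod>i\<in>UNIV. (x $ i) ^ a i) = (\<Prod>j\<leftarrow>L. x $ j)"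
proof -
  have "\<exists>L. mset L = Abs_multiset a" by (rule ex_mset)
  then obtain L where L: "mset L = Abs_multiset a" ..
  then have c: "count_list L = a"
    by (simp add: count_mset[symmetric] fun_eq_iff)
  have "length L = d" using sum_count_list_UNIV[of L] assms by (simp add: c)
  moreover have "(\<Prod>i\<in>UNIV. (x $ i) ^ a i) = (\<Prod>j\<leftarrow>L. x $ j)" for x :: "real^4"
    by (simp add: prod_list_power c)
  ultimately show ?thesis using that by blast
qed

lemma tensor_dl:
  "tensor (\<lambda>i' j' k'. dl i i' * dl j j' * dl k k') x = x $ i * x $ j * x $ k"
proof -
  have "tensor (\<lambda>i' j' k'. dl i i' * dl j j' * dl k k') x =
    (\<Sum>i'\<in>UNIV. \<Sum>j'\<in>UNIV. \<Sum>k'\<in>UNIV. dl i i' * (dl j j' * (dl k k' * (x $ i' * x $ j' * x $ k'))))"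
    unfolding tensor_def by (simp only: ac_simps)
  also have "\<dots> = x $ i * x $ j * x $ k"
    by (simp only: sum_distrib_left[symmetric] sum_dl)
  finally show ?thesis .
qed

lemma tensor_sum: "(\<Sum>a\<in>A. tensor (t a) x) = tensor (\<lambda>i j k. \<Sum>a\<in>A. t a i j k) x"
proof -
  have "tensor (\<lambda>i j k. \<Sum>a\<in>A. t a i j k) x = (\<Sum>i\<in>UNIV. \<Sum>j\<in>UNIV. \<Sum>a\<in>A. \<Sum>k\<in>UNIV. t a i j k * (x $ i * x $ j * x $ k))"
    unfolding tensor_def sum_distrib_right by (subst (3) sum.swap) (rule refl)
  also have "\<dots> = (\<Sum>i\<in>UNIV. \<Sum>a\<in>A. \<Sum>j\<in>UNIV. \<Sum>k\<in>UNIV. t a i j k * (x $ i * x $ j * x $ k))"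
    by (subst (2) sum.swap) (rule refl)
  also have "\<dots> = (\<Sum>a\<in>A. tensor (t a) x)"
    unfolding tensor_def by (subst sum.swap) (rule refl)
  finally show ?thesis ..
qed

lemma homogeneous_poly_3: "f \<in> homogeneous_poly 3 \<longleftrightarrow> (\<exists>t. f = tensor t)"
proof
  assume "f \<in> homogeneous_poly 3"
  then obtain c where f: "f = (\<lambda>x. \<Sum>a | (\<Sum>i\<in>UNIV. a i) = 3. c a * (\<Prod>i\<in>UNIV. (x $ i) ^ a i))"
    by (auto simp: homogeneous_poly_def)
  have "\<exists>t. \<forall>x::real^4. (\<Prod>i\<in>UNIV. (x $ i) ^ a i) = tensor t x" if a: "(\<Sum>i\<in>UNIV. a i) = 3" for a :: "4 \<Rightarrow> nat"
  proof -
    obtain L where L: "length L = 3" "\<And>x::real^4. (\<Prod>i\<in>UNIV. (x $ i) ^ a i) = (\<Prod>j\<leftarrow>L. x $ j)"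
      by (rule monomial_list[OF a]) blast
    then obtain i j k where "L = [i, j, k]" by (auto simp: numeral_3_eq_3 length_Suc_conv)
    with L have "(\<Prod>i\<in>UNIV. (x $ i) ^ a i) = tensor (\<lambda>i' j' k'. dl i i' * dl j j' * dl k k') x" for x :: "real^4"
      unfolding tensor_dl by (simp add: mult.assoc)
    then show ?thesis by blast
  qed
  then obtain t where t: "\<And>a x. (\<Sum>i\<in>UNIV. a i) = 3 \<Longrightarrow> (\<Prod>i\<in>UNIV. (x $ i :: real) ^ a i) = tensor (t a) x" by metis
  have "f = tensor (\<lambda>i j k. \<Sum>a | (\<Sum>i\<in>UNIV. a i) = 3. c a * t a i j k)"
    unfolding f by (rule ext) (simp add: t tensor_cmult tensor_sum)
  then show "\<exists>t. f = tensor t"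
    by (intro exI[of _ "\<lambda>i j k. \<Sum>a | (\<Sum>i\<in>UNIV. a i) = 3. c a * t a i j k"])
next
  assume "\<exists>t. f = tensor t"
  then obtain t where t: "f = tensor t" ..
  have "(\<lambda>x. x $ i * x $ j * x $ k) \<in> homogeneous_poly 3" for i j k
    using homogeneous_poly_list[of "[i, j, k]"] by (simp add: mult.assoc numeral_3_eq_3)
  then show "f \<in> homogeneous_poly 3"
    unfolding t tensor_def by (intro homogeneous_poly_sum homogeneous_poly_cmult) auto
qed

lemma homogeneous_poly_1:
  assumes "f \<in> homogeneous_poly 1" shows "\<exists>y. f = (\<lambda>x. x \<bullet> y)"
proof -
  obtain c where f: "f = (\<lambda>x. \<Sum>a | (\<Sum>i\<in>UNIV. a i) = 1. c a * (\<Prod>i\<in>UNIV. (x $ i) ^ a i))"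
    using assms by (auto simp: homogeneous_poly_def)
  have "\<exists>i. \<forall>x::real^4. (\<Prod>i\<in>UNIV. (x $ i) ^ a i) = x \<bullet> axis i 1" if a: "(\<Sum>i\<in>UNIV. a i) = 1" for a :: "4 \<Rightarrow> nat"
  proof -
    obtain L where L: "length L = 1" "\<And>x::real^4. (\<Prod>i\<in>UNIV. (x $ i) ^ a i) = (\<Prod>j\<leftarrow>L. x $ j)"
      by (rule monomial_list[OF a]) blast
    then obtain i where "L = [i]" by (auto simp: length_Suc_conv)
    with L show ?thesis by (auto simp: inner_axis)
  qed
  note ex = this
  define t where "t a = (SOME i. \<forall>x::real^4. (\<Prod>i\<in>UNIV. (x $ i) ^ a i) = x \<bullet> axis i 1)" for a
  have t: "(\<Prod>i\<in>UNIV. (x $ i) ^ a i) = x \<bullet> axis (t a) 1" if a: "(\<Sum>i\<in>UNIV. a i) = 1" for a and x :: "real^4"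
    using someI_ex[OF ex[OF a]] unfolding t_def by (rule spec)
  have "f = (\<lambda>x. x \<bullet> (\<Sum>a | (\<Sum>i\<in>UNIV. a i) = 1. c a *\<^sub>R axis (t a) 1))"
  proof
    fix x
    have "f x = (\<Sum>a | (\<Sum>i\<in>UNIV. a i) = 1. c a * (x \<bullet> axis (t a) 1))"
      unfolding f by (intro sum.cong refl arg_cong[where f="(*) _"] t) simp
    then show "f x = x \<bullet> (\<Sum>a | (\<Sum>i\<in>UNIV. a i) = 1. c a *\<^sub>R axis (t a) 1)"
      by (simp only: inner_sum_right inner_scaleR_right)
  qed
  then show ?thesis by (intro exI[of _ "\<Sum>a | (\<Sum>i\<in>UNIV. a i) = 1. c a *\<^sub>R axis (t a) 1"])
qed

lemma linear_homogeneous_poly_1: "(\<lambda>x. x \<bullet> y) \<in> homogeneous_poly 1"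
proof -
  have "(\<lambda>x::real^4. x $ i) \<in> homogeneous_poly 1" for i using homogeneous_poly_list[of "[i]"] by simp
  then have "(\<lambda>x. \<Sum>i\<in>UNIV. y $ i * x $ i) \<in> homogeneous_poly 1"
    by (intro homogeneous_poly_sum homogeneous_poly_cmult) auto
  then show ?thesis by (simp add: inner_vec_def mult.commute)
qed

lemma laplacian_linear: "laplacian (\<lambda>x. x \<bullet> y) x = 0"
proof -
  have "((\<lambda>t. (x + t *\<^sub>R axis i 1) \<bullet> y) has_real_derivative y $ i) (at 0)" for x i
    by (auto simp: inner_add_left inner_axis' intro!: derivative_eq_intros)
  then have "partial_deriv i (\<lambda>x. x \<bullet> y) = (\<lambda>x. y $ i)" for i
    unfolding partial_deriv_def by (intro ext) (rule DERIV_imp_deriv)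
  then show ?thesis by (simp add: laplacian_def partial_deriv_def)
qed

text \<open>Two derivatives in the same direction strike two of the three factors, and tie their
  indices together after summation over the direction. The 2 counts the two orders of
  striking.\<close>

lemma laplacian_tensor: "laplacian (tensor t) x = 2 * (\<Sum>k\<in>UNIV. contr t k * x $ k)"
proof -
  let ?d1 = "\<lambda>p i j k x. dl p i * (x $ j * x $ k) + dl p j * (x $ i * x $ k) + dl p k * (x $ i * x $ j)"
  let ?d2 = "\<lambda>p i j k x. 2 * (dl p i * dl p j * x $ k + dl p i * dl p k * x $ j + dl p j * dl p k * x $ i)"
  have c: "((\<lambda>s. (x + s *\<^sub>R axis p 1) $ i) has_real_derivative dl p i) (at 0)" for x :: "real^4" and p i
    by (auto simp: dl_def axis_def intro!: derivative_eq_intros)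
  have "((\<lambda>s. tensor t (x + s *\<^sub>R axis p 1)) has_real_derivative
     (\<Sum>i\<in>UNIV. \<Sum>j\<in>UNIV. \<Sum>k\<in>UNIV. t i j k * ?d1 p i j k x)) (at 0)" for x p
    unfolding tensor_def
    by (intro DERIV_sum DERIV_cmult, rule DERIV_cong, (rule DERIV_mult c)+) (simp add: algebra_simps)
  then have 1: "partial_deriv p (tensor t) = (\<lambda>x. \<Sum>i\<in>UNIV. \<Sum>j\<in>UNIV. \<Sum>k\<in>UNIV. t i j k * ?d1 p i j k x)" for p
    unfolding partial_deriv_def by (intro ext) (rule DERIV_imp_deriv)
  have "((\<lambda>s. partial_deriv p (tensor t) (x + s *\<^sub>R axis p 1)) has_real_derivative
     (\<Sum>i\<in>UNIV. \<Sum>j\<in>UNIV. \<Sum>k\<in>UNIV. t i j k * ?d2 p i j k x)) (at 0)" for x p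
    unfolding 1
    by (intro DERIV_sum DERIV_cmult, rule DERIV_cong, (rule DERIV_mult DERIV_add DERIV_cmult c)+) (simp add: algebra_simps)
  then have 2: "partial_deriv p (partial_deriv p (tensor t)) x = (\<Sum>i\<in>UNIV. \<Sum>j\<in>UNIV. \<Sum>k\<in>UNIV. t i j k * ?d2 p i j k x)" for p
    by (subst partial_deriv_def) (rule DERIV_imp_deriv)
  have "laplacian (tensor t) x = (\<Sum>p\<in>UNIV. \<Sum>i\<in>UNIV. \<Sum>j\<in>UNIV. \<Sum>k\<in>UNIV. t i j k * ?d2 p i j k x)"
    by (simp only: laplacian_def 2)
  also have "\<dots> = (\<Sum>i\<in>UNIV. \<Sum>p\<in>UNIV. \<Sum>j\<in>UNIV. \<Sum>k\<in>UNIV. t i j k * ?d2 p i j k x)"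
    by (rule sum.swap)
  also have "\<dots> = (\<Sum>i\<in>UNIV. \<Sum>j\<in>UNIV. \<Sum>p\<in>UNIV. \<Sum>k\<in>UNIV. t i j k * ?d2 p i j k x)"
    by (rule sum.cong[OF refl], rule sum.swap)
  also have "\<dots> = (\<Sum>i\<in>UNIV. \<Sum>j\<in>UNIV. \<Sum>k\<in>UNIV. \<Sum>p\<in>UNIV. t i j k * ?d2 p i j k x)"
    by (rule sum.cong[OF refl], rule sum.cong[OF refl], rule sum.swap)
  also have "\<dots> = (\<Sum>i\<in>UNIV. \<Sum>j\<in>UNIV. \<Sum>k\<in>UNIV. 2 * (t i j k * (dl i j * x $ k + dl i k * x $ j + dl j k * x $ i)))"
  proof (intro sum.cong refl)
    fix i j k
    have "(\<Sum>p\<in>UNIV. dl p i * dl p j * y) = dl i j * y" for i j and y :: real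
      by (cases "i = j") (auto simp: dl_def if_distrib[where f="\<lambda>x. x * _"] cong: if_cong)
    then show "(\<Sum>p\<in>UNIV. t i j k * ?d2 p i j k x) = 2 * (t i j k * (dl i j * x $ k + dl i k * x $ j + dl j k * x $ i))"
      by (simp only: sum_distrib_left[symmetric] sum.distrib mult.left_commute)
  qed
  also have "\<dots> = 2 * (\<Sum>k\<in>UNIV. contr t k * x $ k)"
    by (simp only: sum_distrib_left[symmetric] sum_contr)
  finally show ?thesis .
qed

lemma harmonic_poly_3: "f \<in> harmonic_poly 3 \<longleftrightarrow> (\<exists>t. f = tensor t \<and> (\<forall>k. contr t k = 0))"
proof
  assume f: "f \<in> harmonic_poly 3"
  then obtain t where t: "f = tensor t" by (auto simp: harmonic_poly_def homogeneous_poly_3)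
  have "contr t k = 0" for k
  proof -
    \<comment> \<open>The Laplacian is a linear form, so its values at the coordinate axes isolate
      its coefficients.\<close>
    have "laplacian (tensor t) (axis k 1) = 0" using f t by (simp add: harmonic_poly_def)
    moreover have "axis k 1 $ i = dl k i" for i by (auto simp: axis_def dl_def)
    ultimately have "2 * (\<Sum>i\<in>UNIV. contr t i * dl k i) = 0"
      unfolding laplacian_tensor by simp
    then show ?thesis unfolding sum_dl by simp
  qed
  with t show "\<exists>t. f = tensor t \<and> (\<forall>k. contr t k = 0)" by blast
qed (auto simp: harmonic_poly_def homogeneous_poly_3 laplacian_tensor)

lemma harmonic_poly_1: "f \<in> harmonic_poly 1 \<longleftrightarrow> (\<exists>y. f = (\<lambda>x. x \<bullet> y))"
  using homogeneous_poly_1 linear_homogeneous_poly_1 laplacian_linear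
  by (auto simp: harmonic_poly_def)

section \<open>Covariance kernels of the two harmonic components\<close>

lemma L2_prod_sum_left:
  assumes "\<And>j. j \<in> J \<Longrightarrow> B j \<in> range tensor"
  shows "L2_prod (\<lambda>x. \<Sum>j\<in>J. c j * B j x) (tensor u) = (\<Sum>j\<in>J. c j * L2_prod (B j) (tensor u))"
proof -
  have g: "gauss_integrable (\<lambda>x. B j x * tensor u x)" if "j \<in> J" for j
    using assms[OF that] gauss_int_tensor(1) by auto
  have "gauss_int (\<lambda>x. (\<Sum>j\<in>J. c j * B j x) * tensor u x) = gauss_int (\<lambda>x. \<Sum>j\<in>J. c j * (B j x * tensor u x))"
    by (simp add: sum_distrib_right mult.assoc)
  also have "\<dots> = (\<Sum>j\<in>J. c j * gauss_int (\<lambda>x. B j x * tensor u x))"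
    using g by (simp add: gauss_integrable_sum gauss_integrable_cmult)
  finally show ?thesis by (simp add: L2_prod_eq sum_distrib_left ac_simps)
qed

lemma L2_prod_commute: "L2_prod f g = L2_prod g f"
  by (simp add: L2_prod_def mult.commute)

lemma onb_expansion:
  assumes fin: "finite J" and t: "\<And>j. j \<in> J \<Longrightarrow> B j \<in> range tensor"
    and on: "orthonormal_family J B"
    and f: "f \<in> range tensor" "\<And>x. f x = (\<Sum>j\<in>J. c j * B j x)"
  shows "f x = (\<Sum>j\<in>J. L2_prod (B j) f * B j x)"
proof -
  have "L2_prod (B i) f = c i" if i: "i \<in> J" for i
  proof -
    obtain u where u: "B i = tensor u" using t[OF i] by auto
    have fe: "f = (\<lambda>x. \<Sum>j\<in>J. c j * B j x)" using f(2) by (rule ext)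
    have "L2_prod (B i) f = L2_prod (\<lambda>x. \<Sum>j\<in>J. c j * B j x) (B i)"
      by (subst L2_prod_commute) (simp only: fe)
    also have "\<dots> = (\<Sum>j\<in>J. c j * (if j = i then 1 else 0))"
      using L2_prod_sum_left[where B=B and J=J and c=c and u=u, OF t] on i
      unfolding u[symmetric] by (simp add: orthonormal_family_def)
    also have "\<dots> = c i" using fin i by (simp add: if_distrib cong: if_cong)
    finally show ?thesis .
  qed
  then show ?thesis unfolding f(2) by simp
qed

text \<open>The zonal cubic at \<open>y\<close>, expanded in the orthonormal basis, has coefficients
  \<open>H j y\<close> by the reproducing property. The kernel is thus the zonal cubic, whatever the
  basis.\<close>

lemma kernel_harmonic_3:
  assumes b: "basis_family (harmonic_poly 3) J H" and on: "orthonormal_family J H" and fin: "finite J"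
  shows "(\<Sum>j\<in>J. H j x * H j y) = (2 * (x \<bullet> y) ^ 3 - (x \<bullet> y) * (x \<bullet> x) * (y \<bullet> y)) / 24"
proof -
  have H: "\<exists>t. H j = tensor t \<and> (\<forall>k. contr t k = 0)" if "j \<in> J" for j
    using b that by (auto simp: basis_family_def harmonic_poly_3)
  have "tensor (zonal y) \<in> harmonic_poly 3" using contr_zonal harmonic_poly_3 by blast
  then obtain c where c: "\<And>x. tensor (zonal y) x = (\<Sum>j\<in>J. c j * H j x)"
    using b unfolding basis_family_def by blast
  have "tensor (zonal y) x = (\<Sum>j\<in>J. L2_prod (H j) (tensor (zonal y)) * H j x)"
    using H by (intro onb_expansion[OF fin _ on rangeI c]) blast
  also have "\<dots> = (\<Sum>j\<in>J. H j x * H j y)"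
  proof (intro sum.cong refl)
    fix j assume "j \<in> J"
    then obtain t where "H j = tensor t" "\<And>k. contr t k = 0" using H by blast
    then show "L2_prod (H j) (tensor (zonal y)) * H j x = H j x * H j y"
      using reproducing(1)[of t y] by simp
  qed
  finally show ?thesis unfolding tensor_zonal by (simp add: field_simps)
qed

lemma kernel_radial:
  assumes b: "basis_family (harmonic_poly 1) J H"
    and on: "orthonormal_family J (\<lambda>j x. (norm x)\<^sup>2 * H j x)" and fin: "finite J"
  shows "(\<Sum>j\<in>J. ((norm x)\<^sup>2 * H j x) * ((norm y)\<^sup>2 * H j y)) = (x \<bullet> y) * (x \<bullet> x) * (y \<bullet> y) / 96"
proof -
  let ?B = "\<lambda>j x. (norm x)\<^sup>2 * H j x"
  have H: "\<exists>u. H j = (\<lambda>x. x \<bullet> u) \<and> ?B j = tensor (radial u)" if "j \<in> J" for j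
  proof -
    have "H j \<in> harmonic_poly 1" using b that by (auto simp: basis_family_def)
    then obtain u where u: "H j = (\<lambda>x. x \<bullet> u)" unfolding harmonic_poly_1 by blast
    then have "?B j = tensor (radial u)" by (auto simp: tensor_radial power2_norm_eq_inner)
    with u show ?thesis by blast
  qed
  have h: "(\<lambda>x. x \<bullet> y) \<in> harmonic_poly 1" unfolding harmonic_poly_1 by blast
  have "\<forall>f\<in>harmonic_poly 1. \<exists>c. \<forall>x. f x = (\<Sum>j\<in>J. c j * H j x)"
    using b unfolding basis_family_def by blast
  from bspec[OF this h] obtain c where c: "\<And>x. x \<bullet> y = (\<Sum>j\<in>J. c j * H j x)"
    by auto
  have c': "tensor (radial y) x = (\<Sum>j\<in>J. c j * ?B j x)" for x
    by (simp add: tensor_radial power2_norm_eq_inner c sum_distrib_right sum_distrib_left ac_simps)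
  have L: "L2_prod (?B j) (tensor (radial y)) = 96 * H j y" if "j \<in> J" for j
    using H[OF that] L2_radial by (auto simp: inner_commute)
  have "tensor (radial y) x = (\<Sum>j\<in>J. L2_prod (?B j) (tensor (radial y)) * ?B j x)"
    using H by (intro onb_expansion[OF fin _ on rangeI c']) blast
  also have "\<dots> = 96 * (\<Sum>j\<in>J. ?B j x * H j y)"
    unfolding sum_distrib_left
    by (intro sum.cong refl, subst L, assumption) (simp only: mult_ac)
  finally have "(x \<bullet> y) * (x \<bullet> x) = 96 * (\<Sum>j\<in>J. ?B j x * H j y)" unfolding tensor_radial .
  moreover have "(\<Sum>j\<in>J. ?B j x * ?B j y) = (norm y)\<^sup>2 * (\<Sum>j\<in>J. ?B j x * H j y)"
    by (simp add: sum_distrib_left ac_simps)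
  ultimately show ?thesis by (simp add: power2_norm_eq_inner)
qed

text \<open>Directness of the sum of harmonic cubics and radial cubics, used to show that evaluation
  vectors span the coefficient space.\<close>

lemma harmonic_decomposition_independent:
  assumes b3: "basis_family (harmonic_poly 3) I H3" and b1: "basis_family (harmonic_poly 1) J H1"
    and z: "\<And>x. (\<Sum>i\<in>I. c i * H3 i x) + (\<Sum>j\<in>J. d j * ((norm x)\<^sup>2 * H1 j x)) = 0"
  shows "\<forall>i\<in>I. c i = 0" and "\<forall>j\<in>J. d j = 0"
proof -
  have "\<forall>i\<in>I. \<exists>t. H3 i = tensor t \<and> (\<forall>k. contr t k = 0)"
    using b3 by (auto simp: basis_family_def harmonic_poly_3)
  then obtain t where t: "\<And>i. i \<in> I \<Longrightarrow> H3 i = tensor (t i)" "\<And>i k. i \<in> I \<Longrightarrow> contr (t i) k = 0" by metis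
  have "\<forall>j\<in>J. \<exists>y. H1 j = (\<lambda>x. x \<bullet> y)"
    using b1 unfolding basis_family_def harmonic_poly_1 by blast
  then obtain y where y: "\<And>j. j \<in> J \<Longrightarrow> H1 j = (\<lambda>x. x \<bullet> y j)" by metis
  define u where "u = (\<Sum>j\<in>J. d j *\<^sub>R y j)"
  have u: "(\<Sum>j\<in>J. d j * H1 j x) = x \<bullet> u" for x
    by (simp add: u_def y inner_sum_right)
  have ru: "tensor (radial u) x = (\<Sum>j\<in>J. d j * ((norm x)\<^sup>2 * H1 j x))" for x
    unfolding tensor_radial u[symmetric] by (simp add: power2_norm_eq_inner sum_distrib_left sum_distrib_right ac_simps)
  have e: "(\<lambda>x. \<Sum>i\<in>I. c i * H3 i x) = tensor (radial (- u))"
  proof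
    fix x
    have "(\<Sum>i\<in>I. c i * H3 i x) = - tensor (radial u) x" using z[of x] ru[of x] by linarith
    then show "(\<Sum>i\<in>I. c i * H3 i x) = tensor (radial (- u)) x" by (simp add: tensor_radial)
  qed
  have c0: "(\<Sum>i\<in>I. c i * H3 i w) = 0" for w
  proof -
    \<comment> \<open>Pairing with \<open>zonal w\<close> annihilates the radial form and reproduces
      the harmonic sum at \<open>w\<close>, so that sum vanishes pointwise.\<close>
    have "0 = L2_prod (tensor (radial (- u))) (tensor (zonal w))"
      using reproducing(3)[of "\<lambda>_ _ _. 0"] by (simp add: contr_def)
    also have "\<dots> = (\<Sum>i\<in>I. c i * L2_prod (H3 i) (tensor (zonal w)))"
      unfolding e[symmetric] by (rule L2_prod_sum_left) (auto simp: t)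
    also have "\<dots> = (\<Sum>i\<in>I. c i * H3 i w)"
      using t reproducing(1) by (intro sum.cong) auto
    finally show ?thesis by simp
  qed
  then show "\<forall>i\<in>I. c i = 0" using b3 unfolding basis_family_def by blast
  have "x \<bullet> u = 0" for x
    using e c0 tensor_radial[of "- u" x] by (cases "x = 0") (auto simp: fun_eq_iff)
  then show "\<forall>j\<in>J. d j = 0" using b1 u unfolding basis_family_def by simp
qed

section \<open>The expected resultant of two Gaussian quadratic forms\<close>

lemma nn_integral_shear:
  fixes H :: "real \<Rightarrow> real \<Rightarrow> ennreal"
  assumes [measurable]: "(\<lambda>(x, y). H x y) \<in> borel_measurable (borel \<Otimes>\<^sub>M borel)"
  shows "(\<integral>\<^sup>+x. \<integral>\<^sup>+y. H (x + t * y) y \<partial>lborel \<partial>lborel) = (\<integral>\<^sup>+x. \<integral>\<^sup>+y. H x y \<partial>lborel \<partial>lborel)"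
    and "(\<integral>\<^sup>+x. \<integral>\<^sup>+y. H x (y + t * x) \<partial>lborel \<partial>lborel) = (\<integral>\<^sup>+x. \<integral>\<^sup>+y. H x y \<partial>lborel \<partial>lborel)"
proof -
  have tr: "(\<integral>\<^sup>+y. h (y + c) \<partial>lborel) = (\<integral>\<^sup>+y. h y \<partial>lborel)"
    if [measurable]: "h \<in> borel_measurable borel" for h :: "real \<Rightarrow> ennreal" and c
    using nn_integral_real_affine[of h 1 c] by (simp add: add.commute)
  show "(\<integral>\<^sup>+x. \<integral>\<^sup>+y. H x (y + t * x) \<partial>lborel \<partial>lborel) = (\<integral>\<^sup>+x. \<integral>\<^sup>+y. H x y \<partial>lborel \<partial>lborel)"
    by (intro nn_integral_cong tr) measurable
  have "(\<integral>\<^sup>+x. \<integral>\<^sup>+y. H (x + t * y) y \<partial>lborel \<partial>lborel) = (\<integral>\<^sup>+y. \<integral>\<^sup>+x. H (x + t * y) y \<partial>lborel \<partial>lborel)"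
    by (rule lborel_pair.Fubini'[symmetric]) measurable
  also have "\<dots> = (\<integral>\<^sup>+y. \<integral>\<^sup>+x. H x y \<partial>lborel \<partial>lborel)"
    by (intro nn_integral_cong tr) measurable
  also have "\<dots> = (\<integral>\<^sup>+x. \<integral>\<^sup>+y. H x y \<partial>lborel \<partial>lborel)"
    by (rule lborel_pair.Fubini') measurable
  finally show "(\<integral>\<^sup>+x. \<integral>\<^sup>+y. H (x + t * y) y \<partial>lborel \<partial>lborel) = (\<integral>\<^sup>+x. \<integral>\<^sup>+y. H x y \<partial>lborel \<partial>lborel)" .
qed

text \<open>A rotation is a product of three shears, unless it is a half turn.\<close>

lemma nn_integral_rotation:
  fixes H :: "real \<Rightarrow> real \<Rightarrow> ennreal"
  assumes [measurable]: "(\<lambda>(x, y). H x y) \<in> borel_measurable (borel \<Otimes>\<^sub>M borel)"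
    and cs: "c\<^sup>2 + s\<^sup>2 = (1::real)"
  shows "(\<integral>\<^sup>+x. \<integral>\<^sup>+y. H (c * x - s * y) (s * x + c * y) \<partial>lborel \<partial>lborel) = (\<integral>\<^sup>+x. \<integral>\<^sup>+y. H x y \<partial>lborel \<partial>lborel)"
proof (cases "s = 0")
  case True
  then have c: "c = 1 \<or> c = -1" using cs by (simp add: power2_eq_1_iff)
  have neg: "(\<integral>\<^sup>+y. h (- y) \<partial>lborel) = (\<integral>\<^sup>+y. h y \<partial>lborel)"
    if [measurable]: "h \<in> borel_measurable borel" for h :: "real \<Rightarrow> ennreal"
    using nn_integral_real_affine[of h "-1" 0] by simp
  have "(\<integral>\<^sup>+x. \<integral>\<^sup>+y. H (- x) (- y) \<partial>lborel \<partial>lborel) = (\<integral>\<^sup>+x. \<integral>\<^sup>+y. H (- x) y \<partial>lborel \<partial>lborel)"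
    by (intro nn_integral_cong neg) measurable
  also have "\<dots> = (\<integral>\<^sup>+x. \<integral>\<^sup>+y. H x y \<partial>lborel \<partial>lborel)"
    by (intro neg) measurable
  finally show ?thesis using c True by auto
next
  case False
  \<comment> \<open>Minus the tangent of half the rotation angle; the three shears have parameters
    \<open>t\<close>, \<open>s\<close>, \<open>t\<close>.\<close>
  define t where "t = (c - 1) / s"
  have st: "s * t = c - 1" using False by (simp add: t_def)
  have "s * (t * (2 + t * s)) = (c - 1) * (2 + (c - 1))"
    using st by (metis mult.assoc mult.commute)
  also have "\<dots> = s * (- s)" using cs by (simp add: algebra_simps power2_eq_square)
  finally have t2: "t * (2 + t * s) = - s" by (simp only: mult_left_cancel[OF False])
  let ?H1 = "\<lambda>x y. H (x + t * y) y"
  let ?H2 = "\<lambda>x y. ?H1 x (y + s * x)"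
  have "(\<integral>\<^sup>+x. \<integral>\<^sup>+y. H x y \<partial>lborel \<partial>lborel) = (\<integral>\<^sup>+x. \<integral>\<^sup>+y. ?H1 x y \<partial>lborel \<partial>lborel)"
    by (rule nn_integral_shear(1)[symmetric]) measurable
  also have "\<dots> = (\<integral>\<^sup>+x. \<integral>\<^sup>+y. ?H2 x y \<partial>lborel \<partial>lborel)"
    by (rule nn_integral_shear(2)[symmetric]) measurable
  also have "\<dots> = (\<integral>\<^sup>+x. \<integral>\<^sup>+y. ?H2 (x + t * y) y \<partial>lborel \<partial>lborel)"
    by (rule nn_integral_shear(1)[symmetric]) measurable
  also have "\<dots> = (\<integral>\<^sup>+x. \<integral>\<^sup>+y. H (c * x - s * y) (s * x + c * y) \<partial>lborel \<partial>lborel)"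
  proof (intro nn_integral_cong)
    fix x y
    have 1: "y + s * (x + t * y) = s * x + c * y"
    proof -
      have "y + s * (x + t * y) = s * x + (1 + s * t) * y" by (simp add: algebra_simps)
      then show ?thesis using st by simp
    qed
    have "x + t * y + t * (s * x + c * y) = (1 + s * t) * x + (t * (1 + c)) * y" by (simp add: algebra_simps)
    moreover have "t * (1 + c) = - s" using t2 st by (simp add: algebra_simps)
    ultimately have 2: "x + t * y + t * (s * x + c * y) = c * x - s * y" using st by simp
    show "?H2 (x + t * y) y = H (c * x - s * y) (s * x + c * y)" unfolding 1 2 ..
  qed
  finally show ?thesis ..
qed

abbreviation std_normal :: "real measure" where
  "std_normal \<equiv> density lborel (\<lambda>x. ennreal (std_normal_density x))"

interpretation sn: prob_space std_normal
  using prob_space_normal_density[of 1 0] by simp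

interpretation sn_pair: pair_sigma_finite std_normal std_normal ..

lemma nn_integral_std_normal:
  "f \<in> borel_measurable borel \<Longrightarrow> (\<integral>\<^sup>+x. f x \<partial>std_normal) = (\<integral>\<^sup>+x. ennreal (std_normal_density x) * f x \<partial>lborel)"
  by (subst nn_integral_density) auto

lemma std_normal_density_mult:
  "std_normal_density x * std_normal_density y = exp (- (x\<^sup>2 + y\<^sup>2) / 2) / (2 * pi)"
  by (simp add: std_normal_density_def mult_exp_exp add_divide_distrib)

lemma nn_integral_std_normal2:
  fixes H :: "real \<Rightarrow> real \<Rightarrow> ennreal"
  assumes [measurable]: "(\<lambda>(x, y). H x y) \<in> borel_measurable (borel \<Otimes>\<^sub>M borel)"
  shows "(\<integral>\<^sup>+x. \<integral>\<^sup>+y. H x y \<partial>std_normal \<partial>std_normal) =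
    (\<integral>\<^sup>+x. \<integral>\<^sup>+y. ennreal (exp (- (x\<^sup>2 + y\<^sup>2) / 2) / (2 * pi)) * H x y \<partial>lborel \<partial>lborel)"
proof -
  have "(\<integral>\<^sup>+x. \<integral>\<^sup>+y. H x y \<partial>std_normal \<partial>std_normal) =
    (\<integral>\<^sup>+x. (\<integral>\<^sup>+y. ennreal (std_normal_density y) * H x y \<partial>lborel) \<partial>std_normal)"
    by (intro nn_integral_cong nn_integral_std_normal) measurable
  also have "\<dots> = (\<integral>\<^sup>+x. ennreal (std_normal_density x) * (\<integral>\<^sup>+y. ennreal (std_normal_density y) * H x y \<partial>lborel) \<partial>lborel)"
    by (intro nn_integral_std_normal) measurable
  also have "\<dots> = (\<integral>\<^sup>+x. \<integral>\<^sup>+y. ennreal (std_normal_density x) * (ennreal (std_normal_density y) * H x y) \<partial>lborel \<partial>lborel)"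
    by (intro nn_integral_cong nn_integral_cmult[symmetric]) measurable
  also have "\<dots> = (\<integral>\<^sup>+x. \<integral>\<^sup>+y. ennreal (exp (- (x\<^sup>2 + y\<^sup>2) / 2) / (2 * pi)) * H x y \<partial>lborel \<partial>lborel)"
    by (simp only: mult.assoc[symmetric] ennreal_mult[symmetric] normal_density_nonneg std_normal_density_mult)
  finally show ?thesis .
qed

lemma std_normal_rotation:
  fixes H :: "real \<Rightarrow> real \<Rightarrow> ennreal"
  assumes [measurable]: "(\<lambda>(x, y). H x y) \<in> borel_measurable (borel \<Otimes>\<^sub>M borel)"
    and cs: "c\<^sup>2 + s\<^sup>2 = (1::real)"
  shows "(\<integral>\<^sup>+x. \<integral>\<^sup>+y. H (c * x - s * y) (s * x + c * y) \<partial>std_normal \<partial>std_normal) =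
    (\<integral>\<^sup>+x. \<integral>\<^sup>+y. H x y \<partial>std_normal \<partial>std_normal)"
proof -
  have n: "(c * x - s * y)\<^sup>2 + (s * x + c * y)\<^sup>2 = x\<^sup>2 + y\<^sup>2" for x y
  proof -
    have "(c * x - s * y)\<^sup>2 + (s * x + c * y)\<^sup>2 = (c\<^sup>2 + s\<^sup>2) * (x\<^sup>2 + y\<^sup>2)"
      by (simp add: power2_eq_square algebra_simps)
    then show ?thesis using cs by simp
  qed
  let ?G = "\<lambda>x y. ennreal (exp (- (x\<^sup>2 + y\<^sup>2) / 2) / (2 * pi)) * H x y"
  have "(\<integral>\<^sup>+x. \<integral>\<^sup>+y. ?G (c * x - s * y) (s * x + c * y) \<partial>lborel \<partial>lborel) = (\<integral>\<^sup>+x. \<integral>\<^sup>+y. ?G x y \<partial>lborel \<partial>lborel)"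
    by (rule nn_integral_rotation[OF _ cs]) measurable
  then have "(\<integral>\<^sup>+x. \<integral>\<^sup>+y. ennreal (exp (- (x\<^sup>2 + y\<^sup>2) / 2) / (2 * pi)) * H (c * x - s * y) (s * x + c * y) \<partial>lborel \<partial>lborel) = (\<integral>\<^sup>+x. \<integral>\<^sup>+y. ?G x y \<partial>lborel \<partial>lborel)"
    by (simp only: n)
  then show ?thesis
    by (subst (1 2) nn_integral_std_normal2) measurable
qed

lemma nn_integral_std_normal_swap:
  fixes H :: "real \<Rightarrow> real \<Rightarrow> ennreal"
  assumes [measurable]: "(\<lambda>(x, y). H x y) \<in> borel_measurable (borel \<Otimes>\<^sub>M borel)"
  shows "(\<integral>\<^sup>+x. \<integral>\<^sup>+y. H x y \<partial>std_normal \<partial>std_normal) = (\<integral>\<^sup>+y. \<integral>\<^sup>+x. H x y \<partial>std_normal \<partial>std_normal)"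
  by (rule sn_pair.Fubini'[symmetric]) measurable

lemma nn_integral_std_normal_eq:
  assumes "integrable lborel (\<lambda>x. std_normal_density x * f x)" "\<And>x. 0 \<le> f x" "f \<in> borel_measurable borel"
  shows "(\<integral>\<^sup>+x. ennreal (f x) \<partial>std_normal) = ennreal (LINT x|lborel. std_normal_density x * f x)"
proof -
  have "(\<integral>\<^sup>+x. ennreal (f x) \<partial>std_normal) = (\<integral>\<^sup>+x. ennreal (std_normal_density x * f x) \<partial>lborel)"
    using assms(2,3) by (subst nn_integral_std_normal) (auto simp: ennreal_mult)
  also have "\<dots> = ennreal (LINT x|lborel. std_normal_density x * f x)"
    using assms by (intro nn_integral_eq_integral) auto
  finally show ?thesis .
qed

lemma nn_integral_std_normal_square: "(\<integral>\<^sup>+x. ennreal (x\<^sup>2) \<partial>std_normal) = 1"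
  using nn_integral_std_normal_eq[of "\<lambda>x. x\<^sup>2"] integrable_std_normal_moment[of 2] integral_std_normal_moment_even[of 1]
  by simp

section \<open>Polar integration and the three-variable moment\<close>

lemma nn_integral_even_half:
  assumes [measurable]: "f \<in> borel_measurable borel" and even: "\<And>x. f (- x) = f x"
  shows "(\<integral>\<^sup>+x. f x \<partial>lborel) = 2 * (\<integral>\<^sup>+x. f x * indicator {0..} (x::real) \<partial>lborel)"
proof -
  have "(\<integral>\<^sup>+x. f x \<partial>lborel) = (\<integral>\<^sup>+x. f x * indicator {0..} x + f x * indicator {..0} x \<partial>lborel)"
    by (intro nn_integral_cong_AE AE_I[where N="{0}"]) (auto split: split_indicator)
  also have "\<dots> = (\<integral>\<^sup>+x. f x * indicator {0..} x \<partial>lborel) + (\<integral>\<^sup>+x. f x * indicator {..0} x \<partial>lborel)"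
    by (intro nn_integral_add) auto
  also have "(\<integral>\<^sup>+x. f x * indicator {..0} x \<partial>lborel) = (\<integral>\<^sup>+x. f (- x) * indicator {..0} (- x) \<partial>lborel)"
    by (subst nn_integral_real_affine[where c="-1" and t=0]) auto
  also have "\<dots> = (\<integral>\<^sup>+x. f x * indicator {0..} x \<partial>lborel)"
    by (intro nn_integral_cong) (auto simp: even split: split_indicator)
  finally show ?thesis by (simp add: mult_2)
qed

lemma nn_integral_inverse_1_plus_square: "(\<integral>\<^sup>+t. ennreal (1 / (1 + t\<^sup>2)) \<partial>lborel) = ennreal pi"
proof -
  have "(\<integral>\<^sup>+t. ennreal (1 / (1 + t\<^sup>2)) * indicator {0..} t \<partial>lborel) = ennreal (pi / 2 - arctan 0)"
    by (rule nn_integral_FTC_atLeast)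
       (auto intro!: derivative_eq_intros tendsto_arctan_at_top simp: add_nonneg_eq_0_iff field_simps power2_eq_square)
  then show ?thesis
    by (subst nn_integral_even_half) (simp_all add: ennreal_mult[symmetric] flip: ennreal_numeral)
qed

text \<open>Polar integration by slopes: \<open>y = x * t\<close>, followed by the scaling of
  \<open>x\<close> by \<open>1 / sqrt (1 + t^2)\<close>, leaves the integral of
  \<open>1 / (1 + t^2)\<close>. The factor is \<open>pi\<close> and not \<open>2 * pi\<close>
  because \<open>r\<close> runs over the whole line.\<close>

lemma nn_integral_polar:
  assumes [measurable]: "h \<in> borel_measurable borel"
  shows "(\<integral>\<^sup>+x. \<integral>\<^sup>+y. h (x\<^sup>2 + y\<^sup>2) \<partial>lborel \<partial>lborel) = ennreal pi * (\<integral>\<^sup>+r. ennreal \<bar>r\<bar> * h (r\<^sup>2 :: real) \<partial>lborel)"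
proof -
  have "(\<integral>\<^sup>+x. \<integral>\<^sup>+y. h (x\<^sup>2 + y\<^sup>2) \<partial>lborel \<partial>lborel) = (\<integral>\<^sup>+x. \<integral>\<^sup>+t. ennreal \<bar>x\<bar> * h (x\<^sup>2 * (1 + t\<^sup>2)) \<partial>lborel \<partial>lborel)"
  \<comment> \<open>The substitution \<open>y = x * t\<close> degenerates only at
    \<open>x = 0\<close>.\<close>
  proof (intro nn_integral_cong_AE AE_I[where N="{0}"])
    show "{x \<in> space lborel. (\<integral>\<^sup>+y. h (x\<^sup>2 + y\<^sup>2) \<partial>lborel) \<noteq> (\<integral>\<^sup>+t. ennreal \<bar>x\<bar> * h (x\<^sup>2 * (1 + t\<^sup>2)) \<partial>lborel)} \<subseteq> {0::real}"
    proof (safe, rule ccontr)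
      fix x :: real assume x: "x \<noteq> 0"
        and n: "(\<integral>\<^sup>+y. h (x\<^sup>2 + y\<^sup>2) \<partial>lborel) \<noteq> (\<integral>\<^sup>+t. ennreal \<bar>x\<bar> * h (x\<^sup>2 * (1 + t\<^sup>2)) \<partial>lborel)"
      have "(\<integral>\<^sup>+y. h (x\<^sup>2 + y\<^sup>2) \<partial>lborel) = ennreal \<bar>x\<bar> * (\<integral>\<^sup>+t. h (x\<^sup>2 + (0 + x * t)\<^sup>2) \<partial>lborel)"
        using x by (intro nn_integral_real_affine) auto
      also have "\<dots> = (\<integral>\<^sup>+t. ennreal \<bar>x\<bar> * h (x\<^sup>2 * (1 + t\<^sup>2)) \<partial>lborel)"
        by (subst nn_integral_cmult[symmetric]) (auto simp: power_mult_distrib distrib_left)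
      finally show False using n by simp
    qed
  qed auto
  also have "\<dots> = (\<integral>\<^sup>+t. \<integral>\<^sup>+x. ennreal \<bar>x\<bar> * h (x\<^sup>2 * (1 + t\<^sup>2)) \<partial>lborel \<partial>lborel)"
    by (rule lborel_pair.Fubini'[symmetric]) measurable
  also have "\<dots> = (\<integral>\<^sup>+t. ennreal (1 / (1 + t\<^sup>2)) * (\<integral>\<^sup>+r. ennreal \<bar>r\<bar> * h (r\<^sup>2) \<partial>lborel) \<partial>lborel)"
  proof (intro nn_integral_cong)
    fix t :: real
    define q where "q = 1 / sqrt (1 + t\<^sup>2)"
    have p: "1 + t\<^sup>2 > 0" by (simp add: add_pos_nonneg)
    then have q: "q > 0" "q\<^sup>2 * (1 + t\<^sup>2) = 1" "q * q = 1 / (1 + t\<^sup>2)"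
      by (auto simp: q_def power_divide real_sqrt_mult_self)
    have "(\<integral>\<^sup>+x. ennreal \<bar>x\<bar> * h (x\<^sup>2 * (1 + t\<^sup>2)) \<partial>lborel) =
      ennreal \<bar>q\<bar> * (\<integral>\<^sup>+r. ennreal \<bar>0 + q * r\<bar> * h ((0 + q * r)\<^sup>2 * (1 + t\<^sup>2)) \<partial>lborel)"
      using q by (intro nn_integral_real_affine) auto
    also have "\<dots> = (\<integral>\<^sup>+r. ennreal (q * q) * (ennreal \<bar>r\<bar> * h (r\<^sup>2)) \<partial>lborel)"
    proof (subst nn_integral_cmult[symmetric])
      have "(0 + q * r)\<^sup>2 * (1 + t\<^sup>2) = r\<^sup>2" for r
        using q(2) by (simp add: power_mult_distrib)
      moreover have "ennreal \<bar>q\<bar> * ennreal \<bar>0 + q * r\<bar> = ennreal (q * q) * ennreal \<bar>r\<bar>" for r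
        using q(1) by (simp add: abs_mult ennreal_mult[symmetric] mult.assoc)
      ultimately show "(\<integral>\<^sup>+r. ennreal \<bar>q\<bar> * (ennreal \<bar>0 + q * r\<bar> * h ((0 + q * r)\<^sup>2 * (1 + t\<^sup>2))) \<partial>lborel)
         = (\<integral>\<^sup>+r. ennreal (q * q) * (ennreal \<bar>r\<bar> * h (r\<^sup>2)) \<partial>lborel)"
        by (simp only: mult.assoc[symmetric])
    qed measurable
    also have "\<dots> = ennreal (q * q) * (\<integral>\<^sup>+r. ennreal \<bar>r\<bar> * h (r\<^sup>2) \<partial>lborel)"
      by (rule nn_integral_cmult) measurable
    finally show "(\<integral>\<^sup>+x. ennreal \<bar>x\<bar> * h (x\<^sup>2 * (1 + t\<^sup>2)) \<partial>lborel) =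
      ennreal (1 / (1 + t\<^sup>2)) * (\<integral>\<^sup>+r. ennreal \<bar>r\<bar> * h (r\<^sup>2) \<partial>lborel)" using q(3) by simp
  qed
  also have "\<dots> = ennreal pi * (\<integral>\<^sup>+r. ennreal \<bar>r\<bar> * h (r\<^sup>2) \<partial>lborel)"
    by (subst nn_integral_multc) (auto simp: nn_integral_inverse_1_plus_square)
  finally show ?thesis .
qed

text \<open>The sum \<open>x^2 + y^2\<close> is exponentially distributed with mean 2. The radial
  integral is split at the radius \<open>b\<close> where the expression changes sign, and
  \<open>F\<close> is an antiderivative of the integrand up to that sign.\<close>

lemma abs_moment_exponential:
  fixes A m :: real
  assumes A: "A > 0" and m: "m \<ge> 0"
  shows "(\<integral>\<^sup>+x. \<integral>\<^sup>+y. ennreal \<bar>A * (x\<^sup>2 + y\<^sup>2) - m\<bar> \<partial>std_normal \<partial>std_normal) =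
    ennreal (m - 2 * A + 4 * A * exp (- m / (2 * A)))"
proof -
  let ?h = "\<lambda>u. ennreal (exp (- u / 2) / (2 * pi)) * ennreal \<bar>A * u - m\<bar>"
  define F where "F r = (A * r\<^sup>2 - m + 2 * A) * exp (- r\<^sup>2 / 2)" for r :: real
  define b where "b = sqrt (m / A)"
  have b: "b \<ge> 0" "A * b\<^sup>2 = m" using A m by (auto simp: b_def)
  have dF: "(F has_real_derivative (r * (m - A * r\<^sup>2) * exp (- r\<^sup>2 / 2))) (at r)" for r
    unfolding F_def by (auto intro!: derivative_eq_intros simp: algebra_simps power2_eq_square)
  have sgn: "A * r\<^sup>2 \<le> m" if "0 \<le> r" "r \<le> b" for r
    using b A power_mono[OF that(2,1), of 2] by (metis mult_left_mono less_imp_le)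
  have sgn': "m \<le> A * r\<^sup>2" if "b \<le> r" for r
    using b A power_mono[OF that b(1), of 2] by (metis mult_left_mono less_imp_le)
  let ?g = "\<lambda>r. r * \<bar>A * r\<^sup>2 - m\<bar> * exp (- r\<^sup>2 / 2)"
  have "(\<integral>\<^sup>+r. ennreal (?g r) * indicator {0..b} r \<partial>lborel) =
        (\<integral>\<^sup>+r. ennreal (r * (m - A * r\<^sup>2) * exp (- r\<^sup>2 / 2)) * indicator {0..b} r \<partial>lborel)"
  proof (intro nn_integral_cong)
    fix r
    show "ennreal (?g r) * indicator {0..b} r = ennreal (r * (m - A * r\<^sup>2) * exp (- r\<^sup>2 / 2)) * indicator {0..b} r"
      using sgn[of r] by (cases "r \<in> {0..b}") (simp_all add: abs_if)
  qed
  also have "\<dots> = ennreal (F b - F 0)"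
    using b dF sgn by (intro nn_integral_FTC_Icc) (auto intro!: mult_nonneg_nonneg has_real_derivative_iff_has_vector_derivative[THEN iffD1] DERIV_subset)
  finally have 1: "(\<integral>\<^sup>+r. ennreal (?g r) * indicator {0..b} r \<partial>lborel) = ennreal (F b - F 0)" .
  have "(\<integral>\<^sup>+r. ennreal (?g r) * indicator {b..} r \<partial>lborel) =
        (\<integral>\<^sup>+r. ennreal (- (r * (m - A * r\<^sup>2) * exp (- r\<^sup>2 / 2))) * indicator {b..} r \<partial>lborel)"
  proof (intro nn_integral_cong)
    fix r
    show "ennreal (?g r) * indicator {b..} r = ennreal (- (r * (m - A * r\<^sup>2) * exp (- r\<^sup>2 / 2))) * indicator {b..} r"
      using sgn'[of r] by (cases "b \<le> r") (simp_all add: abs_if algebra_simps)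
  qed
  also have "\<dots> = ennreal (0 - (- F b))"
  proof (rule nn_integral_FTC_atLeast)
    show "((\<lambda>r. - F r) \<longlongrightarrow> 0) at_top" unfolding F_def by real_asymp
    fix r assume r: "b \<le> r"
    show "((\<lambda>r. - F r) has_real_derivative - (r * (m - A * r\<^sup>2) * exp (- r\<^sup>2 / 2))) (at r)"
      by (intro DERIV_minus dF)
    have "0 \<le> r * (A * r\<^sup>2 - m) * exp (- r\<^sup>2 / 2)" using sgn'[OF r] b(1) r by (intro mult_nonneg_nonneg) auto
    then show "0 \<le> - (r * (m - A * r\<^sup>2) * exp (- r\<^sup>2 / 2))" by (simp add: algebra_simps)
  qed measurable
  finally have 2: "(\<integral>\<^sup>+r. ennreal (?g r) * indicator {b..} r \<partial>lborel) = ennreal (F b)" by simp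
  have Fb: "F b = 2 * A * exp (- m / (2 * A))"
  proof -
    have "b\<^sup>2 = m / A" using b(2) A by (simp add: field_simps)
    then show ?thesis using b(2) A by (simp add: F_def)
  qed
  have mono: "F 0 \<le> F b"
    by (rule DERIV_nonneg_imp_nondecreasing[OF b(1)])
       (use dF sgn in \<open>auto intro!: exI conjI mult_nonneg_nonneg\<close>)
  have "(\<integral>\<^sup>+r. ennreal (?g r) * indicator {0..} r \<partial>lborel) =
     (\<integral>\<^sup>+r. ennreal (?g r) * indicator {0..b} r + ennreal (?g r) * indicator {b..} r \<partial>lborel)"
    using b(1) by (intro nn_integral_cong_AE AE_I[where N="{b}"]) (auto split: split_indicator)
  also have "\<dots> = ennreal (F b - F 0) + ennreal (F b)"
    unfolding 1[symmetric] 2[symmetric] by (rule nn_integral_add) measurable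
  also have "\<dots> = ennreal (F b - F 0 + F b)"
    using mono Fb A by (intro ennreal_plus[symmetric]) auto
  finally have half: "(\<integral>\<^sup>+r. ennreal (?g r) * indicator {0..} r \<partial>lborel) = ennreal (F b - F 0 + F b)" .
  have "(\<integral>\<^sup>+x. \<integral>\<^sup>+y. ennreal \<bar>A * (x\<^sup>2 + y\<^sup>2) - m\<bar> \<partial>std_normal \<partial>std_normal) =
     (\<integral>\<^sup>+x. \<integral>\<^sup>+y. ?h (x\<^sup>2 + y\<^sup>2) \<partial>lborel \<partial>lborel)"
    by (rule nn_integral_std_normal2) measurable
  also have "\<dots> = ennreal pi * (\<integral>\<^sup>+r. ennreal \<bar>r\<bar> * ?h (r\<^sup>2) \<partial>lborel)"
    by (rule nn_integral_polar) measurable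
  also have "(\<integral>\<^sup>+r. ennreal \<bar>r\<bar> * ?h (r\<^sup>2) \<partial>lborel) = 2 * (\<integral>\<^sup>+r. (ennreal \<bar>r\<bar> * ?h (r\<^sup>2)) * indicator {0..} r \<partial>lborel)"
    by (rule nn_integral_even_half) auto
  also have "(\<integral>\<^sup>+r. (ennreal \<bar>r\<bar> * ?h (r\<^sup>2)) * indicator {0..} r \<partial>lborel) =
      (\<integral>\<^sup>+r. ennreal (1 / (2 * pi)) * (ennreal (?g r) * indicator {0..} r) \<partial>lborel)"
    by (intro nn_integral_cong) (auto split: split_indicator simp: ennreal_mult[symmetric] field_simps)
  also have "\<dots> = ennreal (1 / (2 * pi)) * ennreal (F b - F 0 + F b)"
    unfolding half[symmetric] by (rule nn_integral_cmult) measurable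
  also have "ennreal pi * (2 * (ennreal (1 / (2 * pi)) * ennreal (F b - F 0 + F b))) = ennreal (F b - F 0 + F b)"
  proof -
    have w: "ennreal pi * (2 * (ennreal (1 / (2 * pi)) * ennreal W)) = ennreal (pi * (2 * (1 / (2 * pi) * W)))" for W
      by (subst ennreal_mult', simp, subst ennreal_mult', simp, subst ennreal_mult') simp_all
    show ?thesis unfolding w by (rule arg_cong[where f=ennreal]) (simp add: field_simps)
  qed
  also have "F b - F 0 + F b = m - 2 * A + 4 * A * exp (- m / (2 * A))"
    unfolding Fb by (simp add: F_def)
  finally show ?thesis .
qed

lemma abs_moment_three:
  fixes A C :: real
  assumes A: "A > 0" and C: "C > 0"
  shows "(\<integral>\<^sup>+p. \<integral>\<^sup>+x. \<integral>\<^sup>+y. ennreal \<bar>A * (x\<^sup>2 + y\<^sup>2) - C * p\<^sup>2\<bar> \<partial>std_normal \<partial>std_normal \<partial>std_normal) =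
    ennreal (C - 2 * A + 4 * A * sqrt (A / (A + C)))"
proof -
  let ?f = "\<lambda>p. C * p\<^sup>2 - 2 * A + 4 * A * exp (- (C * p\<^sup>2) / (2 * A))"
  \<comment> \<open>Completing the square: the normal density times
    \<open>exp (- C * p^2 / (2 * A))\<close> is \<open>s\<close> times the centred normal density
    with standard deviation \<open>s\<close>.\<close>
  define s where "s = sqrt (A / (A + C))"
  have s: "s > 0" "s\<^sup>2 = A / (A + C)" using A C by (auto simp: s_def)
  have n: "std_normal_density p * exp (- (C * p\<^sup>2) / (2 * A)) = s * normal_density 0 s p" for p
  proof -
    have "- p\<^sup>2 / 2 + - (C * p\<^sup>2) / (2 * A) = - p\<^sup>2 / (2 * s\<^sup>2)"
      unfolding s(2) using A C by (simp add: field_simps)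
    moreover have "sqrt (2 * pi * s\<^sup>2) = sqrt (2 * pi) * s" using s(1) by (simp add: real_sqrt_mult)
    ultimately show ?thesis using s(1)
      by (simp add: std_normal_density_def normal_density_def mult_exp_exp)
  qed
  have i2: "has_bochner_integral lborel (\<lambda>p. std_normal_density p * p\<^sup>2) 1"
    using std_normal_moment_even[of 1] by simp
  have i0: "has_bochner_integral lborel std_normal_density 1"
    using integral_normal_density[of 1 0] integrable_normal_density[of 1 0] by (auto simp: has_bochner_integral_iff)
  have ie: "has_bochner_integral lborel (\<lambda>p. s * normal_density 0 s p) s"
    using s(1) integral_normal_density[of s 0] integrable_normal_density[of s 0] by (auto simp: has_bochner_integral_iff)
  have "has_bochner_integral lborel (\<lambda>p. C * (std_normal_density p * p\<^sup>2) + (- 2 * A) * std_normal_density p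
     + (4 * A) * (s * normal_density 0 s p)) (C * 1 + (- 2 * A) * 1 + (4 * A) * s)"
    by (intro has_bochner_integral_add has_bochner_integral_mult_right i2 i0 ie)
  moreover have "C * (std_normal_density p * p\<^sup>2) + (- 2 * A) * std_normal_density p
     + (4 * A) * (s * normal_density 0 s p) = std_normal_density p * ?f p" for p
    unfolding n[symmetric] by (simp add: algebra_simps)
  ultimately have h: "has_bochner_integral lborel (\<lambda>p. std_normal_density p * ?f p) (C - 2 * A + 4 * A * s)"
    by simp
  \<comment> \<open>Nonnegativity is not visible from the closed form, and \<open>ennreal\<close>
    would truncate negative values. With \<open>u = C * p^2 / (2 * A)\<close> it follows from
    \<open>1 - u <= exp (- u)\<close> for \<open>u <= 1\<close> and is immediate for larger
    \<open>u\<close>.\<close>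
  have nn: "0 \<le> ?f p" for p
  proof -
    have "- (C * p\<^sup>2) / (2 * A) + 1 \<le> exp (- (C * p\<^sup>2) / (2 * A))" by (metis exp_ge_add_one_self add.commute)
    have "(C * p\<^sup>2) / (2 * A) \<ge> 0" using A C by simp
    define u where "u = (C * p\<^sup>2) / (2 * A)"
    have u: "u \<ge> 0" "C * p\<^sup>2 = 2 * A * u" using A C by (auto simp: u_def)
    have "1 - u \<le> exp (- u)" using exp_ge_add_one_self[of "- u"] by simp
    have "u - 1 + 2 * exp (- u) \<ge> 0"
    proof (cases "u \<le> 1")
      case True then show ?thesis using \<open>1 - u \<le> exp (- u)\<close> by linarith
    next
      case False then show ?thesis by (simp add: add_nonneg_nonneg)
    qed
    then have "2 * A * (u - 1 + 2 * exp (- u)) \<ge> 0" using A by (intro mult_nonneg_nonneg) auto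
    moreover have "?f p = 2 * A * (u - 1 + 2 * exp (- u))"
      using A unfolding u(2) by (simp add: algebra_simps)
    ultimately show ?thesis by simp
  qed
  have "(\<integral>\<^sup>+p. \<integral>\<^sup>+x. \<integral>\<^sup>+y. ennreal \<bar>A * (x\<^sup>2 + y\<^sup>2) - C * p\<^sup>2\<bar> \<partial>std_normal \<partial>std_normal \<partial>std_normal) =
     (\<integral>\<^sup>+p. ennreal (?f p) \<partial>std_normal)"
    using A C by (intro nn_integral_cong abs_moment_exponential) auto
  also have "\<dots> = ennreal (LINT p|lborel. std_normal_density p * ?f p)"
    using h nn by (intro nn_integral_std_normal_eq) (auto simp: has_bochner_integral_iff)
  also have "\<dots> = ennreal (C - 2 * A + 4 * A * s)"
    using h by (simp add: has_bochner_integral_iff)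
  finally show ?thesis unfolding s_def .
qed

text \<open>The resultant of two binary quadratic forms with coefficient vectors \<open>(X, Y, Z)\<close> and
  \<open>(X', Y', Z')\<close> with respect to \<open>s\<^sup>2 - t\<^sup>2\<close>, \<open>2 s t\<close>, \<open>s\<^sup>2 + t\<^sup>2\<close>, up to a factor 4.\<close>

abbreviation weighted_resultant :: "real \<Rightarrow> real \<Rightarrow> real \<Rightarrow> real \<Rightarrow> real \<Rightarrow> real \<Rightarrow> real \<Rightarrow> real \<Rightarrow> real" where
  "weighted_resultant A C X X' Y Y' Z Z' \<equiv>
     A * ((Z * X' - X * Z')\<^sup>2 + (Z * Y' - Y * Z')\<^sup>2) - C * (X * Y' - Y * X')\<^sup>2"

lemma polar_unit:
  fixes Z Z' :: real
  obtains c s r where "c\<^sup>2 + s\<^sup>2 = 1" "Z = r * c" "Z' = r * s" "Z\<^sup>2 + Z'\<^sup>2 = r\<^sup>2"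
proof (cases "Z\<^sup>2 + Z'\<^sup>2 = 0")
  case True
  then show ?thesis using that[of 1 0 0] by (auto simp: sum_power2_eq_zero_iff)
next
  case False
  then have p: "Z\<^sup>2 + Z'\<^sup>2 > 0" by (metis sum_power2_ge_zero order_le_less)
  define r where "r = sqrt (Z\<^sup>2 + Z'\<^sup>2)"
  have r: "r > 0" "r\<^sup>2 = Z\<^sup>2 + Z'\<^sup>2" using p by (auto simp: r_def)
  show ?thesis
    by (rule that[of "Z / r" "Z' / r" r]) (use r p in \<open>auto simp: power_divide add_divide_distrib[symmetric]\<close>)
qed

text \<open>A rotation mixing the primed with the unprimed form preserves the Gaussian law. The one
  carrying \<open>(Z, Z')\<close> to \<open>(r, 0)\<close> turns the resultant into
  \<open>A * r^2 * (v^2 + v'^2) - C * (u * v' - u' * v)^2\<close>. For fixed \<open>v\<close>,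
  \<open>v'\<close>, a rotation of \<open>u\<close>, \<open>u'\<close> makes the bracket a normal
  variable times the length of \<open>(v, v')\<close>; the mean of \<open>v^2 + v'^2\<close> is the
  factor 2.\<close>

lemma expected_resultant_fixed:
  fixes A C Z Z' :: real
  shows "(\<integral>\<^sup>+Y. \<integral>\<^sup>+Y'. \<integral>\<^sup>+X. \<integral>\<^sup>+X'. ennreal \<bar>weighted_resultant A C X X' Y Y' Z Z'\<bar> \<partial>std_normal \<partial>std_normal \<partial>std_normal \<partial>std_normal)
    = 2 * (\<integral>\<^sup>+p. ennreal \<bar>A * (Z\<^sup>2 + Z'\<^sup>2) - C * p\<^sup>2\<bar> \<partial>std_normal)"
proof -
  obtain c s r where cs: "c\<^sup>2 + s\<^sup>2 = 1" and Z: "Z = r * c" "Z' = r * s" "Z\<^sup>2 + Z'\<^sup>2 = r\<^sup>2"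
    by (rule polar_unit)
  let ?F = "\<lambda>X X' Y Y'. ennreal \<bar>weighted_resultant A C X X' Y Y' Z Z'\<bar>"
  let ?G = "\<lambda>u v u' v'. ennreal \<bar>A * r\<^sup>2 * (v\<^sup>2 + v'\<^sup>2) - C * (u * v' - u' * v)\<^sup>2\<bar>"
  have id1: "Z * (s * u + c * v) - (c * u - s * v) * Z' = r * v" for u v
  proof -
    have "Z * (s * u + c * v) - (c * u - s * v) * Z' = r * v * (c\<^sup>2 + s\<^sup>2)"
      unfolding Z by (simp add: algebra_simps power2_eq_square)
    then show ?thesis using cs by simp
  qed
  have id2: "(c * u - s * v) * (s * u' + c * v') - (c * u' - s * v') * (s * u + c * v) = u * v' - u' * v" for u v u' v'
  proof -
    have "(c * u - s * v) * (s * u' + c * v') - (c * u' - s * v') * (s * u + c * v) = (u * v' - u' * v) * (c\<^sup>2 + s\<^sup>2)"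
      by (simp add: algebra_simps power2_eq_square)
    then show ?thesis using cs by simp
  qed
  have rot: "?F (c * u - s * v) (s * u + c * v) (c * u' - s * v') (s * u' + c * v') = ?G u v u' v'" for u v u' v'
    unfolding id1 id2 by (simp add: power_mult_distrib algebra_simps)
  have "(\<integral>\<^sup>+Y. \<integral>\<^sup>+Y'. \<integral>\<^sup>+X. \<integral>\<^sup>+X'. ?F X X' Y Y' \<partial>std_normal \<partial>std_normal \<partial>std_normal \<partial>std_normal)
    = (\<integral>\<^sup>+Y. \<integral>\<^sup>+Y'. \<integral>\<^sup>+u. \<integral>\<^sup>+v. ?F (c * u - s * v) (s * u + c * v) Y Y' \<partial>std_normal \<partial>std_normal \<partial>std_normal \<partial>std_normal)"
    by (intro nn_integral_cong std_normal_rotation[OF _ cs, symmetric]) measurable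
  also have "\<dots> = (\<integral>\<^sup>+u'. \<integral>\<^sup>+v'. \<integral>\<^sup>+u. \<integral>\<^sup>+v. ?F (c * u - s * v) (s * u + c * v) (c * u' - s * v') (s * u' + c * v')
      \<partial>std_normal \<partial>std_normal \<partial>std_normal \<partial>std_normal)"
    by (rule std_normal_rotation[OF _ cs, symmetric]) measurable
  also have "\<dots> = (\<integral>\<^sup>+u'. \<integral>\<^sup>+v'. \<integral>\<^sup>+u. \<integral>\<^sup>+v. ?G u v u' v' \<partial>std_normal \<partial>std_normal \<partial>std_normal \<partial>std_normal)"
    by (simp only: rot)
  \<comment> \<open>The exchanges move \<open>u\<close> and \<open>u'\<close> to the inside, so that
    they can be rotated while \<open>v\<close> and \<open>v'\<close> are held fixed.\<close>
  also have "\<dots> = (\<integral>\<^sup>+v'. \<integral>\<^sup>+u'. \<integral>\<^sup>+u. \<integral>\<^sup>+v. ?G u v u' v' \<partial>std_normal \<partial>std_normal \<partial>std_normal \<partial>std_normal)"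
    by (rule nn_integral_std_normal_swap) measurable
  also have "\<dots> = (\<integral>\<^sup>+v'. \<integral>\<^sup>+u'. \<integral>\<^sup>+v. \<integral>\<^sup>+u. ?G u v u' v' \<partial>std_normal \<partial>std_normal \<partial>std_normal \<partial>std_normal)"
    by (intro nn_integral_cong nn_integral_std_normal_swap) measurable
  also have "\<dots> = (\<integral>\<^sup>+v'. \<integral>\<^sup>+v. \<integral>\<^sup>+u'. \<integral>\<^sup>+u. ?G u v u' v' \<partial>std_normal \<partial>std_normal \<partial>std_normal \<partial>std_normal)"
    by (intro nn_integral_cong nn_integral_std_normal_swap) measurable
  also have "\<dots> = (\<integral>\<^sup>+v'. \<integral>\<^sup>+v. ennreal (v\<^sup>2 + v'\<^sup>2) * (\<integral>\<^sup>+p. ennreal \<bar>A * r\<^sup>2 - C * p\<^sup>2\<bar> \<partial>std_normal) \<partial>std_normal \<partial>std_normal)"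
  proof (intro nn_integral_cong)
    fix v' v :: real
    obtain c s n where cs: "c\<^sup>2 + s\<^sup>2 = 1" and v: "v' = n * c" "- v = n * s" "v'\<^sup>2 + (- v)\<^sup>2 = n\<^sup>2"
      by (rule polar_unit)
    have cs': "c\<^sup>2 + (- s)\<^sup>2 = 1" using cs by simp
    have id: "((- s) * x + c * y) * v' - (c * x - (- s) * y) * v = n * y" for x y
    proof -
      have "v = - (n * s)" using v(2) by simp
      then have "((- s) * x + c * y) * v' - (c * x - (- s) * y) * v = n * y * (c\<^sup>2 + s\<^sup>2)"
        unfolding v(1) by (simp add: algebra_simps power2_eq_square)
      then show ?thesis using cs by simp
    qed
    have n: "v\<^sup>2 + v'\<^sup>2 = n\<^sup>2" using v(3) by simp
    have G: "?G ((- s) * x + c * y) v (c * x - (- s) * y) v' = ennreal (n\<^sup>2) * ennreal \<bar>A * r\<^sup>2 - C * y\<^sup>2\<bar>" for x y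
    proof -
      have "A * r\<^sup>2 * n\<^sup>2 - C * (n * y)\<^sup>2 = n\<^sup>2 * (A * r\<^sup>2 - C * y\<^sup>2)"
        by (simp add: algebra_simps power_mult_distrib)
      then show ?thesis unfolding id n by (simp add: abs_mult ennreal_mult)
    qed
    have "(\<integral>\<^sup>+u'. \<integral>\<^sup>+u. ?G u v u' v' \<partial>std_normal \<partial>std_normal) =
      (\<integral>\<^sup>+x. \<integral>\<^sup>+y. ?G ((- s) * x + c * y) v (c * x - (- s) * y) v' \<partial>std_normal \<partial>std_normal)"
      by (rule std_normal_rotation[OF _ cs', symmetric]) measurable
    also have "\<dots> = ennreal (n\<^sup>2) * (\<integral>\<^sup>+p. ennreal \<bar>A * r\<^sup>2 - C * p\<^sup>2\<bar> \<partial>std_normal)"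
      using sn.emeasure_space_1 unfolding G by (simp add: nn_integral_cmult)
    finally show "(\<integral>\<^sup>+u'. \<integral>\<^sup>+u. ?G u v u' v' \<partial>std_normal \<partial>std_normal) =
      ennreal (v\<^sup>2 + v'\<^sup>2) * (\<integral>\<^sup>+p. ennreal \<bar>A * r\<^sup>2 - C * p\<^sup>2\<bar> \<partial>std_normal)" unfolding n .
  qed
  also have "\<dots> = (\<integral>\<^sup>+v'. \<integral>\<^sup>+v. ennreal (v\<^sup>2 + v'\<^sup>2) \<partial>std_normal \<partial>std_normal) * (\<integral>\<^sup>+p. ennreal \<bar>A * r\<^sup>2 - C * p\<^sup>2\<bar> \<partial>std_normal)"
    by (simp add: nn_integral_multc)
  also have "(\<integral>\<^sup>+v'. \<integral>\<^sup>+v. ennreal (v\<^sup>2 + v'\<^sup>2) \<partial>std_normal \<partial>std_normal) = 2"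
  proof -
    have [simp]: "emeasure std_normal UNIV = 1" using sn.emeasure_space_1 by simp
    have "(\<integral>\<^sup>+v. ennreal (v\<^sup>2 + v'\<^sup>2) \<partial>std_normal) = 1 + ennreal (v'\<^sup>2)" for v' :: real
      by (simp add: ennreal_plus nn_integral_add nn_integral_std_normal_square sn.emeasure_space_1)
    then show ?thesis
      by (simp add: nn_integral_add nn_integral_std_normal_square sn.emeasure_space_1)
  qed
  finally show ?thesis unfolding Z(3) .
qed

lemma expected_resultant:
  fixes A C :: real
  assumes A: "A > 0" and C: "C > 0"
  shows "(\<integral>\<^sup>+Z. \<integral>\<^sup>+Z'. \<integral>\<^sup>+Y. \<integral>\<^sup>+Y'. \<integral>\<^sup>+X. \<integral>\<^sup>+X'. ennreal \<bar>weighted_resultant A C X X' Y Y' Z Z'\<bar>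
      \<partial>std_normal \<partial>std_normal \<partial>std_normal \<partial>std_normal \<partial>std_normal \<partial>std_normal) =
    ennreal (2 * (C - 2 * A + 4 * A * sqrt (A / (A + C))))"
proof -
  have "(\<integral>\<^sup>+Z. \<integral>\<^sup>+Z'. \<integral>\<^sup>+Y. \<integral>\<^sup>+Y'. \<integral>\<^sup>+X. \<integral>\<^sup>+X'. ennreal \<bar>weighted_resultant A C X X' Y Y' Z Z'\<bar>
      \<partial>std_normal \<partial>std_normal \<partial>std_normal \<partial>std_normal \<partial>std_normal \<partial>std_normal) =
    2 * (\<integral>\<^sup>+Z. \<integral>\<^sup>+Z'. \<integral>\<^sup>+p. ennreal \<bar>A * (Z\<^sup>2 + Z'\<^sup>2) - C * p\<^sup>2\<bar> \<partial>std_normal \<partial>std_normal \<partial>std_normal)"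
    unfolding expected_resultant_fixed by (simp add: nn_integral_cmult)
  also have "(\<integral>\<^sup>+Z. \<integral>\<^sup>+Z'. \<integral>\<^sup>+p. ennreal \<bar>A * (Z\<^sup>2 + Z'\<^sup>2) - C * p\<^sup>2\<bar> \<partial>std_normal \<partial>std_normal \<partial>std_normal)
    = (\<integral>\<^sup>+Z. \<integral>\<^sup>+p. \<integral>\<^sup>+Z'. ennreal \<bar>A * (Z\<^sup>2 + Z'\<^sup>2) - C * p\<^sup>2\<bar> \<partial>std_normal \<partial>std_normal \<partial>std_normal)"
    by (intro nn_integral_cong nn_integral_std_normal_swap) measurable
  also have "\<dots> = (\<integral>\<^sup>+p. \<integral>\<^sup>+Z. \<integral>\<^sup>+Z'. ennreal \<bar>A * (Z\<^sup>2 + Z'\<^sup>2) - C * p\<^sup>2\<bar> \<partial>std_normal \<partial>std_normal \<partial>std_normal)"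
    by (rule nn_integral_std_normal_swap) measurable
  also have "\<dots> = ennreal (C - 2 * A + 4 * A * sqrt (A / (A + C)))"
    by (rule abs_moment_three[OF A C])
  also have "2 * ennreal (C - 2 * A + 4 * A * sqrt (A / (A + C))) = ennreal (2 * (C - 2 * A + 4 * A * sqrt (A / (A + C))))"
    by (subst ennreal_mult') simp_all
  finally show ?thesis .
qed

section \<open>Planes in four-space via quaternions\<close>

definition mk4 :: "real \<Rightarrow> real \<Rightarrow> real \<Rightarrow> real \<Rightarrow> real^4" where
  "mk4 a b c d = (\<chi> i. if i = 1 then a else if i = 2 then b else if i = 3 then c else d)"

lemma mk4_nth[simp]: "mk4 a b c d $ 1 = a" "mk4 a b c d $ 2 = b" "mk4 a b c d $ 3 = c" "mk4 a b c d $ 4 = d"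
  by (simp_all add: mk4_def)

lemma vec4_eq_iff: "x = y \<longleftrightarrow> x $ 1 = y $ 1 \<and> x $ 2 = y $ 2 \<and> x $ 3 = y $ 3 \<and> x $ 4 = (y :: real^4) $ 4"
  by (simp add: vec_eq_iff forall_4)

lemma inner4: "x \<bullet> y = x $ 1 * y $ 1 + x $ 2 * y $ 2 + x $ 3 * y $ 3 + x $ 4 * (y :: real^4) $ 4"
  by (simp add: inner_vec_def sum_4)

text \<open>Points of \<open>\<real>\<^sup>4\<close> are multiplied as quaternions.\<close>

definition qm :: "real^4 \<Rightarrow> real^4 \<Rightarrow> real^4" where
  "qm x y = mk4
    (x $ 1 * y $ 1 - x $ 2 * y $ 2 - x $ 3 * y $ 3 - x $ 4 * y $ 4)
    (x $ 1 * y $ 2 + x $ 2 * y $ 1 + x $ 3 * y $ 4 - x $ 4 * y $ 3)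
    (x $ 1 * y $ 3 - x $ 2 * y $ 4 + x $ 3 * y $ 1 + x $ 4 * y $ 2)
    (x $ 1 * y $ 4 + x $ 2 * y $ 3 - x $ 3 * y $ 2 + x $ 4 * y $ 1)"

definition qcnj :: "real^4 \<Rightarrow> real^4" where
  "qcnj x = mk4 (x $ 1) (- x $ 2) (- x $ 3) (- x $ 4)"

definition q1 :: "real^4" where "q1 = mk4 1 0 0 0"
definition qi :: "real^4" where "qi = mk4 0 1 0 0"
definition qk :: "real^4" where "qk = mk4 0 0 0 1"

lemma qm_assoc: "qm (qm x y) z = qm x (qm y z)"
  by (simp add: qm_def vec4_eq_iff algebra_simps)

lemma qm_q1[simp]: "qm q1 x = x" "qm x q1 = x"
  by (simp_all add: qm_def q1_def vec4_eq_iff)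

lemma qm_linear:
  "qm (x + y) z = qm x z + qm y z" "qm x (y + z) = qm x y + qm x z"
  "qm (c *\<^sub>R x) z = c *\<^sub>R qm x z" "qm x (c *\<^sub>R z) = c *\<^sub>R qm x z"
  "qm (- x) z = - qm x z" "qm x (- z) = - qm x z"
  "qm (x - y) z = qm x z - qm y z" "qm x (y - z) = qm x y - qm x z"
  "qm 0 z = 0" "qm z 0 = 0"
  by (simp_all add: qm_def vec4_eq_iff algebra_simps)

lemma bounded_linear_qm_left: "bounded_linear (\<lambda>x. qm x z)"
  unfolding linear_conv_bounded_linear[symmetric]
  by (rule linearI) (simp_all add: qm_linear)

lemma bounded_linear_qm_right: "bounded_linear (qm z)"
  unfolding linear_conv_bounded_linear[symmetric]
  by (rule linearI) (simp_all add: qm_linear)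

lemma qcnj_linear: "qcnj (x + y) = qcnj x + qcnj y" "qcnj (c *\<^sub>R x) = c *\<^sub>R qcnj x" "qcnj (- x) = - qcnj x"
  by (simp_all add: qcnj_def vec4_eq_iff)

lemma bounded_linear_qcnj: "bounded_linear qcnj"
  unfolding linear_conv_bounded_linear[symmetric]
  by (rule linearI) (simp_all add: qcnj_linear)

lemma qcnj_qm: "qcnj (qm x y) = qm (qcnj y) (qcnj x)"
  by (simp add: qm_def qcnj_def vec4_eq_iff algebra_simps)

lemma qm_qcnj: "qm x (qcnj x) = (x \<bullet> x) *\<^sub>R q1" "qm (qcnj x) x = (x \<bullet> x) *\<^sub>R q1"
  by (simp_all add: qm_def qcnj_def q1_def vec4_eq_iff inner4)

lemma qm_inner: "qm x y \<bullet> qm x z = (x \<bullet> x) * (y \<bullet> z)" "qm y x \<bullet> qm z x = (x \<bullet> x) * (y \<bullet> z)"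
  by (simp_all add: qm_def inner4) (simp_all add: algebra_simps)

lemma qcnj_inner: "qcnj x \<bullet> qcnj x = x \<bullet> x"
  by (simp add: qcnj_def inner4)

text \<open>The unit quaternion \<open>exp (f i) exp (t k)\<close>. A third Euler factor
  \<open>exp (s i)\<close> on the right would map the base plane to itself, so two angles per side
  suffice.\<close>

definition spin :: "real \<Rightarrow> real \<Rightarrow> real^4" where
  "spin f t = mk4 (cos f * cos t) (sin f * cos t) (- (sin f * sin t)) (cos f * sin t)"

lemma spin_unit[simp]: "spin f t \<bullet> spin f t = 1"
proof -
  have "spin f t \<bullet> spin f t = ((cos f)\<^sup>2 + (sin f)\<^sup>2) * ((cos t)\<^sup>2 + (sin t)\<^sup>2)"
    unfolding spin_def inner4 mk4_nth by algebra
  then show ?thesis by simp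
qed

lemma spin_inverse[simp]:
  "qm (spin f t) (qcnj (spin f t)) = q1" "qm (qcnj (spin f t)) (spin f t) = q1"
  "qm (spin f t) (qm (qcnj (spin f t)) x) = x" "qm (qcnj (spin f t)) (qm (spin f t) x) = x"
  by (simp_all add: qm_qcnj flip: qm_assoc)

definition frame :: "real \<Rightarrow> real \<Rightarrow> real \<Rightarrow> real \<Rightarrow> real^4 \<Rightarrow> real^4" where
  "frame f t f' t' y = qm (spin f t) (qm y (qcnj (spin f' t')))"

definition coframe :: "real \<Rightarrow> real \<Rightarrow> real \<Rightarrow> real \<Rightarrow> real^4 \<Rightarrow> real^4" where
  "coframe f t f' t' x = qm (qcnj (spin f t)) (qm x (spin f' t'))"

lemma frame_coframe[simp]: "frame f t f' t' (coframe f t f' t' x) = x" "coframe f t f' t' (frame f t f' t' x) = x"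
  by (simp_all add: frame_def coframe_def qm_assoc)

lemma coframe_inner: "coframe f t f' t' x \<bullet> coframe f t f' t' y = x \<bullet> y"
  by (simp add: coframe_def qm_inner qcnj_inner)

lemma linear_frame: "linear (frame f t f' t')"
  by (rule linearI) (simp_all add: frame_def qm_linear)

section \<open>Planes as rotated copies of the base plane\<close>

definition base_plane :: "(real^4) set" where "base_plane = {x. x $ 3 = 0 \<and> x $ 4 = 0}"

definition plane :: "real \<Rightarrow> real \<Rightarrow> real \<Rightarrow> real \<Rightarrow> (real^4) set" where
  "plane f t f' t' = {x. coframe f t f' t' x \<in> base_plane}"

lemma base_plane_span: "base_plane = span {axis 1 1, axis 2 1}"
proof -
  have "x \<in> span {axis 1 1, axis 2 1} \<longleftrightarrow> (\<exists>a b. x = a *\<^sub>R axis 1 1 + b *\<^sub>R axis 2 1)" for x :: "real^4"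
    by (simp add: span_insert algebra_simps)
  moreover have "x \<in> base_plane \<longleftrightarrow> (\<exists>a b. x = a *\<^sub>R axis 1 1 + b *\<^sub>R axis 2 1)" for x
    by (auto simp: base_plane_def vec4_eq_iff axis_def)
  ultimately show ?thesis by blast
qed

lemma dim_base_plane: "dim base_plane = 2"
proof -
  have "independent {axis 1 1, axis 2 1 :: real^4}"
    by (rule independent_mono[OF independent_Basis]) (auto simp: Basis_vec_def)
  moreover have "axis 1 1 \<noteq> (axis 2 1 :: real^4)" by (simp add: axis_eq_axis)
  ultimately show ?thesis
    unfolding base_plane_span dim_span by (subst dim_eq_card_independent) auto
qed

lemma plane_eq_frame: "plane f t f' t' = frame f t f' t' ` base_plane"
  by (force simp: plane_def image_iff)

lemma subspace_base_plane: "subspace base_plane"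
  unfolding base_plane_span by (rule subspace_span)

lemma subspace_plane: "subspace (plane f t f' t')"
  unfolding plane_eq_frame by (intro linear_subspace_image linear_frame subspace_base_plane)

lemma dim_plane: "dim (plane f t f' t') = 2"
proof -
  have "inj_on (frame f t f' t') A" for A by (metis inj_onI frame_coframe(2))
  then show ?thesis
    unfolding plane_eq_frame by (subst dim_image_eq) (auto simp: linear_frame dim_base_plane)
qed

text \<open>A plane consists of the solutions of \<open>u x = x v\<close> for two imaginary unit quaternions, and these
  are determined by the plane up to a common sign.\<close>

definition dir :: "real \<Rightarrow> real \<Rightarrow> real^4" where
  "dir f t = mk4 0 (cos (2 * t)) (sin (2 * t) * cos (2 * f)) (sin (2 * t) * sin (2 * f))"

lemma spin_factor: "spin f t = qm (mk4 (cos f) (sin f) 0 0) (mk4 (cos t) 0 0 (sin t))"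
  by (simp add: spin_def qm_def vec4_eq_iff)

text \<open>\<open>dir f t\<close> is \<open>qi\<close> conjugated by \<open>spin f t\<close>.
  Conjugation turns imaginary directions through twice the angle, whence \<open>2 * f\<close> and
  \<open>2 * t\<close>.\<close>

lemma dir_spin: "qm (dir f t) (spin f t) = qm (spin f t) qi"
proof -
  let ?E = "mk4 (cos f) (sin f) 0 0" and ?K = "mk4 (cos t) 0 0 (sin t)"
  let ?w = "mk4 0 (cos (2 * t)) (sin (2 * t)) 0"
  have d: "cos (2 * x) * cos x + sin (2 * x) * sin x = cos x" "sin (2 * x) * cos x - cos (2 * x) * sin x = sin x" for x :: real
    using cos_diff[of "2 * x" x] sin_diff[of "2 * x" x] by simp_all
  have 1: "qm ?K qi = qm ?w ?K"
    using d[of t] by (simp add: qm_def qi_def vec4_eq_iff)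
  have 2: "qm ?E ?w = qm (dir f t) ?E"
  proof -
    have "sin (2 * t) * cos f = sin (2 * t) * (cos (2 * f) * cos f + sin (2 * f) * sin f)"
      "sin (2 * t) * sin f = sin (2 * t) * (sin (2 * f) * cos f - cos (2 * f) * sin f)"
      unfolding d by simp_all
    then show ?thesis by (simp add: qm_def dir_def vec4_eq_iff algebra_simps)
  qed
  show ?thesis unfolding spin_factor by (simp only: qm_assoc 1) (simp only: 2 flip: qm_assoc)
qed

lemma base_plane_commute: "y \<in> base_plane \<longleftrightarrow> qm qi y = qm y qi"
  by (auto simp: base_plane_def qm_def qi_def vec4_eq_iff)

text \<open>The base plane is the centraliser of \<open>qi\<close>; transporting
  \<open>qm qi y = qm y qi\<close> by the two spins turns it into the intertwining relation.\<close>

lemma plane_iff: "x \<in> plane f t f' t' \<longleftrightarrow> qm (dir f t) x = qm x (dir f' t')"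
proof -
  let ?p = "spin f t" and ?q = "spin f' t'"
  define y where "y = coframe f t f' t' x"
  have x: "x = qm ?p (qm y (qcnj ?q))" using frame_coframe(1)[of f t f' t' x] by (simp add: y_def frame_def)
  have 1: "qm (dir f t) x = qm ?p (qm (qm qi y) (qcnj ?q))"
    unfolding x by (simp add: dir_spin flip: qm_assoc)
  have "qcnj (qm (dir f' t') ?q) = qcnj (qm ?q qi)" by (simp add: dir_spin)
  moreover have "qcnj (dir f' t') = - dir f' t'" "qcnj qi = - qi" by (simp_all add: qcnj_def dir_def qi_def vec4_eq_iff)
  ultimately have "qm (qcnj ?q) (dir f' t') = qm qi (qcnj ?q)" by (simp add: qcnj_qm qm_linear)
  then have 2: "qm x (dir f' t') = qm ?p (qm (qm y qi) (qcnj ?q))"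
    unfolding x by (simp add: qm_assoc)
  have "qm ?p (qm a (qcnj ?q)) = qm ?p (qm b (qcnj ?q)) \<longleftrightarrow> a = b" for a b
    by (metis frame_coframe(2) frame_def)
  then show ?thesis unfolding plane_def mem_Collect_eq y_def[symmetric] base_plane_commute 1 2 by simp
qed

text \<open>Spherical coordinates about the axis \<open>qi\<close>, with polar angle
  \<open>2 * t\<close> and azimuth \<open>2 * f\<close>; the closed hemisphere corresponds to
  \<open>t <= pi / 4\<close>.\<close>

lemma unit_imaginary_dir:
  assumes "u $ 1 = 0" "u \<bullet> u = 1" "u $ 2 \<ge> 0"
  shows "\<exists>f t. u = dir f t \<and> 0 \<le> f \<and> f \<le> pi \<and> 0 \<le> t \<and> t \<le> pi / 4"
proof -
  have n: "(u $ 2)\<^sup>2 + ((u $ 3)\<^sup>2 + (u $ 4)\<^sup>2) = 1" using assms(1,2) by (simp add: inner4 power2_eq_square)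
  then have le: "(u $ 2)\<^sup>2 \<le> 1" by (smt (verit) zero_le_power2)
  then have le1: "u $ 2 \<le> 1" by (simp add: abs_square_le_1)
  define t where "t = arccos (u $ 2) / 2"
  have t: "0 \<le> t" "t \<le> pi / 4" "cos (2 * t) = u $ 2"
    using assms(3) le1 arccos_lbound[of "u $ 2"] arccos_le_pi2[of "u $ 2"] by (auto simp: t_def)
  have s: "(sin (2 * t))\<^sup>2 = (u $ 3)\<^sup>2 + (u $ 4)\<^sup>2"
    using n t(3) by (simp add: sin_squared_eq)
  have "\<exists>f. 0 \<le> f \<and> f \<le> pi \<and> u $ 3 = sin (2 * t) * cos (2 * f) \<and> u $ 4 = sin (2 * t) * sin (2 * f)"
  proof (cases "sin (2 * t) = 0")
    case True
    then show ?thesis using s by (intro exI[of _ 0]) (auto simp: sum_power2_eq_zero_iff)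
  next
    case False
    then have "(u $ 3 / sin (2 * t))\<^sup>2 + (u $ 4 / sin (2 * t))\<^sup>2 = 1"
      unfolding power_divide add_divide_distrib[symmetric] s[symmetric] using False by simp
    then obtain w where w: "0 \<le> w" "w < 2 * pi" "u $ 3 / sin (2 * t) = cos w" "u $ 4 / sin (2 * t) = sin w"
      by (rule sincos_total_2pi) blast
    then show ?thesis using False by (intro exI[of _ "w / 2"]) (auto simp: field_simps)
  qed
  then obtain f where "0 \<le> f" "f \<le> pi" "u $ 3 = sin (2 * t) * cos (2 * f)" "u $ 4 = sin (2 * t) * sin (2 * f)" by blast
  then show ?thesis using t assms(1) by (intro exI[of _ f] exI[of _ t]) (auto simp: dir_def vec4_eq_iff)
qed

lemma unit_imaginary_dir':
  assumes "u $ 1 = 0" "u \<bullet> u = 1"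
  shows "\<exists>f t. u = dir f t \<and> 0 \<le> f \<and> f \<le> pi \<and> 0 \<le> t \<and> t \<le> pi / 2"
proof (cases "u $ 2 \<ge> 0")
  case True
  then obtain f t where "u = dir f t" "0 \<le> f" "f \<le> pi" "0 \<le> t" "t \<le> pi / 4"
    using unit_imaginary_dir assms by blast
  moreover from this have "t \<le> pi / 2" using pi_gt_zero by linarith
  ultimately show ?thesis by blast
next
  case False
  let ?w = "mk4 0 (- u $ 2) (u $ 3) (u $ 4)"
  have "?w \<bullet> ?w = 1" using assms by (simp add: inner4)
  then obtain f t where ft: "?w = dir f t" "0 \<le> f" "f \<le> pi" "0 \<le> t" "t \<le> pi / 4"
    using unit_imaginary_dir[of ?w] False by auto
  have d: "cos (2 * (pi / 2 - t)) = - cos (2 * t)" "sin (2 * (pi / 2 - t)) = sin (2 * t)"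
    by (simp_all add: right_diff_distrib cos_diff sin_diff)
  have "u = dir f (pi / 2 - t)" using ft(1) assms(1) unfolding dir_def d by (simp add: vec4_eq_iff)
  moreover have "0 \<le> pi / 2 - t" "pi / 2 - t \<le> pi / 2" using ft by auto
  ultimately show ?thesis using ft by blast
qed

text \<open>For an orthonormal basis \<open>a\<close>, \<open>b\<close>, the quaternions
  \<open>b a^-1\<close> and \<open>a^-1 b\<close> intertwine both basis vectors, and orthogonality
  makes them imaginary. A common change of sign puts the first into the required hemisphere.\<close>

lemma plane_exists:
  assumes V: "subspace V" "dim V = 2"
  shows "\<exists>f t f' t'. V = plane f t f' t' \<and> f \<in> {0..pi} \<and> t \<in> {0..pi / 4} \<and> f' \<in> {0..pi} \<and> t' \<in> {0..pi / 2}"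
proof -
  obtain B where B: "B \<subseteq> V" "pairwise orthogonal B" "\<And>x. x \<in> B \<Longrightarrow> norm x = 1" "independent B" "card B = 2" "span B = V"
    using orthonormal_basis_subspace[OF V(1)] V(2) by metis
  obtain a b where ab: "B = {a, b}" "a \<noteq> b" using B(5) by (meson card_2_iff)
  have o: "a \<bullet> b = 0" "a \<bullet> a = 1" "b \<bullet> b = 1"
    using B(2,3) ab by (auto simp: pairwise_def orthogonal_def norm_eq_1)
  define u where "u = qm b (qcnj a)"
  define v where "v = qm (qcnj a) b"
  have u: "u $ 1 = 0" "u \<bullet> u = 1" and v: "v $ 1 = 0" "v \<bullet> v = 1"
    using o by (simp_all add: u_def v_def qm_inner qcnj_inner) (simp_all add: qm_def qcnj_def inner4 algebra_simps)
  have c: "qm (qcnj a) a = q1" "qm a (qcnj a) = q1" using o by (simp_all add: qm_qcnj)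
  have ca: "qm (qcnj a) (qm a z) = z" "qm a (qm (qcnj a) z) = z" for z by (simp_all add: c flip: qm_assoc)
  have a: "qm u a = qm a v" by (simp add: u_def v_def qm_assoc c ca)
  have b: "qm u b = qm b v" by (simp add: u_def v_def qm_assoc)
  have main: "\<exists>f t f' t'. V = plane f t f' t' \<and> f \<in> {0..pi} \<and> t \<in> {0..pi / 4} \<and> f' \<in> {0..pi} \<and> t' \<in> {0..pi / 2}"
    if w: "w $ 1 = 0" "w \<bullet> w = 1" "w $ 2 \<ge> 0" "w' $ 1 = 0" "w' \<bullet> w' = 1" "qm w a = qm a w'" "qm w b = qm b w'" for w w'
  proof -
    obtain f t where ft: "w = dir f t" "f \<in> {0..pi}" "t \<in> {0..pi / 4}" using unit_imaginary_dir w by force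
    obtain f' t' where ft': "w' = dir f' t'" "f' \<in> {0..pi}" "t' \<in> {0..pi / 2}" using unit_imaginary_dir' w by force
    have "B \<subseteq> plane f t f' t'" using w ft ft' ab by (simp add: plane_iff)
    then have "V \<subseteq> plane f t f' t'" using B(6) span_minimal subspace_plane by metis
    then have "V = plane f t f' t'"
      using subspace_dim_equal[OF V(1) subspace_plane] V(2) by (simp add: dim_plane)
    then show ?thesis using ft ft' by blast
  qed
  show ?thesis
  proof (cases "u $ 2 \<ge> 0")
    case True
    then show ?thesis using main[of u v] u v a b by blast
  next
    case False
    then show ?thesis using main[of "- u" "- v"] u v a b by (simp add: qm_linear)
  qed
qed

lemma orthogonal_in_plane:
  fixes x y z :: "'a::euclidean_space"
  assumes V: "subspace V" "dim V = 2" and m: "x \<in> V" "y \<in> V" "z \<in> V"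
    and xy: "x \<bullet> x = 1" "y \<bullet> y = 1" "z \<bullet> z = 1" "x \<bullet> y = 0" "x \<bullet> z = 0"
  shows "z = y \<or> z = - y"
proof -
  have "pairwise orthogonal {x, y}" using xy by (auto simp: pairwise_def orthogonal_def inner_commute)
  then have ind: "independent {x, y}"
    by (rule pairwise_orthogonal_independent) (use xy in auto)
  have "x \<noteq> y" using xy by auto
  then have "V \<subseteq> span {x, y}" using ind m V by (intro card_ge_dim_independent) auto
  then have "z \<in> span {x, y}" using m(3) by blast
  then obtain p where "z - p *\<^sub>R x \<in> span {y}" using span_breakdown_eq[of z x "{y}"] by blast
  then obtain r where "z - p *\<^sub>R x = r *\<^sub>R y" unfolding span_singleton by blast
  then have z: "z = p *\<^sub>R x + r *\<^sub>R y" by (simp add: diff_eq_eq add.commute)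
  have "p = 0" using xy(5) unfolding z by (simp add: inner_add_right xy)
  then have "z = r *\<^sub>R y" using z by simp
  moreover from this have "r * r = 1" using xy by simp
  then have "r = 1 \<or> r = -1" by (metis power2_eq_1_iff power2_eq_square)
  ultimately show ?thesis by auto
qed

lemma dir_unit: "dir f t \<bullet> dir f t = 1"
proof -
  have "dir f t \<bullet> dir f t = (cos (2 * t))\<^sup>2 + (sin (2 * t))\<^sup>2 * ((cos (2 * f))\<^sup>2 + (sin (2 * f))\<^sup>2)"
    unfolding dir_def inner4 mk4_nth by algebra
  then show ?thesis by simp
qed

lemma dir_inj:
  assumes "dir f t = dir g s" "0 < f" "f < pi" "0 < g" "g < pi" "0 < t" "t < pi / 2" "0 < s" "s < pi / 2"
  shows "f = g \<and> t = s"
proof -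
  have e: "cos (2 * t) = cos (2 * s)" "sin (2 * t) * cos (2 * f) = sin (2 * s) * cos (2 * g)"
    "sin (2 * t) * sin (2 * f) = sin (2 * s) * sin (2 * g)"
    using assms(1) by (auto simp: dir_def vec4_eq_iff)
  have "2 * t = 2 * s" by (rule cos_inj_pi) (use assms(6-9) e(1) in linarith)+
  then have ts: "t = s" by simp
  have "sin (2 * t) > 0" using assms by (intro sin_gt_zero) auto
  then have c: "cos (2 * f) = cos (2 * g)" "sin (2 * f) = sin (2 * g)" using e ts by auto
  have "cos (2 * f - 2 * g) = 1" unfolding cos_diff using c sin_cos_squared_add2[of "2 * g"] by (simp add: power2_eq_square)
  then obtain n :: int where n: "2 * f - 2 * g = of_int n * 2 * pi" using cos_one_2pi_int by auto
  then have "f - g = of_int n * pi" by simp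
  moreover have "\<bar>f - g\<bar> < pi" using assms by auto
  ultimately have "\<bar>of_int n * pi\<bar> < 1 * pi" by simp
  then have "\<bar>of_int n :: real\<bar> < 1" unfolding abs_mult by (simp add: mult_less_cancel_right)
  then have "n = 0" by linarith
  with n ts show ?thesis by simp
qed

text \<open>For a unit vector \<open>x\<close> of the plane, the product of the left direction with
  \<open>x\<close> is a unit vector of the plane orthogonal to \<open>x\<close>, hence unique up to
  sign. The left direction is recovered by cancelling \<open>x\<close>, and the right one
  follows.\<close>

lemma plane_inj:
  assumes eq: "plane f t f' t' = plane g s g' s'"
    and r: "f \<in> {0<..<pi}" "t \<in> {0<..<pi / 4}" "f' \<in> {0<..<pi}" "t' \<in> {0<..<pi / 2}"
      "g \<in> {0<..<pi}" "s \<in> {0<..<pi / 4}" "g' \<in> {0<..<pi}" "s' \<in> {0<..<pi / 2}"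
  shows "f = g \<and> t = s \<and> f' = g' \<and> t' = s'"
proof -
  define V where "V = plane f t f' t'"
  have V: "subspace V" "dim V = 2" by (simp_all add: V_def subspace_plane dim_plane)
  obtain x where x: "x \<in> V" "x \<bullet> x = 1"
  proof -
    have "frame f t f' t' (axis 1 1) \<in> V"
      unfolding V_def plane_eq_frame base_plane_span by (intro imageI span_base) auto
    moreover have "frame f t f' t' (axis 1 1) \<bullet> frame f t f' t' (axis 1 1) = 1"
      by (simp add: frame_def qm_inner qcnj_inner inner_axis_axis)
    ultimately show thesis using that by blast
  qed
  have key: "qm (dir a b) x \<in> V \<and> x \<bullet> qm (dir a b) x = 0 \<and> qm (dir a b) x \<bullet> qm (dir a b) x = 1"
    if "V = plane a b a' b'" for a b a' b'
  proof (intro conjI)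
    have "qm (dir a b) x = qm x (dir a' b')" using x(1) that by (simp add: plane_iff)
    then show "qm (dir a b) x \<in> V" unfolding that plane_iff by (metis qm_assoc)
    show "x \<bullet> qm (dir a b) x = 0" by (simp add: dir_def qm_def inner4 algebra_simps)
    show "qm (dir a b) x \<bullet> qm (dir a b) x = 1" using x(2) by (simp add: qm_inner dir_unit)
  qed
  have "qm (dir g s) x = qm (dir f t) x \<or> qm (dir g s) x = - qm (dir f t) x"
    using key[of f t f' t'] key[of g s g' s'] eq V x by (intro orthogonal_in_plane[of V x]) (auto simp: V_def)
  moreover have "qm (qm w x) (qcnj x) = w" for w using x(2) by (simp add: qm_assoc qm_qcnj)
  ultimately have "dir g s = dir f t \<or> dir g s = - dir f t" by (metis qm_linear(5))
  \<comment> \<open>The open range below \<open>pi / 4\<close> places both left directions in the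
    same open hemisphere, which excludes the opposite sign.\<close>
  moreover have "dir g s $ 2 > 0" "dir f t $ 2 > 0" using r by (auto simp: dir_def intro!: cos_gt_zero)
  ultimately have 1: "dir g s = dir f t" by auto
  have "qm x (dir g' s') = qm x (dir f' t')"
    using x(1) eq 1 unfolding V_def by (metis plane_iff)
  moreover have "qm (qcnj x) (qm x w) = w" for w using x(2) by (simp add: qm_qcnj flip: qm_assoc)
  ultimately have 2: "dir g' s' = dir f' t'" by metis
  have "f = g \<and> t = s" using r by (intro dir_inj[OF 1[symmetric]]) auto
  moreover have "f' = g' \<and> t' = s'" using r by (intro dir_inj[OF 2[symmetric]]) auto
  ultimately show ?thesis by blast
qed

section \<open>Velocities of the moving frame\<close>

lemma spin_eq: "spin f t = cos t *\<^sub>R (cos f *\<^sub>R q1 + sin f *\<^sub>R qi) + sin t *\<^sub>R qm (cos f *\<^sub>R q1 + sin f *\<^sub>R qi) qk"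
  by (simp add: spin_def vec4_eq_iff qm_def q1_def qi_def qk_def)

lemma spin_deriv2: "((\<lambda>t. spin f t) has_vector_derivative qm (spin f t) qk) (at t)"
proof -
  have "((\<lambda>t. spin f t) has_vector_derivative (- sin t) *\<^sub>R (cos f *\<^sub>R q1 + sin f *\<^sub>R qi) + cos t *\<^sub>R qm (cos f *\<^sub>R q1 + sin f *\<^sub>R qi) qk) (at t)"
    unfolding spin_eq by (auto intro!: derivative_eq_intros)
  moreover have "(- sin t) *\<^sub>R (cos f *\<^sub>R q1 + sin f *\<^sub>R qi) + cos t *\<^sub>R qm (cos f *\<^sub>R q1 + sin f *\<^sub>R qi) qk = qm (spin f t) qk"
    by (simp add: spin_def vec4_eq_iff qm_def q1_def qi_def qk_def)
  ultimately show ?thesis by simp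
qed

lemma spin_deriv1: "((\<lambda>f. spin f t) has_vector_derivative qm qi (spin f t)) (at f)"
proof -
  have e: "spin f t = cos f *\<^sub>R (cos t *\<^sub>R q1 + sin t *\<^sub>R qk) + sin f *\<^sub>R qm qi (cos t *\<^sub>R q1 + sin t *\<^sub>R qk)" for f
    by (simp add: spin_def vec4_eq_iff qm_def q1_def qi_def qk_def)
  have "((\<lambda>f. spin f t) has_vector_derivative (- sin f) *\<^sub>R (cos t *\<^sub>R q1 + sin t *\<^sub>R qk) + cos f *\<^sub>R qm qi (cos t *\<^sub>R q1 + sin t *\<^sub>R qk)) (at f)"
    unfolding e by (auto intro!: derivative_eq_intros)
  moreover have "(- sin f) *\<^sub>R (cos t *\<^sub>R q1 + sin t *\<^sub>R qk) + cos f *\<^sub>R qm qi (cos t *\<^sub>R q1 + sin t *\<^sub>R qk) = qm qi (spin f t)"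
    by (simp add: spin_def vec4_eq_iff qm_def q1_def qi_def qk_def)
  ultimately show ?thesis by simp
qed

text \<open>The angle \<open>f\<close> acts by \<open>qi\<close> from the left. Carried into the
  moving frame this generator depends on \<open>t\<close> alone, because \<open>exp (f i)\<close>
  commutes with \<open>qi\<close>; so the angles \<open>f\<close> and \<open>f'\<close> drop out of
  the Jacobian.\<close>

lemma spin_conj_qi: "qm (qcnj (spin f t)) (qm qi (spin f t)) = mk4 0 (cos (2 * t)) (- sin (2 * t)) 0"
proof -
  let ?E = "mk4 (cos f) (sin f) 0 0" and ?K = "mk4 (cos t) 0 0 (sin t)"
  have 1: "qm qi (qm ?E z) = qm ?E (qm qi z)" for z
    by (simp add: qm_def qi_def vec4_eq_iff)
  have 2: "qm (qcnj ?E) (qm ?E z) = z" for z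
    by (simp add: qm_qcnj inner4 flip: qm_assoc power2_eq_square)
  have 3: "qm (qcnj ?K) (qm qi ?K) = mk4 0 (cos (2 * t)) (- sin (2 * t)) 0"
    by (simp add: qm_def qcnj_def qi_def vec4_eq_iff cos_double sin_double power2_eq_square)
  show ?thesis unfolding spin_factor qcnj_qm qm_assoc 1 2 3 ..
qed

text \<open>The velocities are expressed by the frame coordinates \<open>y\<close> of the point, so
  the Jacobian at any plane becomes a computation on the base plane.\<close>

lemma coframe_deriv:
  fixes x :: "real^4"
  assumes y: "y = coframe f t f' t' x"
  shows "((\<lambda>f. coframe f t f' t' x) has_vector_derivative - qm (mk4 0 (cos (2 * t)) (- sin (2 * t)) 0) y) (at f)"
    and "((\<lambda>t. coframe f t f' t' x) has_vector_derivative - qm qk y) (at t)"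
    and "((\<lambda>f'. coframe f t f' t' x) has_vector_derivative qm y (mk4 0 (cos (2 * t')) (- sin (2 * t')) 0)) (at f')"
    and "((\<lambda>t'. coframe f t f' t' x) has_vector_derivative qm y qk) (at t')"
proof -
  have x: "x = qm (spin f t) (qm y (qcnj (spin f' t')))" using frame_coframe(1)[of f t f' t' x] by (simp add: y frame_def)
  have L: "bounded_linear (\<lambda>p. qm (qcnj p) z)" for z
    by (rule bounded_linear_compose[OF bounded_linear_qm_left bounded_linear_qcnj])
  have R: "bounded_linear (\<lambda>p. qm w (qm z p))" for w z
    by (rule bounded_linear_compose[OF bounded_linear_qm_right bounded_linear_qm_right])
  have e: "qm x (spin f' t') = qm (spin f t) y" "qm (qcnj (spin f t)) x = qm y (qcnj (spin f' t'))"
    unfolding x by (simp_all add: qm_assoc)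
  have "((\<lambda>f. coframe f t f' t' x) has_vector_derivative qm (qcnj (qm qi (spin f t))) (qm x (spin f' t'))) (at f)"
    unfolding coframe_def by (rule bounded_linear.has_vector_derivative[OF L spin_deriv1])
  moreover have "qm (qcnj (qm qi (spin f t))) (qm x (spin f' t')) = - qm (mk4 0 (cos (2 * t)) (- sin (2 * t)) 0) y"
  proof -
    have "qcnj qi = - qi" by (simp add: qcnj_def qi_def vec4_eq_iff)
    then show ?thesis
      unfolding e spin_conj_qi[symmetric, of t f] by (simp add: qcnj_qm qm_linear qm_assoc)
  qed
  ultimately show "((\<lambda>f. coframe f t f' t' x) has_vector_derivative - qm (mk4 0 (cos (2 * t)) (- sin (2 * t)) 0) y) (at f)" by simp
  have "((\<lambda>t. coframe f t f' t' x) has_vector_derivative qm (qcnj (qm (spin f t) qk)) (qm x (spin f' t'))) (at t)"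
    unfolding coframe_def by (rule bounded_linear.has_vector_derivative[OF L spin_deriv2])
  moreover have "qm (qcnj (qm (spin f t) qk)) (qm x (spin f' t')) = - qm qk y"
  proof -
    have "qcnj qk = - qk" by (simp add: qcnj_def qk_def vec4_eq_iff)
    then show ?thesis unfolding e by (simp add: qcnj_qm qm_linear qm_assoc)
  qed
  ultimately show "((\<lambda>t. coframe f t f' t' x) has_vector_derivative - qm qk y) (at t)" by simp
  have "((\<lambda>f'. coframe f t f' t' x) has_vector_derivative qm (qcnj (spin f t)) (qm x (qm qi (spin f' t')))) (at f')"
    unfolding coframe_def by (rule bounded_linear.has_vector_derivative[OF R spin_deriv1])
  moreover have "qm (qcnj (spin f t)) (qm x (qm qi (spin f' t'))) = qm y (mk4 0 (cos (2 * t')) (- sin (2 * t')) 0)"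
    unfolding spin_conj_qi[symmetric, of t' f'] x by (simp add: qm_assoc)
  ultimately show "((\<lambda>f'. coframe f t f' t' x) has_vector_derivative qm y (mk4 0 (cos (2 * t')) (- sin (2 * t')) 0)) (at f')" by simp
  have "((\<lambda>t'. coframe f t f' t' x) has_vector_derivative qm (qcnj (spin f t)) (qm x (qm (spin f' t') qk))) (at t')"
    unfolding coframe_def by (rule bounded_linear.has_vector_derivative[OF R spin_deriv2])
  moreover have "qm (qcnj (spin f t)) (qm x (qm (spin f' t') qk)) = qm y qk"
    unfolding x by (simp add: qm_assoc)
  ultimately show "((\<lambda>t'. coframe f t f' t' x) has_vector_derivative qm y qk) (at t')" by simp
qed

section \<open>Isometries, determinants and differentiability\<close>

text \<open>Define the map on a basis chosen among the vectors \<open>b x\<close>. Equal Gram values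
  show that it preserves inner products, and then that \<open>T (b x) - b' x\<close> has length zero
  for every \<open>x\<close>.\<close>

lemma gram_isometry:
  fixes b b' :: "'x \<Rightarrow> 'a::euclidean_space"
  assumes gram: "\<And>x y. b x \<bullet> b y = b' x \<bullet> b' y" and sp: "span (range b) = UNIV"
  shows "\<exists>T. orthogonal_transformation T \<and> (\<forall>x. T (b x) = b' x)"
proof -
  obtain B where B: "B \<subseteq> range b" "independent B" "range b \<subseteq> span B"
    using maximal_independent_subset by blast
  have spB: "span B = UNIV"
    using span_minimal[OF B(3) subspace_span] sp by auto
  define c where "c = inv_into UNIV b"
  have bc: "b (c v) = v" if "v \<in> range b" for v using that by (simp add: c_def f_inv_into_f)
  obtain T where T: "linear T" "\<And>v. v \<in> B \<Longrightarrow> T v = b' (c v)"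
    using linear_independent_extend[OF B(2), of "\<lambda>v. b' (c v)"] by auto
  have 1: "T v \<bullet> b' y = v \<bullet> b y" for v y
  proof -
    have "v \<in> span B" using spB by simp
    then show ?thesis
    proof (induction rule: span_induct_alt)
      case base then show ?case by (simp add: linear_0[OF T(1)])
    next
      case (step k v w)
      have "v \<bullet> b y = b' (c v) \<bullet> b' y" using gram[of "c v" y] bc[of v] step(1) B(1) by auto
      with step show ?case
        by (simp add: linear_add[OF T(1)] linear_scale[OF T(1)] T(2) inner_add_left)
    qed
  qed
  have 2: "T v \<bullet> T w = v \<bullet> w" for v w
  proof -
    have "w \<in> span B" using spB by simp
    then show ?thesis
    proof (induction rule: span_induct_alt)
      case base then show ?case by (simp add: linear_0[OF T(1)])
    next
      case (step k x y)
      have "T v \<bullet> T x = v \<bullet> x" using 1[of v "c x"] bc[of x] step(1) B(1) T(2)[of x] by auto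
      with step show ?case
        by (simp add: linear_add[OF T(1)] linear_scale[OF T(1)] inner_add_right)
    qed
  qed
  have "T (b x) = b' x" for x
  proof -
    have "(T (b x) - b' x) \<bullet> (T (b x) - b' x) = T (b x) \<bullet> T (b x) - 2 * (T (b x) \<bullet> b' x) + b' x \<bullet> b' x"
      by (simp add: inner_diff_left inner_diff_right inner_commute)
    also have "\<dots> = 0" by (simp add: 1 2 gram)
    finally show ?thesis by simp
  qed
  moreover have "orthogonal_transformation T" using T(1) 2 by (simp add: orthogonal_transformation_def)
  ultimately show ?thesis by blast
qed

text \<open>A permutation moving an index outside \<open>I\<close> meets a zero of a unit column.
  The remaining minor is left as a sum over permutations, since \<open>I\<close> is not a dimension
  type.\<close>

lemma det_unit_columns:
  fixes M :: "real^'n^'n"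
  assumes M: "\<And>r j. j \<notin> I \<Longrightarrow> M $ r $ j = (if r = j then 1 else 0)"
  shows "det M = (\<Sum>p | p permutes I. of_int (sign p) * (\<Prod>i\<in>I. M $ i $ p i))"
proof -
  let ?f = "\<lambda>p. of_int (sign p) * (\<Prod>i\<in>UNIV. M $ i $ p i)"
  have "det M = sum ?f {p. p permutes I}"
    unfolding det_def
  proof (rule sum.mono_neutral_right)
    show "{p. p permutes I} \<subseteq> {p. p permutes UNIV}" using permutes_subset[of _ I UNIV] by auto
    show "\<forall>p\<in>{p. p permutes UNIV} - {p. p permutes I}. ?f p = 0"
    proof
      fix p assume p: "p \<in> {p. p permutes UNIV} - {p. p permutes I}"
      then have pU: "p permutes UNIV" by simp
      then obtain j where j: "j \<notin> I" "p j \<noteq> j" using p unfolding permutes_def by auto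
      obtain r where r: "p r = j" using permutes_surj[OF pU] by (metis surjD)
      then have "r \<noteq> j" using j by auto
      then have "M $ r $ p r = 0" using M[OF j(1), of r] r by simp
      then have "(\<Prod>i\<in>UNIV. M $ i $ p i) = 0" by (intro prod_zero) auto
      then show "?f p = 0" by simp
    qed
  qed simp
  also have "\<dots> = (\<Sum>p | p permutes I. of_int (sign p) * (\<Prod>i\<in>I. M $ i $ p i))"
  proof (rule sum.cong[OF refl])
    fix p assume "p \<in> {p. p permutes I}"
    then have "p permutes I" by simp
    then have "\<And>i. i \<notin> I \<Longrightarrow> M $ i $ p i = 1" using M by (simp add: permutes_def)
    then have "(\<Prod>i\<in>UNIV. M $ i $ p i) = (\<Prod>i\<in>I. M $ i $ p i)"
      by (intro prod.mono_neutral_right) auto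
    then show "?f p = of_int (sign p) * (\<Prod>i\<in>I. M $ i $ p i)" by simp
  qed
  finally show ?thesis .
qed

text \<open>Laplace expansion of a four by four determinant along its first row, with the indices
  drawn from an arbitrary type.\<close>

lemma sum_permutes_4:
  fixes m :: "'i \<Rightarrow> 'i \<Rightarrow> real"
  assumes d: "distinct [a, b, c, d]"
  shows "(\<Sum>p | p permutes {a, b, c, d}. of_int (sign p) * (\<Prod>i\<in>{a, b, c, d}. m i (p i))) =
     m a a * (m b b * (m c c * m d d - m c d * m d c) - m b c * (m c b * m d d - m c d * m d b) + m b d * (m c b * m d c - m c c * m d b))
   - m a b * (m b a * (m c c * m d d - m c d * m d c) - m b c * (m c a * m d d - m c d * m d a) + m b d * (m c a * m d c - m c c * m d a))
   + m a c * (m b a * (m c b * m d d - m c d * m d b) - m b b * (m c a * m d d - m c d * m d a) + m b d * (m c a * m d b - m c b * m d a))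
   - m a d * (m b a * (m c b * m d c - m c c * m d b) - m b b * (m c a * m d c - m c c * m d a) + m b c * (m c a * m d b - m c b * m d a))"
proof -
  have f1: "finite {b, c, d}" "a \<notin> {b, c, d}" and f2: "finite {c, d}" "b \<notin> {c, d}" and f3: "finite {d}" "c \<notin> {d}"
    using d by auto
  have ne: "a \<noteq> b" "a \<noteq> c" "a \<noteq> d" "b \<noteq> c" "b \<noteq> d" "c \<noteq> d" using d by auto
  note ne' = ne ne[symmetric]
  show ?thesis
    unfolding sum_over_permutations_insert[OF f1] sum_over_permutations_insert[OF f2]
      sum_over_permutations_insert[OF f3] permutes_sing
    using ne'
    by (simp add: sign_swap_id permutation_swap_id permutation_compose sign_compose sign_id swap_id_eq algebra_simps)
qed

text \<open>Continuity is required of each directional derivative separately, the form in which the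
  area formula asks for it.\<close>

definition C1_fun :: "('a::real_normed_vector \<Rightarrow> real) \<Rightarrow> bool" where
  "C1_fun f \<longleftrightarrow> (\<exists>f'. (\<forall>z. (f has_derivative f' z) (at z)) \<and> (\<forall>h. continuous_on UNIV (\<lambda>z. f' z h)))"

lemma C1_funI:
  assumes "\<And>z. (f has_derivative f' z) (at z)" "\<And>h. continuous_on UNIV (\<lambda>z. f' z h)"
  shows "C1_fun f"
  using assms unfolding C1_fun_def by blast

lemma C1_fun_continuous: "C1_fun f \<Longrightarrow> continuous_on UNIV f"
  unfolding C1_fun_def
  by (auto simp: continuous_on_eq_continuous_at intro: has_derivative_continuous)

lemma C1_fun_const[intro, simp]: "C1_fun (\<lambda>z. c)"
  by (rule C1_funI[of _ "\<lambda>z h. 0"]) auto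

lemma C1_fun_bounded_linear: "bounded_linear f \<Longrightarrow> C1_fun f"
  by (rule C1_funI[of _ "\<lambda>z. f"]) (auto intro: bounded_linear_imp_has_derivative)

lemma C1_fun_nth[intro]: "C1_fun (\<lambda>z :: real^'n. z $ i)"
  by (rule C1_fun_bounded_linear) (rule bounded_linear_vec_nth)

lemma C1_fun_add[intro]: assumes "C1_fun f" "C1_fun g" shows "C1_fun (\<lambda>z. f z + g z)"
proof -
  obtain f' g' where "\<And>z. (f has_derivative f' z) (at z)" "\<And>h. continuous_on UNIV (\<lambda>z. f' z h)"
    "\<And>z. (g has_derivative g' z) (at z)" "\<And>h. continuous_on UNIV (\<lambda>z. g' z h)"
    using assms unfolding C1_fun_def by blast
  then show ?thesis by (intro C1_funI[of _ "\<lambda>z h. f' z h + g' z h"] has_derivative_add continuous_on_add)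
qed

lemma C1_fun_mult[intro]: assumes "C1_fun f" "C1_fun g" shows "C1_fun (\<lambda>z. f z * g z)"
proof -
  obtain f' g' where *: "\<And>z. (f has_derivative f' z) (at z)" "\<And>h. continuous_on UNIV (\<lambda>z. f' z h)"
    "\<And>z. (g has_derivative g' z) (at z)" "\<And>h. continuous_on UNIV (\<lambda>z. g' z h)"
    using assms unfolding C1_fun_def by blast
  show ?thesis
    by (rule C1_funI[of _ "\<lambda>z h. f z * g' z h + f' z h * g z"])
       (intro has_derivative_mult * continuous_on_add continuous_on_mult C1_fun_continuous assms)+
qed

lemma C1_fun_minus[intro]: "C1_fun f \<Longrightarrow> C1_fun (\<lambda>z. - f z)"
  using C1_fun_mult[of "\<lambda>z. -1" f] by simp

lemma C1_fun_diff[intro]: "C1_fun f \<Longrightarrow> C1_fun g \<Longrightarrow> C1_fun (\<lambda>z. f z - g z)"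
  using C1_fun_add[of f "\<lambda>z. - g z"] by auto

lemma C1_fun_power[intro]: "C1_fun f \<Longrightarrow> C1_fun (\<lambda>z. f z ^ n)"
  by (induction n) auto

lemma C1_fun_sum: "(\<And>i. i \<in> I \<Longrightarrow> C1_fun (f i)) \<Longrightarrow> C1_fun (\<lambda>z. \<Sum>i\<in>I. f i z)"
  by (induction I rule: infinite_finite_induct) auto

lemma C1_fun_compose:
  assumes f: "C1_fun f" and g: "\<And>x. (g has_real_derivative g' x) (at x)" "continuous_on UNIV g'"
  shows "C1_fun (\<lambda>z. g (f z))"
proof -
  obtain f' where *: "\<And>z. (f has_derivative f' z) (at z)" "\<And>h. continuous_on UNIV (\<lambda>z. f' z h)"
    using f unfolding C1_fun_def by blast
  show ?thesis
  proof (rule C1_funI[of _ "\<lambda>z h. g' (f z) * f' z h"])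
    fix z
    have "(g has_derivative (\<lambda>x. g' (f z) * x)) (at (f z))" using g(1) by (simp add: has_field_derivative_def)
    from has_derivative_compose[OF *(1) this]
    show "((\<lambda>z. g (f z)) has_derivative (\<lambda>h. g' (f z) * f' z h)) (at z)" .
  next
    fix h
    have "continuous_on UNIV (\<lambda>z. g' (f z))"
      using continuous_on_compose[OF C1_fun_continuous[OF f], of g'] g(2) by (simp add: o_def continuous_on_subset)
    then show "continuous_on UNIV (\<lambda>z. g' (f z) * f' z h)" by (intro continuous_on_mult *)
  qed
qed

lemma C1_fun_sin[intro]: "C1_fun f \<Longrightarrow> C1_fun (\<lambda>z. sin (f z))"
  by (rule C1_fun_compose[where g=sin and g'=cos]) (auto intro: DERIV_sin continuous_intros)

lemma C1_fun_cos[intro]: "C1_fun f \<Longrightarrow> C1_fun (\<lambda>z. cos (f z))"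
  by (rule C1_fun_compose[where g=cos and g'="\<lambda>x. - sin x"]) (auto intro!: DERIV_cos continuous_on_minus continuous_on_sin continuous_on_id)

lemma C1_vec:
  fixes F :: "'a::real_normed_vector \<Rightarrow> real^'n"
  assumes "\<And>i. C1_fun (\<lambda>z. F z $ i)"
  obtains F' where "\<And>z. (F has_derivative F' z) (at z)" "\<And>h. continuous_on UNIV (\<lambda>z. F' z h)"
proof -
  have "\<forall>i. \<exists>f'. (\<forall>z. ((\<lambda>z. F z $ i) has_derivative f' z) (at z)) \<and> (\<forall>h. continuous_on UNIV (\<lambda>z. f' z h))"
    using assms unfolding C1_fun_def by blast
  from choice[OF this] obtain f' where f': "\<And>i z. ((\<lambda>z. F z $ i) has_derivative f' i z) (at z)"
    "\<And>i h. continuous_on UNIV (\<lambda>z. f' i z h)" by auto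
  show thesis
  proof (rule that[of "\<lambda>z h. \<chi> i. f' i z h"])
    fix z
    show "(F has_derivative (\<lambda>h. \<chi> i. f' i z h)) (at z)"
      using f'(1) by (subst has_derivative_componentwise_within) (auto simp: Basis_vec_def inner_axis)
  next
    fix h show "continuous_on UNIV (\<lambda>z. \<chi> i. f' i z h)"
      by (intro continuous_on_vec_lambda f'(2))
  qed
qed

section \<open>A basis of cubics adapted to a plane\<close>

text \<open>Once the terms of angular order 3 and 2 in the base plane are split off,
  \<open>kern\<close> retains \<open>wgt l m\<close> as the coefficient for \<open>x_1 Z\<close> and
  \<open>x_2 Z\<close>, and \<open>wgt' l m\<close> for \<open>x_3 Z\<close> and
  \<open>x_4 Z\<close>, where \<open>Z\<close> is the squared norm in that plane.\<close>

definition wgt :: "real \<Rightarrow> real \<Rightarrow> real" where "wgt l m = 2 * l\<^sup>2 + m\<^sup>2"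
definition wgt' :: "real \<Rightarrow> real \<Rightarrow> real" where "wgt' l m = 8 * l\<^sup>2 + m\<^sup>2"

text \<open>An orthonormal basis of cubics for \<open>m \<noteq> 0\<close> (up to scale); the first sixteen members suffice for
  \<open>m = 0\<close>. With \<open>z = x\<^sub>1 + i x\<^sub>2\<close> and \<open>w = x\<^sub>3 + i x\<^sub>4\<close>, the members 0 to 3 are those not vanishing
  on the plane \<open>w = 0\<close>, and 4 to 9 those vanishing there to first order.\<close>

definition cubics :: "real \<Rightarrow> real \<Rightarrow> (real^4 \<Rightarrow> real) list" where
  "cubics l m = (let Z = \<lambda>x. (x $ 1)\<^sup>2 + (x $ 2)\<^sup>2; W = \<lambda>x. (x $ 3)\<^sup>2 + (x $ 4)\<^sup>2; e = m\<^sup>2 - 4 * l\<^sup>2;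
       a = 1 / sqrt (wgt l m); b = 1 / sqrt (wgt' l m) in
    [\<lambda>x. sqrt 2 * l * ((x $ 1) ^ 3 - 3 * x $ 1 * (x $ 2)\<^sup>2),
     \<lambda>x. sqrt 2 * l * (3 * (x $ 1)\<^sup>2 * x $ 2 - (x $ 2) ^ 3),
     \<lambda>x. a * (x $ 1 * (wgt l m * Z x + e * W x)),
     \<lambda>x. a * (x $ 2 * (wgt l m * Z x + e * W x)),
     \<lambda>x. sqrt 12 * l * (((x $ 1)\<^sup>2 - (x $ 2)\<^sup>2) * x $ 3),
     \<lambda>x. sqrt 12 * l * (2 * x $ 1 * x $ 2 * x $ 3),
     \<lambda>x. sqrt 12 * l * (((x $ 1)\<^sup>2 - (x $ 2)\<^sup>2) * x $ 4),
     \<lambda>x. sqrt 12 * l * (2 * x $ 1 * x $ 2 * x $ 4),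
     \<lambda>x. b * (x $ 3 * (wgt' l m * Z x + e * W x)),
     \<lambda>x. b * (x $ 4 * (wgt' l m * Z x + e * W x)),
     \<lambda>x. sqrt 2 * l * ((x $ 3) ^ 3 - 3 * x $ 3 * (x $ 4)\<^sup>2),
     \<lambda>x. sqrt 2 * l * (3 * (x $ 3)\<^sup>2 * x $ 4 - (x $ 4) ^ 3),
     \<lambda>x. sqrt 12 * l * (((x $ 3)\<^sup>2 - (x $ 4)\<^sup>2) * x $ 1),
     \<lambda>x. sqrt 12 * l * (2 * x $ 3 * x $ 4 * x $ 1),
     \<lambda>x. sqrt 12 * l * (((x $ 3)\<^sup>2 - (x $ 4)\<^sup>2) * x $ 2),
     \<lambda>x. sqrt 12 * l * (2 * x $ 3 * x $ 4 * x $ 2),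
     \<lambda>x. a * (sqrt 18 * l * m * (x $ 1 * W x)),
     \<lambda>x. a * (sqrt 18 * l * m * (x $ 2 * W x)),
     \<lambda>x. b * (sqrt 18 * l * m * (x $ 3 * W x)),
     \<lambda>x. b * (sqrt 18 * l * m * (x $ 4 * W x))])"

definition cubic :: "real \<Rightarrow> real \<Rightarrow> nat \<Rightarrow> real^4 \<Rightarrow> real" where
  "cubic l m j = cubics l m ! j"

text \<open>With \<open>m = 1 - l\<close> this is 96 times the covariance of the random cubic. For
  \<open>m = 2 * l\<close> the second term vanishes and the rotation invariant Kostlan kernel, a
  multiple of the cube of \<open>x \<bullet> y\<close>, remains.\<close>

definition kern :: "real \<Rightarrow> real \<Rightarrow> real^4 \<Rightarrow> real^4 \<Rightarrow> real" where
  "kern l m x y = 8 * l\<^sup>2 * (x \<bullet> y) ^ 3 + (m\<^sup>2 - 4 * l\<^sup>2) * ((x \<bullet> y) * (x \<bullet> x) * (y \<bullet> y))"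

lemma nth_20:
  "[a0, a1, a2, a3, a4, a5, a6, a7, a8, a9, a10, a11, a12, a13, a14, a15, a16, a17, a18, a19] ! 0 = a0"
  "[a0, a1, a2, a3, a4, a5, a6, a7, a8, a9, a10, a11, a12, a13, a14, a15, a16, a17, a18, a19] ! 1 = a1"
  "[a0, a1, a2, a3, a4, a5, a6, a7, a8, a9, a10, a11, a12, a13, a14, a15, a16, a17, a18, a19] ! 2 = a2"
  "[a0, a1, a2, a3, a4, a5, a6, a7, a8, a9, a10, a11, a12, a13, a14, a15, a16, a17, a18, a19] ! 3 = a3"
  "[a0, a1, a2, a3, a4, a5, a6, a7, a8, a9, a10, a11, a12, a13, a14, a15, a16, a17, a18, a19] ! 4 = a4"
  "[a0, a1, a2, a3, a4, a5, a6, a7, a8, a9, a10, a11, a12, a13, a14, a15, a16, a17, a18, a19] ! 5 = a5"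
  "[a0, a1, a2, a3, a4, a5, a6, a7, a8, a9, a10, a11, a12, a13, a14, a15, a16, a17, a18, a19] ! 6 = a6"
  "[a0, a1, a2, a3, a4, a5, a6, a7, a8, a9, a10, a11, a12, a13, a14, a15, a16, a17, a18, a19] ! 7 = a7"
  "[a0, a1, a2, a3, a4, a5, a6, a7, a8, a9, a10, a11, a12, a13, a14, a15, a16, a17, a18, a19] ! 8 = a8"
  "[a0, a1, a2, a3, a4, a5, a6, a7, a8, a9, a10, a11, a12, a13, a14, a15, a16, a17, a18, a19] ! 9 = a9"
  "[a0, a1, a2, a3, a4, a5, a6, a7, a8, a9, a10, a11, a12, a13, a14, a15, a16, a17, a18, a19] ! 10 = a10"
  "[a0, a1, a2, a3, a4, a5, a6, a7, a8, a9, a10, a11, a12, a13, a14, a15, a16, a17, a18, a19] ! 11 = a11"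
  "[a0, a1, a2, a3, a4, a5, a6, a7, a8, a9, a10, a11, a12, a13, a14, a15, a16, a17, a18, a19] ! 12 = a12"
  "[a0, a1, a2, a3, a4, a5, a6, a7, a8, a9, a10, a11, a12, a13, a14, a15, a16, a17, a18, a19] ! 13 = a13"
  "[a0, a1, a2, a3, a4, a5, a6, a7, a8, a9, a10, a11, a12, a13, a14, a15, a16, a17, a18, a19] ! 14 = a14"
  "[a0, a1, a2, a3, a4, a5, a6, a7, a8, a9, a10, a11, a12, a13, a14, a15, a16, a17, a18, a19] ! 15 = a15"
  "[a0, a1, a2, a3, a4, a5, a6, a7, a8, a9, a10, a11, a12, a13, a14, a15, a16, a17, a18, a19] ! 16 = a16"
  "[a0, a1, a2, a3, a4, a5, a6, a7, a8, a9, a10, a11, a12, a13, a14, a15, a16, a17, a18, a19] ! 17 = a17"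
  "[a0, a1, a2, a3, a4, a5, a6, a7, a8, a9, a10, a11, a12, a13, a14, a15, a16, a17, a18, a19] ! 18 = a18"
  "[a0, a1, a2, a3, a4, a5, a6, a7, a8, a9, a10, a11, a12, a13, a14, a15, a16, a17, a18, a19] ! 19 = a19"
  by simp_all

text \<open>The members 2, 3, 8, 9 are grouped with 16 to 19, since only the pairs have a simple
  kernel.\<close>

lemma sum_20: "(\<Sum>j<20. f (j::nat)) = f 0 + f 1 + f 4 + f 5 + f 6 + f 7 + f 10 + f 11 + f 12 + f 13 + f 14 + f 15
   + ((f 2 + f 16) + (f 3 + f 17) + (f 8 + f 18) + (f 9 + f 19 :: real))"
  by (simp add: lessThan_nat_numeral lessThan_Suc)

text \<open>A Cholesky factorisation of the quadratic form with matrix entries \<open>w\<close>,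
  \<open>e\<close>, \<open>e\<close>, \<open>w'\<close> in the variables \<open>Z\<close>,
  \<open>W\<close>; its determinant is \<open>18 * l^2 * m^2\<close>. At \<open>m = 0\<close> the
  form has rank one, which is why four members disappear.\<close>

lemma cubic_radial_part:
  fixes w w' :: real
  assumes "w > 0" "w * w' = e\<^sup>2 + 18 * l\<^sup>2 * m\<^sup>2"
  shows "(1 / sqrt w * (s * (w * Z + e * W))) * (1 / sqrt w * (s' * (w * Z' + e * W')))
     + (1 / sqrt w * (sqrt 18 * l * m * (s * W))) * (1 / sqrt w * (sqrt 18 * l * m * (s' * W')))
     = s * s' * (w * Z * Z' + e * (Z * W' + W * Z') + w' * W * W')"
proof -
  have 1: "1 / sqrt w * (1 / sqrt w) = 1 / w" using assms(1) by simp
  have "(1 / sqrt w * (s * (w * Z + e * W))) * (1 / sqrt w * (s' * (w * Z' + e * W')))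
     + (1 / sqrt w * (sqrt 18 * l * m * (s * W))) * (1 / sqrt w * (sqrt 18 * l * m * (s' * W')))
    = (1 / sqrt w * (1 / sqrt w)) * (s * s') * ((w * Z + e * W) * (w * Z' + e * W') + (sqrt 18 * sqrt 18) * l\<^sup>2 * m\<^sup>2 * W * W')"
    by (simp only: power2_eq_square) (simp only: algebra_simps)
  also have "\<dots> = (1 / w) * (s * s') * ((w * Z + e * W) * (w * Z' + e * W') + 18 * l\<^sup>2 * m\<^sup>2 * W * W')"
    unfolding 1 by simp
  also have "(w * Z + e * W) * (w * Z' + e * W') + 18 * l\<^sup>2 * m\<^sup>2 * W * W' = w * (w * Z * Z' + e * (Z * W' + W * Z') + w' * W * W')"
    using assms(2) by algebra
  finally show ?thesis using assms(1) by simp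
qed

lemma sum_cubic_kern:
  assumes l: "l > 0"
  shows "(\<Sum>j<20. cubic l m j x * cubic l m j y) = kern l m x y"
proof -
  obtain s t p q where x: "s = x $ 1" "t = x $ 2" "p = x $ 3" "q = x $ 4" by blast
  obtain s' t' p' q' where y: "s' = y $ 1" "t' = y $ 2" "p' = y $ 3" "q' = y $ 4" by blast
  define e where "e = m\<^sup>2 - 4 * l\<^sup>2"
  define w where "w = wgt l m"
  define w' where "w' = wgt' l m"
  have w: "w > 0" "w' > 0" "w * w' = e\<^sup>2 + 18 * l\<^sup>2 * m\<^sup>2"
    using l by (auto simp: w_def w'_def wgt_def wgt'_def intro!: add_pos_nonneg)
      (simp add: e_def power2_eq_square algebra_simps)
  note R1 = cubic_radial_part[OF w(1,3)]
  note R2 = cubic_radial_part[OF w(2) w(3)[unfolded mult.commute[of w]]]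
  define Z W Z' W' where "Z = s\<^sup>2 + t\<^sup>2" and "W = p\<^sup>2 + q\<^sup>2" and "Z' = s'\<^sup>2 + t'\<^sup>2" and "W' = p'\<^sup>2 + q'\<^sup>2"
  have s2: "(sqrt 2 * l * c) * (sqrt 2 * l * d) = 2 * l\<^sup>2 * (c * d)" for c d
  proof -
    have "(sqrt 2 * l * c) * (sqrt 2 * l * d) = (sqrt 2 * sqrt 2) * l\<^sup>2 * (c * d)" by (simp only: power2_eq_square ac_simps)
    then show ?thesis by simp
  qed
  have s12: "(sqrt 12 * l * c) * (sqrt 12 * l * d) = 12 * l\<^sup>2 * (c * d)" for c d
  proof -
    have "(sqrt 12 * l * c) * (sqrt 12 * l * d) = (sqrt 12 * sqrt 12) * l\<^sup>2 * (c * d)" by (simp only: power2_eq_square ac_simps)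
    then show ?thesis by simp
  qed
  define a where "a = s * s' + t * t'"
  define c where "c = p * p' + q * q'"
  have "(\<Sum>j<20. cubic l m j x * cubic l m j y) =
     2 * l\<^sup>2 * ((s ^ 3 - 3 * s * t\<^sup>2) * (s' ^ 3 - 3 * s' * t'\<^sup>2)) + 2 * l\<^sup>2 * ((3 * s\<^sup>2 * t - t ^ 3) * (3 * s'\<^sup>2 * t' - t' ^ 3))
   + 12 * l\<^sup>2 * (((s\<^sup>2 - t\<^sup>2) * p) * ((s'\<^sup>2 - t'\<^sup>2) * p')) + 12 * l\<^sup>2 * ((2 * s * t * p) * (2 * s' * t' * p'))
   + 12 * l\<^sup>2 * (((s\<^sup>2 - t\<^sup>2) * q) * ((s'\<^sup>2 - t'\<^sup>2) * q')) + 12 * l\<^sup>2 * ((2 * s * t * q) * (2 * s' * t' * q'))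
   + 2 * l\<^sup>2 * ((p ^ 3 - 3 * p * q\<^sup>2) * (p' ^ 3 - 3 * p' * q'\<^sup>2)) + 2 * l\<^sup>2 * ((3 * p\<^sup>2 * q - q ^ 3) * (3 * p'\<^sup>2 * q' - q' ^ 3))
   + 12 * l\<^sup>2 * (((p\<^sup>2 - q\<^sup>2) * s) * ((p'\<^sup>2 - q'\<^sup>2) * s')) + 12 * l\<^sup>2 * ((2 * p * q * s) * (2 * p' * q' * s'))
   + 12 * l\<^sup>2 * (((p\<^sup>2 - q\<^sup>2) * t) * ((p'\<^sup>2 - q'\<^sup>2) * t')) + 12 * l\<^sup>2 * ((2 * p * q * t) * (2 * p' * q' * t'))
   + (s * s' * (w * Z * Z' + e * (Z * W' + W * Z') + w' * W * W') + t * t' * (w * Z * Z' + e * (Z * W' + W * Z') + w' * W * W')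
   + p * p' * (w' * Z * Z' + e * (Z * W' + W * Z') + w * W * W') + q * q' * (w' * Z * Z' + e * (Z * W' + W * Z') + w * W * W'))"
    unfolding sum_20 cubic_def cubics_def Let_def nth_20 x[symmetric] y[symmetric] w_def[symmetric] w'_def[symmetric] e_def[symmetric]
      Z_def W_def Z'_def W'_def s2 s12 R1 R2 ..
  \<comment> \<open>With \<open>a\<close> the inner product in the base plane, the real and
    imaginary parts of cubes and squares combine by the triple and double angle formulas into
    \<open>4 a^3 - 3 Z Z' a\<close> and \<open>2 a^2 - Z Z'\<close>, and likewise with
    \<open>c\<close> in the orthogonal plane.\<close>
  also have "\<dots> = 2 * l\<^sup>2 * (4 * a ^ 3 - 3 * Z * Z' * a) + 12 * l\<^sup>2 * (2 * a\<^sup>2 - Z * Z') * c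
     + 2 * l\<^sup>2 * (4 * c ^ 3 - 3 * W * W' * c) + 12 * l\<^sup>2 * (2 * c\<^sup>2 - W * W') * a
     + a * (w * Z * Z' + e * (Z * W' + W * Z') + w' * W * W') + c * (w' * Z * Z' + e * (Z * W' + W * Z') + w * W * W')"
    unfolding a_def c_def Z_def W_def Z'_def W'_def by algebra
  also have "\<dots> = 8 * l\<^sup>2 * (a + c) ^ 3 + e * ((a + c) * (Z + W) * (Z' + W'))"
    unfolding e_def w_def w'_def wgt_def wgt'_def by algebra
  also have "\<dots> = kern l m x y"
    unfolding kern_def inner4 x[symmetric] y[symmetric] e_def a_def c_def Z_def W_def Z'_def W'_def
    by (simp only: power2_eq_square add.assoc)
  finally show ?thesis .
qed

lemma cubic_on_base:
  assumes "x $ 3 = 0" "x $ 4 = 0"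
  shows "cubic l m 0 x = sqrt 2 * l * ((x $ 1) ^ 3 - 3 * x $ 1 * (x $ 2)\<^sup>2)"
    "cubic l m 1 x = sqrt 2 * l * (3 * (x $ 1)\<^sup>2 * x $ 2 - (x $ 2) ^ 3)"
    "cubic l m 2 x = sqrt (wgt l m) * (((x $ 1)\<^sup>2 + (x $ 2)\<^sup>2) * x $ 1)"
    "cubic l m 3 x = sqrt (wgt l m) * (((x $ 1)\<^sup>2 + (x $ 2)\<^sup>2) * x $ 2)"
    "4 \<le> j \<Longrightarrow> j < 20 \<Longrightarrow> cubic l m j x = 0"
proof -
  have w: "1 / sqrt (wgt l m) * (a * (wgt l m * b)) = sqrt (wgt l m) * (b * a)" for a b
    using real_div_sqrt[of "wgt l m"] by (simp add: wgt_def) (metis mult.commute mult.left_commute times_divide_eq_left)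
  show "cubic l m 0 x = sqrt 2 * l * ((x $ 1) ^ 3 - 3 * x $ 1 * (x $ 2)\<^sup>2)"
    "cubic l m 1 x = sqrt 2 * l * (3 * (x $ 1)\<^sup>2 * x $ 2 - (x $ 2) ^ 3)"
    by (simp_all add: cubic_def cubics_def Let_def)
  show "cubic l m 2 x = sqrt (wgt l m) * (((x $ 1)\<^sup>2 + (x $ 2)\<^sup>2) * x $ 1)"
    "cubic l m 3 x = sqrt (wgt l m) * (((x $ 1)\<^sup>2 + (x $ 2)\<^sup>2) * x $ 2)"
    unfolding w[symmetric] using assms by (simp_all add: cubic_def cubics_def Let_def)
  assume "4 \<le> j" "j < 20"
  then have "j = 4 \<or> j = 5 \<or> j = 6 \<or> j = 7 \<or> j = 8 \<or> j = 9 \<or> j = 10 \<or> j = 11 \<or> j = 12 \<or> j = 13 \<or> j = 14 \<or> j = 15 \<or> j = 16 \<or> j = 17 \<or> j = 18 \<or> j = 19" by arith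
  then show "cubic l m j x = 0"
    using assms by (auto simp: cubic_def cubics_def Let_def)
qed

text \<open>Members from 10 on vanish to second order along the base plane, so only six coefficients
  reach the Jacobian.\<close>

lemma cubic_deriv_on_base:
  assumes d: "\<And>i. ((\<lambda>\<tau>. c \<tau> $ i) has_real_derivative v $ i) (at 0)"
    and 0: "c 0 $ 3 = 0" "c 0 $ 4 = 0" and s: "s = c 0 $ 1" and t: "t = c 0 $ 2"
  shows "((\<lambda>\<tau>. cubic l m 4 (c \<tau>)) has_real_derivative sqrt 12 * l * ((s\<^sup>2 - t\<^sup>2) * v $ 3)) (at 0)"
    "((\<lambda>\<tau>. cubic l m 5 (c \<tau>)) has_real_derivative sqrt 12 * l * (2 * s * t * v $ 3)) (at 0)"
    "((\<lambda>\<tau>. cubic l m 6 (c \<tau>)) has_real_derivative sqrt 12 * l * ((s\<^sup>2 - t\<^sup>2) * v $ 4)) (at 0)"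
    "((\<lambda>\<tau>. cubic l m 7 (c \<tau>)) has_real_derivative sqrt 12 * l * (2 * s * t * v $ 4)) (at 0)"
    "((\<lambda>\<tau>. cubic l m 8 (c \<tau>)) has_real_derivative sqrt (wgt' l m) * ((s\<^sup>2 + t\<^sup>2) * v $ 3)) (at 0)"
    "((\<lambda>\<tau>. cubic l m 9 (c \<tau>)) has_real_derivative sqrt (wgt' l m) * ((s\<^sup>2 + t\<^sup>2) * v $ 4)) (at 0)"
    "10 \<le> j \<Longrightarrow> j < 20 \<Longrightarrow> ((\<lambda>\<tau>. cubic l m j (c \<tau>)) has_real_derivative 0) (at 0)"
proof -
  have w: "1 / sqrt (wgt' l m) * (a * (wgt' l m * b)) = sqrt (wgt' l m) * (b * a)" for a b
    using real_div_sqrt[of "wgt' l m"] by (simp add: wgt'_def) (metis mult.commute mult.left_commute times_divide_eq_left)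
  note dd = d[of 1] d[of 2] d[of 3] d[of 4]
  show "((\<lambda>\<tau>. cubic l m 4 (c \<tau>)) has_real_derivative sqrt 12 * l * ((s\<^sup>2 - t\<^sup>2) * v $ 3)) (at 0)"
    "((\<lambda>\<tau>. cubic l m 5 (c \<tau>)) has_real_derivative sqrt 12 * l * (2 * s * t * v $ 3)) (at 0)"
    "((\<lambda>\<tau>. cubic l m 6 (c \<tau>)) has_real_derivative sqrt 12 * l * ((s\<^sup>2 - t\<^sup>2) * v $ 4)) (at 0)"
    "((\<lambda>\<tau>. cubic l m 7 (c \<tau>)) has_real_derivative sqrt 12 * l * (2 * s * t * v $ 4)) (at 0)"
    "((\<lambda>\<tau>. cubic l m 8 (c \<tau>)) has_real_derivative sqrt (wgt' l m) * ((s\<^sup>2 + t\<^sup>2) * v $ 3)) (at 0)"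
    "((\<lambda>\<tau>. cubic l m 9 (c \<tau>)) has_real_derivative sqrt (wgt' l m) * ((s\<^sup>2 + t\<^sup>2) * v $ 4)) (at 0)"
    unfolding w[symmetric] cubic_def cubics_def Let_def nth_20 s t
    by (rule DERIV_cmult, rule DERIV_cong, (rule DERIV_add DERIV_diff DERIV_mult DERIV_power DERIV_const dd)+, simp add: 0)+
  have z: "((\<lambda>\<tau>. K * f \<tau>) has_real_derivative 0) (at 0)" if "(f has_real_derivative 0) (at 0)" for f and K :: real
    using DERIV_cmult[OF that, of K] by simp
  assume "10 \<le> j" "j < 20"
  then have "j = 10 \<or> j = 11 \<or> j = 12 \<or> j = 13 \<or> j = 14 \<or> j = 15 \<or> j = 16 \<or> j = 17 \<or> j = 18 \<or> j = 19" by arith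
  then show "((\<lambda>\<tau>. cubic l m j (c \<tau>)) has_real_derivative 0) (at 0)"
    unfolding cubic_def cubics_def Let_def
    by (elim disjE; simp only: nth_20) (rule z, rule DERIV_cong, (rule DERIV_add DERIV_diff DERIV_mult DERIV_power DERIV_const dd)+, simp add: 0)+
qed

lemma C1_fun_cubic:
  assumes c: "\<And>i. C1_fun (\<lambda>z. c z $ i)" and j: "j < 20"
  shows "C1_fun (\<lambda>z. cubic l m j (c z))"
proof -
  have "j = 0 \<or> j = 1 \<or> j = 2 \<or> j = 3 \<or> j = 4 \<or> j = 5 \<or> j = 6 \<or> j = 7 \<or> j = 8 \<or> j = 9 \<or> j = 10 \<or> j = 11 \<or> j = 12 \<or> j = 13 \<or> j = 14 \<or> j = 15 \<or> j = 16 \<or> j = 17 \<or> j = 18 \<or> j = 19" using j by arith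
  then show ?thesis
    unfolding cubic_def cubics_def Let_def
    by (elim disjE; simp only: nth_20) (rule C1_fun_const c C1_fun_add C1_fun_diff C1_fun_mult C1_fun_power)+
qed

lemma C1_fun_coframe:
  assumes "C1_fun f" "C1_fun t" "C1_fun f'" "C1_fun t'"
  shows "C1_fun (\<lambda>z. coframe (f z) (t z) (f' z) (t' z) x $ i)"
proof -
  have "\<forall>i. C1_fun (\<lambda>z. coframe (f z) (t z) (f' z) (t' z) x $ i)"
    unfolding forall_4 coframe_def qm_def qcnj_def spin_def mk4_nth
    by (intro conjI C1_fun_add C1_fun_mult C1_fun_diff C1_fun_minus C1_fun_sin C1_fun_cos C1_fun_const assms)
  then show ?thesis ..
qed

section \<open>The incidence map and its Jacobian\<close>

definition lines_count :: "(real^4 \<Rightarrow> real) \<Rightarrow> ennreal" where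
  "lines_count P = emeasure (count_space UNIV) {V. subspace V \<and> dim V = 2 \<and> (\<forall>x\<in>V. P x = 0)}"

lemma binary_cubic_coeffs:
  fixes A B C D :: real
  assumes "\<And>s t. A * (s ^ 3 - 3 * s * t\<^sup>2) + B * (3 * s\<^sup>2 * t - t ^ 3) + C * ((s\<^sup>2 + t\<^sup>2) * s) + D * ((s\<^sup>2 + t\<^sup>2) * t) = 0"
  shows "A = 0 \<and> B = 0 \<and> C = 0 \<and> D = 0"
  using assms[of 1 0] assms[of 0 1] assms[of 1 1] assms[of 1 "-1"] by (simp add: power2_eq_square)

text \<open>A vector \<open>v\<close> stands for the cubic \<open>\<lambda>x. v \<bullet> b x\<close>; the enumeration \<open>e\<close> is needed because the
  dimension is a type. In the source of the incidence map \<open>Phi\<close> below, coordinates 0 to 3 of \<open>z\<close> are the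
  parameters of a plane \<open>pl z\<close>, and the others, collected in \<open>kap z\<close>, are the coefficients of a cubic
  vanishing on the base plane, in the basis \<open>cubic l m\<close>. \<open>Phi z\<close> is that cubic moved to \<open>pl z\<close>.\<close>

locale incidence =
  fixes l m :: real and N :: nat and e :: "'n::{finite,wellorder} \<Rightarrow> nat" and b :: "real^4 \<Rightarrow> real^'n::_"
  assumes l: "l > 0" and N: "10 \<le> N" "N \<le> 20" and e: "bij_betw e UNIV {..<N}"
    and vanish: "\<And>j x. N \<le> j \<Longrightarrow> j < 20 \<Longrightarrow> cubic l m j x = 0"
    and gram: "\<And>x y. b x \<bullet> b y = kern l m x y" and sp: "span (range b) = UNIV"
begin

definition idx :: "nat \<Rightarrow> 'n" where "idx = inv_into UNIV e"

lemma e_idx: "j < N \<Longrightarrow> e (idx j) = j"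
  using e by (auto simp: idx_def bij_betw_def intro!: f_inv_into_f)

lemma idx_e: "idx (e i) = i"
  using e by (auto simp: idx_def bij_betw_def)

lemma e_less: "e i < N"
  using e by (auto simp: bij_betw_def)

lemma sum_idx: "(\<Sum>i\<in>UNIV. f (e i)) = (\<Sum>j<N. f j)"
  by (rule sum.reindex_bij_betw[OF e])

lemma idx_eq_iff: "i < N \<Longrightarrow> j < N \<Longrightarrow> idx i = idx j \<longleftrightarrow> i = j"
  by (metis e_idx)

text \<open>The counterpart of \<open>b\<close> for the adapted basis:
  \<open>v \<bullet> b' x\<close> is the value at \<open>x\<close> of the cubic with coefficients
  \<open>v\<close>.\<close>

definition b' :: "real^4 \<Rightarrow> real^'n::_" where
  "b' x = (\<chi> i. cubic l m (e i) x)"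

lemma b'_gram: "b' x \<bullet> b' y = kern l m x y"
proof -
  have "b' x \<bullet> b' y = (\<Sum>j<N. cubic l m j x * cubic l m j y)"
    by (simp add: b'_def inner_vec_def sum_idx[of "\<lambda>j. cubic l m j x * cubic l m j y"])
  also have "\<dots> = (\<Sum>j<20. cubic l m j x * cubic l m j y)"
    using N vanish by (intro sum.mono_neutral_left) auto
  finally show ?thesis using sum_cubic_kern[OF l] by simp
qed

lemma inner_b': "v \<bullet> b' x = (\<Sum>j<N. v $ idx j * cubic l m j x)"
  using sum_idx[of "\<lambda>j. v $ idx j * cubic l m j x"] by (simp add: b'_def inner_vec_def idx_e)

definition G :: "real^'n::_ \<Rightarrow> real^4 \<Rightarrow> real^4" where
  "G z = coframe (z $ idx 0) (z $ idx 1) (z $ idx 2) (z $ idx 3)"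

definition H :: "real^'n::_ \<Rightarrow> real^4 \<Rightarrow> real^4" where
  "H z = frame (z $ idx 0) (z $ idx 1) (z $ idx 2) (z $ idx 3)"

definition pl :: "real^'n::_ \<Rightarrow> (real^4) set" where
  "pl z = plane (z $ idx 0) (z $ idx 1) (z $ idx 2) (z $ idx 3)"

definition kap :: "real^'n::_ \<Rightarrow> real^'n::_" where
  "kap z = (\<chi> i. if e i < 4 then 0 else z $ i)"

lemma GH[simp]: "G z (H z x) = x" "H z (G z x) = x"
  by (simp_all add: G_def H_def)

text \<open>\<open>T z\<close> exists because both \<open>b\<close> and \<open>b' \<circ> G z\<close> have the rotation invariant Gram kernel \<open>kern l m\<close>.\<close>

definition T :: "real^'n::_ \<Rightarrow> real^'n::_ \<Rightarrow> real^'n::_" where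
  "T z = (SOME T. orthogonal_transformation T \<and> (\<forall>x. T (b x) = b' (G z x)))"

lemma T: "orthogonal_transformation (T z)" "T z (b x) = b' (G z x)"
proof -
  have "\<exists>T. orthogonal_transformation T \<and> (\<forall>x. T (b x) = b' (G z x))"
    by (rule gram_isometry[OF _ sp]) (simp add: gram b'_gram kern_def G_def coframe_inner)
  from someI_ex[OF this] show "orthogonal_transformation (T z)" "T z (b x) = b' (G z x)"
    unfolding T_def by auto
qed

lemma linear_T: "linear (T z)"
  using T(1) by (simp add: orthogonal_transformation_def)

lemma T_inner: "T z v \<bullet> T z w = v \<bullet> w"
  using T(1) by (simp add: orthogonal_transformation_def)

lemma span_b': "span (range b') = UNIV"
proof -
  have "UNIV = T 0 ` UNIV" using orthogonal_transformation_surj[OF T(1)] by simp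
  also have "\<dots> = span (T 0 ` range b)" unfolding sp[symmetric] by (rule linear_span_image[OF linear_T, symmetric])
  also have "\<dots> \<subseteq> span (range b')" by (intro span_mono) (auto simp: T(2))
  finally show ?thesis by auto
qed

text \<open>Coefficient vectors may be compared through the values of their cubics, because the
  evaluation vectors span.\<close>

lemma eq_if_inner_b':
  assumes "\<And>x. v \<bullet> b' x = w \<bullet> b' x" shows "v = w"
proof -
  have "subspace {u. v \<bullet> u = w \<bullet> u}" by (simp add: subspace_def inner_add_right)
  then have "span (range b') \<subseteq> {u. v \<bullet> u = w \<bullet> u}" using assms by (intro span_minimal) auto
  then have "v \<bullet> u = w \<bullet> u" for u using span_b' by auto
  then show ?thesis by (metis vector_eq_rdot)
qed

text \<open>The adjoint appears because \<open>T z\<close> acts on evaluation vectors: paired with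
  \<open>b x\<close>, \<open>Phi z\<close> gives the cubic \<open>kap z\<close> composed with the
  inverse rotation \<open>G z\<close>.\<close>

definition Phi :: "real^'n::_ \<Rightarrow> real^'n::_" where
  "Phi z = adjoint (T z) (kap z)"

lemma Phi_inner: "Phi z \<bullet> v = kap z \<bullet> T z v"
  unfolding Phi_def by (metis adjoint_works[OF linear_T] inner_commute)

lemma T_Phi: "T z (Phi z) = kap z"
proof -
  obtain v where v: "T z v = kap z" using orthogonal_transformation_surj[OF T(1)] by (metis surjD)
  have "Phi z \<bullet> w = v \<bullet> w" for w unfolding Phi_inner v[symmetric] T_inner ..
  then have "Phi z = v" by (metis vector_eq_rdot)
  then show ?thesis using v by simp
qed

text \<open>Moving a cubic is an isometry, so the Gaussian density at \<open>Phi z\<close> sees only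
  the coefficients and not the plane.\<close>

lemma norm_Phi: "Phi z \<bullet> Phi z = kap z \<bullet> kap z"
  by (simp add: Phi_inner T_Phi)

lemma Phi_inner_b: "Phi z \<bullet> b x = kap z \<bullet> b' (G z x)"
  by (simp add: Phi_inner T)

text \<open>\<open>T z\<close> comes from a choice, so nothing is known about its dependence on
  \<open>z\<close>. Paired with an evaluation vector, however, \<open>Phi z\<close> is explicit in
  angles and coefficients, and these vectors span.\<close>

lemma C1_Phi_inner: "C1_fun (\<lambda>z. Phi z \<bullet> v)"
proof -
  have "subspace {v. C1_fun (\<lambda>z. Phi z \<bullet> v)}"
    by (auto simp: subspace_def inner_add_right intro: C1_fun_add C1_fun_mult)
  moreover have "C1_fun (\<lambda>z. Phi z \<bullet> b x)" for x
  proof -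
    have "kap z \<bullet> b' (G z x) = (\<Sum>j<N. (if j < 4 then 0 else z $ idx j) * cubic l m j (G z x))" for z
      unfolding inner_b' by (intro sum.cong) (auto simp: kap_def e_idx)
    moreover have "C1_fun (\<lambda>z. (if j < 4 then 0 else z $ idx j) * cubic l m j (G z x))" if "j < N" for j
      unfolding G_def using that N
      by (cases "j < 4") (auto intro!: C1_fun_mult C1_fun_cubic C1_fun_coframe)
    ultimately show ?thesis unfolding Phi_inner_b by (auto intro!: C1_fun_sum)
  qed
  ultimately have "span (range b) \<subseteq> {v. C1_fun (\<lambda>z. Phi z \<bullet> v)}"
    by (intro span_minimal) auto
  then show ?thesis using sp by auto
qed

section \<open>The derivative of the incidence map\<close>

definition Phi' :: "real^'n::_ \<Rightarrow> real^'n::_ \<Rightarrow> real^'n::_" where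
  "Phi' = (SOME F'. (\<forall>z. (Phi has_derivative F' z) (at z)) \<and> (\<forall>h. continuous_on UNIV (\<lambda>z. F' z h)))"

lemma Phi': "(Phi has_derivative Phi' z) (at z)" "continuous_on UNIV (\<lambda>z. Phi' z h)"
proof -
  have "C1_fun (\<lambda>z. Phi z $ i)" for i
    using C1_Phi_inner[of "axis i 1"] by (simp add: inner_axis)
  then obtain F' where "\<And>z. (Phi has_derivative F' z) (at z)" "\<And>h. continuous_on UNIV (\<lambda>z. F' z h)"
    using C1_vec by blast
  then have "\<exists>F'. (\<forall>z. (Phi has_derivative F' z) (at z)) \<and> (\<forall>h. continuous_on UNIV (\<lambda>z. F' z h))" by blast
  from someI_ex[OF this] show "(Phi has_derivative Phi' z) (at z)" "continuous_on UNIV (\<lambda>z. Phi' z h)"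
    unfolding Phi'_def by auto
qed

lemma Phi'_inner_b:
  "((\<lambda>\<tau>. kap (z + \<tau> *\<^sub>R h) \<bullet> b' (G (z + \<tau> *\<^sub>R h) x)) has_real_derivative Phi' z h \<bullet> b x) (at 0)"
proof -
  have "((\<lambda>\<tau>::real. z + \<tau> *\<^sub>R h) has_derivative (\<lambda>\<tau>. \<tau> *\<^sub>R h)) (at 0)"
    by (auto intro!: derivative_eq_intros)
  moreover have "(Phi has_derivative Phi' z) (at (z + 0 *\<^sub>R h))" using Phi'(1) by simp
  ultimately have "((\<lambda>\<tau>. Phi (z + \<tau> *\<^sub>R h)) has_derivative (\<lambda>\<tau>. Phi' z (\<tau> *\<^sub>R h))) (at 0)"
    using has_derivative_compose[of "\<lambda>\<tau>. z + \<tau> *\<^sub>R h" "\<lambda>\<tau>. \<tau> *\<^sub>R h" 0 UNIV Phi "Phi' z"] by simp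
  then have "((\<lambda>\<tau>. Phi (z + \<tau> *\<^sub>R h) \<bullet> b x) has_derivative (\<lambda>\<tau>. Phi' z (\<tau> *\<^sub>R h) \<bullet> b x)) (at 0)"
    by (rule has_derivative_inner_left)
  moreover have "Phi' z (\<tau> *\<^sub>R h) = \<tau> *\<^sub>R Phi' z h" for \<tau>
    using linear_scale[OF has_derivative_linear[OF Phi'(1)]] by auto
  moreover have e: "(\<lambda>\<tau>. \<tau> * c) = (*) c" for c :: real by (auto simp: mult.commute)
  ultimately show ?thesis
    unfolding Phi_inner_b has_field_derivative_def
    by (simp add: e)
qed

text \<open>A column of the derivative turned back by the isometry \<open>T z\<close>, which
  preserves the absolute determinant and reduces the computation to the base plane.\<close>

definition col :: "real^'n::_ \<Rightarrow> 'n \<Rightarrow> real^'n::_" where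
  "col z i = T z (Phi' z (axis i 1))"

lemma col_inner_b':
  "((\<lambda>\<tau>. kap (z + \<tau> *\<^sub>R axis i 1) \<bullet> b' (G (z + \<tau> *\<^sub>R axis i 1) (H z y))) has_real_derivative col z i \<bullet> b' y) (at 0)"
proof -
  have "Phi' z (axis i 1) \<bullet> b (H z y) = col z i \<bullet> b' y"
    unfolding col_def using T_inner[of z _ "b (H z y)"] by (simp add: T)
  then show ?thesis using Phi'_inner_b[of z "axis i 1" "H z y"] by simp
qed

lemma axis_idx: "axis i (1::real) $ idx j = (if e i = j then 1 else 0)" if "j < N"
  using that by (auto simp: axis_def e_idx idx_e)

text \<open>A coefficient does not move the plane, so these columns are unit vectors and the
  determinant shrinks to a four by four block.\<close>

lemma col_free:
  assumes i: "e i \<ge> 4" shows "col z i = axis i 1"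
proof (rule eq_if_inner_b')
  fix y
  have G: "G (z + \<tau> *\<^sub>R axis i 1) = G z" for \<tau> :: real
    using i N by (simp add: G_def axis_idx)
  have k: "kap (z + \<tau> *\<^sub>R axis i 1) = kap z + \<tau> *\<^sub>R axis i 1" for \<tau> :: real
    using i by (auto simp: kap_def vec_eq_iff axis_def)
  have "((\<lambda>\<tau>. (kap z + \<tau> *\<^sub>R axis i 1) \<bullet> b' y) has_real_derivative axis i 1 \<bullet> b' y) (at 0)"
    by (auto simp: inner_add_left intro!: derivative_eq_intros)
  then show "col z i \<bullet> b' y = axis i 1 \<bullet> b' y"
    using DERIV_unique[OF col_inner_b'[of z i y]] by (simp add: G k)
qed

lemma det_Phi': "\<bar>det (matrix (Phi' z))\<bar> = \<bar>det (\<chi> r i. col z i $ r)\<bar>"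
proof -
  have lin: "linear (Phi' z)" by (rule has_derivative_linear[OF Phi'(1)])
  have "(\<chi> r i. col z i $ r) = matrix (T z) ** matrix (Phi' z)"
    unfolding matrix_compose[OF lin linear_T, symmetric] by (simp add: matrix_def col_def)
  moreover have "\<bar>det (matrix (T z))\<bar> = 1"
    using det_orthogonal_matrix[of "matrix (T z)"] T(1)[of z] by (auto simp: orthogonal_transformation_matrix)
  ultimately show ?thesis by (simp add: det_mul abs_mult)
qed

abbreviation "p1 \<equiv> sqrt 2 * l"
abbreviation "p2 \<equiv> sqrt (wgt l m)"

lemma p12: "p1 > 0" "p2 > 0"
  using l by (auto simp: wgt_def intro!: add_pos_nonneg)

lemma sum_split4: "(\<Sum>j<N. f j) = f 0 + f 1 + f 2 + f 3 + (\<Sum>j\<in>{4..<N}. f j)" for f :: "nat \<Rightarrow> real"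
proof -
  have "(\<Sum>j<N. f j) = (\<Sum>j\<in>{0,1,2,3} \<union> {4..<N}. f j)"
    using N by (intro sum.cong) auto
  also have "\<dots> = (\<Sum>j\<in>{0,1,2,3}. f j) + (\<Sum>j\<in>{4..<N}. f j)"
    by (intro sum.union_disjoint) auto
  finally show ?thesis by (simp add: add_ac)
qed

lemma inner_b'_base:
  "v \<bullet> b' (mk4 s t 0 0) = p1 * v $ idx 0 * (s ^ 3 - 3 * s * t\<^sup>2) + p1 * v $ idx 1 * (3 * s\<^sup>2 * t - t ^ 3)
     + p2 * v $ idx 2 * ((s\<^sup>2 + t\<^sup>2) * s) + p2 * v $ idx 3 * ((s\<^sup>2 + t\<^sup>2) * t)"
proof -
  have "(\<Sum>j\<in>{4..<N}. v $ idx j * cubic l m j (mk4 s t 0 0)) = 0"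
    using N by (intro sum.neutral) (auto simp: cubic_on_base)
  then show ?thesis unfolding inner_b' sum_split4 by (simp add: cubic_on_base del: One_nat_def)
qed

text \<open>The restriction to the base plane is a binary cubic, and the first four members restrict
  to a basis of the binary cubics.\<close>

lemma vanish_on_base: "(\<forall>x\<in>base_plane. v \<bullet> b' x = 0) \<longleftrightarrow> (\<forall>j<4. v $ idx j = 0)"
proof
  assume a: "\<forall>x\<in>base_plane. v \<bullet> b' x = 0"
  have "v \<bullet> b' (mk4 s t 0 0) = 0" for s t using a by (simp add: base_plane_def)
  from this[unfolded inner_b'_base] have "p1 * v $ idx 0 = 0 \<and> p1 * v $ idx 1 = 0 \<and> p2 * v $ idx 2 = 0 \<and> p2 * v $ idx 3 = 0"
    by (rule binary_cubic_coeffs)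
  then have z: "v $ idx 0 = 0" "v $ idx 1 = 0" "v $ idx 2 = 0" "v $ idx 3 = 0" using p12 by auto
  show "\<forall>j<4. v $ idx j = 0"
  proof safe
    fix j :: nat assume "j < 4"
    then have "j = 0 \<or> j = 1 \<or> j = 2 \<or> j = 3" by arith
    then show "v $ idx j = 0" using z by auto
  qed
next
  assume a: "\<forall>j<4. v $ idx j = 0"
  show "\<forall>x\<in>base_plane. v \<bullet> b' x = 0"
  proof
    fix x assume "x \<in> base_plane"
    then have "x = mk4 (x $ 1) (x $ 2) 0 0" by (simp add: base_plane_def vec4_eq_iff)
    then show "v \<bullet> b' x = 0" using inner_b'_base[of v "x $ 1" "x $ 2"] a by simp
  qed
qed

text \<open>To first order at the base plane, the cubic with coefficients \<open>kap z\<close> is \<open>q0 z * x\<^sub>3 + q0' z * x\<^sub>4\<close>.\<close>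

definition q0 :: "real^'n::_ \<Rightarrow> real \<Rightarrow> real \<Rightarrow> real" where
  "q0 z s t = sqrt 12 * l * z $ idx 4 * (s\<^sup>2 - t\<^sup>2) + sqrt 12 * l * z $ idx 5 * (2 * s * t) + sqrt (wgt' l m) * z $ idx 8 * (s\<^sup>2 + t\<^sup>2)"

definition q0' :: "real^'n::_ \<Rightarrow> real \<Rightarrow> real \<Rightarrow> real" where
  "q0' z s t = sqrt 12 * l * z $ idx 6 * (s\<^sup>2 - t\<^sup>2) + sqrt 12 * l * z $ idx 7 * (2 * s * t) + sqrt (wgt' l m) * z $ idx 9 * (s\<^sup>2 + t\<^sup>2)"

lemma deriv_b'_base:
  assumes d: "(c has_vector_derivative v) (at 0)" and c0: "c 0 = mk4 s t 0 0"
  shows "((\<lambda>\<tau>. kap z \<bullet> b' (c \<tau>)) has_real_derivative q0 z s t * v $ 3 + q0' z s t * v $ 4) (at 0)"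
proof -
  have d': "((\<lambda>\<tau>. c \<tau> $ i) has_real_derivative v $ i) (at 0)" for i
    using has_vector_derivative_real_field bounded_linear.has_vector_derivative[OF bounded_linear_vec_nth d]
    by (simp add: has_real_derivative_iff_has_vector_derivative)
  note D = cubic_deriv_on_base[OF d', where s=s and t=t and l=l and m=m, unfolded c0 mk4_nth, OF refl refl refl refl]
  define E where "E j = (if j = 4 then sqrt 12 * l * ((s\<^sup>2 - t\<^sup>2) * v $ 3) else if j = 5 then sqrt 12 * l * (2 * s * t * v $ 3)
     else if j = 6 then sqrt 12 * l * ((s\<^sup>2 - t\<^sup>2) * v $ 4) else if j = 7 then sqrt 12 * l * (2 * s * t * v $ 4)
     else if j = 8 then sqrt (wgt' l m) * ((s\<^sup>2 + t\<^sup>2) * v $ 3) else if j = 9 then sqrt (wgt' l m) * ((s\<^sup>2 + t\<^sup>2) * v $ 4) else 0)" for j :: nat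
  have dE: "((\<lambda>\<tau>. cubic l m j (c \<tau>)) has_real_derivative E j) (at 0)" if "4 \<le> j" "j < 20" for j
  proof (cases "10 \<le> j")
    case True then show ?thesis using D(7)[of j] that by (simp add: E_def)
  next
    case False
    then have "j = 4 \<or> j = 5 \<or> j = 6 \<or> j = 7 \<or> j = 8 \<or> j = 9" using that by arith
    then show ?thesis using D(1-6) by (auto simp: E_def)
  qed
  have k: "kap z $ idx j = (if j < 4 then 0 else z $ idx j)" if "j < N" for j
    using that by (simp add: kap_def e_idx)
  have eq: "kap z \<bullet> b' x = (\<Sum>j\<in>{4..<N}. z $ idx j * cubic l m j x)" for x
  proof -
    have "(\<Sum>j\<in>{4..<N}. kap z $ idx j * cubic l m j x) = (\<Sum>j\<in>{4..<N}. z $ idx j * cubic l m j x)"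
      by (intro sum.cong) (auto simp: k)
    then show ?thesis unfolding inner_b' sum_split4 using N by (simp add: k)
  qed
  have "((\<lambda>\<tau>. \<Sum>j\<in>{4..<N}. z $ idx j * cubic l m j (c \<tau>)) has_real_derivative (\<Sum>j\<in>{4..<N}. z $ idx j * E j)) (at 0)"
    using N by (intro DERIV_sum DERIV_cmult dE) auto
  moreover have "(\<Sum>j\<in>{4..<N}. z $ idx j * E j) = (\<Sum>j\<in>{4,5,6,7,8,9}. z $ idx j * E j)"
    using N by (intro sum.mono_neutral_right) (auto simp: E_def)
  moreover have "\<dots> = q0 z s t * v $ 3 + q0' z s t * v $ 4"
    by (simp add: E_def q0_def q0'_def algebra_simps)
  ultimately show ?thesis unfolding eq by simp
qed

lemma kap_param: "e i < 4 \<Longrightarrow> kap (z + \<tau> *\<^sub>R axis i 1) = kap z"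
  by (auto simp: kap_def vec_eq_iff axis_def)

lemma col_base:
  assumes i: "e i < 4" and d: "((\<lambda>\<tau>. G (z + \<tau> *\<^sub>R axis i 1) (H z (mk4 s t 0 0))) has_vector_derivative v) (at 0)"
  shows "col z i \<bullet> b' (mk4 s t 0 0) = q0 z s t * v $ 3 + q0' z s t * v $ 4"
  using DERIV_unique[OF col_inner_b'[of z i "mk4 s t 0 0", unfolded kap_param[OF i]] deriv_b'_base[OF d]] by simp

lemma shift_deriv:
  assumes "(f has_vector_derivative v) (at (a::real))"
  shows "((\<lambda>\<tau>. f (a + \<tau>)) has_vector_derivative v) (at 0)"
proof -
  have "((\<lambda>\<tau>. a + \<tau>) has_vector_derivative 1) (at 0)" by (auto intro!: derivative_eq_intros)
  from vector_diff_chain_at[OF this, of f v] assms show ?thesis by (simp add: o_def)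
qed

lemma velocities:
  shows "((\<lambda>\<tau>. G (z + \<tau> *\<^sub>R axis (idx 0) 1) (H z y)) has_vector_derivative - qm (mk4 0 (cos (2 * z $ idx 1)) (- sin (2 * z $ idx 1)) 0) y) (at 0)"
    and "((\<lambda>\<tau>. G (z + \<tau> *\<^sub>R axis (idx 1) 1) (H z y)) has_vector_derivative - qm qk y) (at 0)"
    and "((\<lambda>\<tau>. G (z + \<tau> *\<^sub>R axis (idx 2) 1) (H z y)) has_vector_derivative qm y (mk4 0 (cos (2 * z $ idx 3)) (- sin (2 * z $ idx 3)) 0)) (at 0)"
    and "((\<lambda>\<tau>. G (z + \<tau> *\<^sub>R axis (idx 3) 1) (H z y)) has_vector_derivative qm y qk) (at 0)"
proof -
  have y: "y = coframe (z $ idx 0) (z $ idx 1) (z $ idx 2) (z $ idx 3) (H z y)" by (simp add: H_def)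
  have a: "axis (idx i) (1::real) $ idx j = (if i = j then 1 else 0)" if "i < 4" "j < 4" for i j
    using that N by (simp add: axis_idx e_idx)
  note d = coframe_deriv[OF y]
  show "((\<lambda>\<tau>. G (z + \<tau> *\<^sub>R axis (idx 0) 1) (H z y)) has_vector_derivative - qm (mk4 0 (cos (2 * z $ idx 1)) (- sin (2 * z $ idx 1)) 0) y) (at 0)"
    using shift_deriv[OF d(1)] by (simp add: G_def a del: One_nat_def)
  show "((\<lambda>\<tau>. G (z + \<tau> *\<^sub>R axis (idx 1) 1) (H z y)) has_vector_derivative - qm qk y) (at 0)"
    using shift_deriv[OF d(2)] by (simp add: G_def a del: One_nat_def)
  show "((\<lambda>\<tau>. G (z + \<tau> *\<^sub>R axis (idx 2) 1) (H z y)) has_vector_derivative qm y (mk4 0 (cos (2 * z $ idx 3)) (- sin (2 * z $ idx 3)) 0)) (at 0)"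
    using shift_deriv[OF d(3)] by (simp add: G_def a del: One_nat_def)
  show "((\<lambda>\<tau>. G (z + \<tau> *\<^sub>R axis (idx 3) 1) (H z y)) has_vector_derivative qm y qk) (at 0)"
    using shift_deriv[OF d(4)] by (simp add: G_def a del: One_nat_def)
qed

text \<open>Moving the plane changes the restricted cubic by \<open>q0\<close> and
  \<open>q0'\<close> times the normal velocities, which are linear in \<open>s\<close>,
  \<open>t\<close>. The halves come from rewriting such products in the adapted binary basis, as in
  \<open>(s^2 - t^2) s = (s^3 - 3 s t^2) / 2 + (s^2 + t^2) s / 2\<close>.\<close>

lemma col_coeffs:
  assumes i: "e i < 4"
    and d: "\<And>s t. ((\<lambda>\<tau>. G (z + \<tau> *\<^sub>R axis i 1) (H z (mk4 s t 0 0))) has_vector_derivative V s t) (at 0)"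
    and V: "\<And>s t. V s t $ 3 = A * s + B * t" "\<And>s t. V s t $ 4 = C * s + D * t"
    and x: "x0 = sqrt 12 * l * z $ idx 4" "y0 = sqrt 12 * l * z $ idx 5" "z0 = sqrt (wgt' l m) * z $ idx 8"
     "x1 = sqrt 12 * l * z $ idx 6" "y1 = sqrt 12 * l * z $ idx 7" "z1 = sqrt (wgt' l m) * z $ idx 9"
  shows "col z i $ idx 0 = (A * x0 - B * y0 + C * x1 - D * y1) / (2 * p1)"
    "col z i $ idx 1 = (A * y0 + B * x0 + C * y1 + D * x1) / (2 * p1)"
    "col z i $ idx 2 = (A * (2 * z0 + x0) + B * y0 + C * (2 * z1 + x1) + D * y1) / (2 * p2)"
    "col z i $ idx 3 = (A * y0 + B * (2 * z0 - x0) + C * y1 + D * (2 * z1 - x1)) / (2 * p2)"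
proof -
  let ?v = "col z i"
  have eq: "?v \<bullet> b' (mk4 s t 0 0) = q0 z s t * (A * s + B * t) + q0' z s t * (C * s + D * t)" for s t
    using col_base[OF i d] V by simp
  have "(p1 * ?v $ idx 0 - (A * x0 - B * y0 + C * x1 - D * y1) / 2) * (s ^ 3 - 3 * s * t\<^sup>2)
     + (p1 * ?v $ idx 1 - (A * y0 + B * x0 + C * y1 + D * x1) / 2) * (3 * s\<^sup>2 * t - t ^ 3)
     + (p2 * ?v $ idx 2 - (A * (2 * z0 + x0) + B * y0 + C * (2 * z1 + x1) + D * y1) / 2) * ((s\<^sup>2 + t\<^sup>2) * s)
     + (p2 * ?v $ idx 3 - (A * y0 + B * (2 * z0 - x0) + C * y1 + D * (2 * z1 - x1)) / 2) * ((s\<^sup>2 + t\<^sup>2) * t) = 0" for s t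
    using eq[of s t] unfolding inner_b'_base q0_def q0'_def x[symmetric] by algebra
  from binary_cubic_coeffs[OF this] show
    "col z i $ idx 0 = (A * x0 - B * y0 + C * x1 - D * y1) / (2 * p1)"
    "col z i $ idx 1 = (A * y0 + B * x0 + C * y1 + D * x1) / (2 * p1)"
    "col z i $ idx 2 = (A * (2 * z0 + x0) + B * y0 + C * (2 * z1 + x1) + D * y1) / (2 * p2)"
    "col z i $ idx 3 = (A * y0 + B * (2 * z0 - x0) + C * y1 + D * (2 * z1 - x1)) / (2 * p2)"
    using p12 l by (simp_all add: field_simps)
qed

end

lemma negligible_hyperplane_nth: "negligible {z :: real^'n. z $ i = c}"
  using negligible_standard_hyperplane[of "axis i (1::real)" c] by (simp add: inner_axis)

lemma resultant_scale:
  fixes p q l w X X' Y Y' Z Z' :: real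
  assumes "q\<^sup>2 = 12" "p\<^sup>2 = w"
  shows "(p * Z * (q * l * X') - q * l * X * (p * Z'))\<^sup>2 + (p * Z * (q * l * Y') - q * l * Y * (p * Z'))\<^sup>2
      - (q * l * X * (q * l * Y') - q * l * Y * (q * l * X'))\<^sup>2
    = 12 * l\<^sup>2 * weighted_resultant w (12 * l\<^sup>2) X X' Y Y' Z Z'"
  unfolding assms[symmetric] by algebra

context incidence begin

text \<open>The angular columns are, up to sign, \<open>S (s q0 - t q0')\<close>,
  \<open>t q0 + s q0'\<close>, \<open>S' (s q0 + t q0')\<close> and \<open>t q0 - s q0'\<close>.
  Sums and differences turn them into \<open>s q0\<close>, \<open>t q0\<close>,
  \<open>s q0'\<close>, \<open>t q0'\<close>, the Sylvester matrix of the two quadratic forms; hence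
  the resultant, with \<open>S * S'\<close> in front.\<close>

lemma jacobian:
  "\<bar>det (matrix (Phi' z))\<bar> = 6 / wgt l m * \<bar>sin (2 * z $ idx 1)\<bar> * \<bar>sin (2 * z $ idx 3)\<bar> *
     \<bar>weighted_resultant (wgt' l m) (12 * l\<^sup>2) (z $ idx 4) (z $ idx 6) (z $ idx 5) (z $ idx 7) (z $ idx 8) (z $ idx 9)\<bar>"
proof -
  define x0 y0 z0 x1 y1 z1 where x: "x0 = sqrt 12 * l * z $ idx 4" "y0 = sqrt 12 * l * z $ idx 5" "z0 = sqrt (wgt' l m) * z $ idx 8"
     "x1 = sqrt 12 * l * z $ idx 6" "y1 = sqrt 12 * l * z $ idx 7" "z1 = sqrt (wgt' l m) * z $ idx 9"
  define S S' where "S = sin (2 * z $ idx 1)" and "S' = sin (2 * z $ idx 3)"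
  have e4: "e (idx 0) = 0" "e (idx 1) = 1" "e (idx 2) = 2" "e (idx 3) = 3" using N by (simp_all add: e_idx)
  have e4': "e (idx 0) < 4" "e (idx 1) < 4" "e (idx 2) < 4" "e (idx 3) < 4" unfolding e4 by simp_all
  note v = velocities[of z "mk4 _ _ 0 0"]
  \<comment> \<open>Only the components normal to the base plane are recorded, since the cubic
    vanishes along it.\<close>
  have V0: "(- qm (mk4 0 (cos (2 * z $ idx 1)) (- sin (2 * z $ idx 1)) 0) (mk4 s t 0 0)) $ 3 = S * s + 0 * t"
    "(- qm (mk4 0 (cos (2 * z $ idx 1)) (- sin (2 * z $ idx 1)) 0) (mk4 s t 0 0)) $ 4 = 0 * s + (- S) * t" for s t
    by (simp_all add: qm_def S_def)
  have V1: "(- qm qk (mk4 s t 0 0)) $ 3 = 0 * s + (- 1) * t" "(- qm qk (mk4 s t 0 0)) $ 4 = (- 1) * s + 0 * t" for s t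
    by (simp_all add: qm_def qk_def)
  have V2: "qm (mk4 s t 0 0) (mk4 0 (cos (2 * z $ idx 3)) (- sin (2 * z $ idx 3)) 0) $ 3 = (- S') * s + 0 * t"
    "qm (mk4 s t 0 0) (mk4 0 (cos (2 * z $ idx 3)) (- sin (2 * z $ idx 3)) 0) $ 4 = 0 * s + (- S') * t" for s t
    by (simp_all add: qm_def S'_def)
  have V3: "qm (mk4 s t 0 0) qk $ 3 = 0 * s + (- 1) * t" "qm (mk4 s t 0 0) qk $ 4 = 1 * s + 0 * t" for s t
    by (simp_all add: qm_def qk_def)
  note c0 = col_coeffs[OF e4'(1) velocities(1) V0 x]
  note c1 = col_coeffs[OF e4'(2) velocities(2) V1 x]
  note c2 = col_coeffs[OF e4'(3) velocities(3) V2 x]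
  note c3 = col_coeffs[OF e4'(4) velocities(4) V3 x]
  define R where "R = (z0 * x1 - x0 * z1)\<^sup>2 + (z0 * y1 - y0 * z1)\<^sup>2 - (x0 * y1 - y0 * x1)\<^sup>2"
  define p r where "p = 1 / (2 * p1)" and "r = 1 / (2 * p2)"
  have pr: "y / (2 * p1) = p * y" "y / (2 * p2) = r * y" for y by (simp_all add: p_def r_def)
  let ?M = "(\<chi> r i. col z i $ r) :: real^'n::_^'n::_"
  let ?I = "{idx 0, idx 1, idx 2, idx 3}"
  have d: "distinct [idx 0, idx 1, idx 2, idx 3]" using N by (simp add: idx_eq_iff)
  have "det ?M = (\<Sum>p | p permutes ?I. of_int (sign p) * (\<Prod>i\<in>?I. ?M $ i $ p i))"
  proof (rule det_unit_columns)
    fix r j assume "j \<notin> ?I"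
    have "e j \<ge> 4"
    proof (rule ccontr)
      assume "\<not> 4 \<le> e j"
      then have "e j = 0 \<or> e j = 1 \<or> e j = 2 \<or> e j = 3" by arith
      then show False using \<open>j \<notin> ?I\<close> idx_e[of j] by auto
    qed
    then show "?M $ r $ j = (if r = j then 1 else 0)" by (simp add: col_free axis_def)
  qed
  also have "\<dots> = (\<Sum>p | p permutes ?I. of_int (sign p) * (\<Prod>i\<in>?I. col z (p i) $ i))" by simp
  also have "\<dots> = - 16 * (p\<^sup>2 * r\<^sup>2) * (S * S' * R)"
    unfolding sum_permutes_4[OF d, where m="\<lambda>i j. col z j $ i"] c0 c1 c2 c3 pr R_def by algebra
  finally have det: "\<bar>det ?M\<bar> = 16 * (p\<^sup>2 * r\<^sup>2) * \<bar>S\<bar> * \<bar>S'\<bar> * \<bar>R\<bar>" by (simp add: abs_mult)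
  have w: "wgt l m > 0" "wgt' l m > 0" using l by (auto simp: wgt_def wgt'_def intro!: add_pos_nonneg)
  \<comment> \<open>Together with the factor \<open>12 * l^2\<close> extracted from
    \<open>R\<close>, this produces the constant \<open>6 / wgt l m\<close>.\<close>
  have 16: "16 * (p\<^sup>2 * r\<^sup>2) = 1 / (2 * l\<^sup>2 * wgt l m)"
    using w l by (simp add: p_def r_def power_divide power_mult_distrib)
  have R: "R = 12 * l\<^sup>2 * weighted_resultant (wgt' l m) (12 * l\<^sup>2) (z $ idx 4) (z $ idx 6) (z $ idx 5) (z $ idx 7) (z $ idx 8) (z $ idx 9)"
  proof -
    have s: "(sqrt 12)\<^sup>2 = 12" "(sqrt (wgt' l m))\<^sup>2 = wgt' l m" using w by simp_all
    show ?thesis unfolding R_def x by (rule resultant_scale[OF s])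
  qed
  show ?thesis
    unfolding det_Phi' det 16 R abs_mult[of "12 * l\<^sup>2"] S_def S'_def using l w by (simp add: field_simps)
qed

text \<open>The second angle stops at \<open>pi / 4\<close> because the direction pairs \<open>(u, v)\<close> and \<open>(-u, -v)\<close> define the same
  plane.\<close>

definition inner_box :: "(real^'n::_) set" where
  "inner_box = {z. z $ idx 0 \<in> {0<..<pi} \<and> z $ idx 1 \<in> {0<..<pi / 4} \<and> z $ idx 2 \<in> {0<..<pi} \<and> z $ idx 3 \<in> {0<..<pi / 2}}"

text \<open>Entire hyperplanes are taken instead of faces, as only the null image under
  \<open>Phi\<close> matters.\<close>

definition box_faces :: "(real^'n::_) set" where
  "box_faces = {z. z $ idx 0 = 0} \<union> {z. z $ idx 0 = pi} \<union> {z. z $ idx 1 = 0} \<union> {z. z $ idx 1 = pi / 4}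
     \<union> {z. z $ idx 2 = 0} \<union> {z. z $ idx 2 = pi} \<union> {z. z $ idx 3 = 0} \<union> {z. z $ idx 3 = pi / 2}"

lemma inner_box_borel: "inner_box \<in> sets borel"
  unfolding inner_box_def by measurable

lemma Phi_faces_null: "Phi ` box_faces \<in> null_sets lebesgue"
proof -
  have "negligible box_faces"
    unfolding box_faces_def by (intro negligible_Un negligible_hyperplane_nth)
  moreover have "Phi differentiable_on box_faces"
    using Phi'(1) by (auto simp: differentiable_on_def differentiable_def intro: has_derivative_at_withinI)
  ultimately have "negligible (Phi ` box_faces)"
    by (intro negligible_differentiable_image_negligible) auto
  then show ?thesis by (simp add: negligible_iff_null_sets)
qed

lemma pl_in_zero_set:
  assumes "Phi z = v" "x \<in> pl z" shows "v \<bullet> b x = 0"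
proof -
  have "G z x \<in> base_plane" using assms(2) by (simp add: pl_def plane_def G_def)
  moreover have "\<forall>j<4. kap z $ idx j = 0" using N by (simp add: kap_def e_idx)
  ultimately have "kap z \<bullet> b' (G z x) = 0" using vanish_on_base[of "kap z"] by blast
  then show ?thesis using assms(1) Phi_inner_b by auto
qed

text \<open>Distinct fibre points have distinct planes, because the plane fixes the angles and then
  the cubic fixes the coefficients. Conversely every plane has angles in the closed box, and a cubic
  outside the image of the faces forces them into the interior.\<close>

lemma Phi_bij:
  assumes v: "v \<notin> Phi ` box_faces"
  shows "bij_betw pl {z\<in>inner_box. Phi z = v} {V. subspace V \<and> dim V = 2 \<and> (\<forall>x\<in>V. v \<bullet> b x = 0)}"
proof (rule bij_betw_imageI)
  show "inj_on pl {z \<in> inner_box. Phi z = v}"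
  proof (rule inj_onI)
    fix z z' assume z: "z \<in> {z \<in> inner_box. Phi z = v}" "z' \<in> {z \<in> inner_box. Phi z = v}" "pl z = pl z'"
    then have p: "z $ idx 0 = z' $ idx 0 \<and> z $ idx 1 = z' $ idx 1 \<and> z $ idx 2 = z' $ idx 2 \<and> z $ idx 3 = z' $ idx 3"
      unfolding pl_def inner_box_def by (intro plane_inj) auto
    have "kap z = kap z'"
    proof (rule eq_if_inner_b')
      fix y
      have "G z' (H z y) = G z (H z y)" using p by (simp add: G_def)
      moreover have "Phi z \<bullet> b (H z y) = Phi z' \<bullet> b (H z y)" using z by simp
      ultimately show "kap z \<bullet> b' y = kap z' \<bullet> b' y" unfolding Phi_inner_b by simp
    qed
    then have k: "e i \<ge> 4 \<Longrightarrow> z $ i = z' $ i" for i by (simp add: kap_def vec_eq_iff) (metis not_less)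
    show "z = z'"
    proof (subst vec_eq_iff, safe)
      fix i
      show "z $ i = z' $ i"
      proof (cases "e i \<ge> 4")
        case False
        then have "e i = 0 \<or> e i = 1 \<or> e i = 2 \<or> e i = 3" by arith
        then show ?thesis using p idx_e[of i] by auto
      qed (rule k)
    qed
  qed
  show "pl ` {z \<in> inner_box. Phi z = v} = {V. subspace V \<and> dim V = 2 \<and> (\<forall>x\<in>V. v \<bullet> b x = 0)}"
  proof safe
    fix z assume "v = Phi z"
    show "subspace (pl z)" "dim (pl z) = 2" by (simp_all add: pl_def subspace_plane dim_plane)
    fix x assume "x \<in> pl z"
    then show "Phi z \<bullet> b x = 0" using pl_in_zero_set by blast
  next
    fix V assume V: "subspace V" "dim V = 2" "\<forall>x\<in>V. v \<bullet> b x = 0"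
    obtain f t f' t' where p: "V = plane f t f' t'" "f \<in> {0..pi}" "t \<in> {0..pi / 4}" "f' \<in> {0..pi}" "t' \<in> {0..pi / 2}"
      using plane_exists[OF V(1,2)] by blast
    define par where "par j = (if j = 0 then f else if j = 1 then t else if j = 2 then f' else t')" for j :: nat
    \<comment> \<open>\<open>w\<close> fixes only the plane. It is needed first because the
      remaining coordinates of \<open>z\<close> are the coefficients of \<open>v\<close> in the
      frame of that plane.\<close>
    define w where "w = (\<chi> i. par (e i))"
    define z where "z = (\<chi> i. if e i < 4 then par (e i) else T w v $ i)"
    have zi: "z $ idx j = par j" "w $ idx j = par j" if "j < 4" for j using that N by (simp_all add: z_def w_def e_idx)
    have gh: "G z = G w" "pl z = V" "pl w = V" using zi by (simp_all add: G_def pl_def p(1) par_def)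
    have "\<forall>x\<in>base_plane. T w v \<bullet> b' x = 0"
    proof
      fix y assume "y \<in> base_plane"
      then have "H w y \<in> V" unfolding gh(3)[symmetric] pl_def plane_def using GH(1)[of w y] by (simp add: G_def)
      then have "v \<bullet> b (H w y) = 0" using V(3) by blast
      then show "T w v \<bullet> b' y = 0" using T_inner[of w v "b (H w y)"] by (simp add: T)
    qed
    then have "\<forall>j<4. T w v $ idx j = 0" unfolding vanish_on_base .
    then have k: "kap z = T w v"
      by (auto simp: kap_def z_def vec_eq_iff) (metis idx_e)
    have "Phi z \<bullet> b x = v \<bullet> b x" for x
      unfolding Phi_inner_b k gh(1) T(2)[of w, symmetric] T_inner ..
    then have "T z (Phi z) \<bullet> b' x = T z v \<bullet> b' x" for x
      using T_inner[of z _ "b (H z x)"] by (simp add: T(2))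
    then have "T z (Phi z) = T z v" by (rule eq_if_inner_b')
    then have Pz: "Phi z = v" using orthogonal_transformation_inj[OF T(1)[of z]] by (simp add: inj_eq)
    have "z \<notin> box_faces" using v Pz by blast
    then have "z \<in> inner_box" using p zi[of 0] zi[of 1] zi[of 2] zi[of 3] by (auto simp: box_faces_def inner_box_def par_def)
    then show "V \<in> pl ` {z \<in> inner_box. Phi z = v}" using Pz gh(2) by blast
  qed
qed

lemma lines_count_AE:
  "AE v in lebesgue. lines_count (\<lambda>x. v \<bullet> b x) = emeasure (count_space UNIV) {z\<in>inner_box. Phi z = v}"
proof (rule AE_I'[OF Phi_faces_null], safe, rule ccontr)
  fix v assume n: "lines_count (\<lambda>x. v \<bullet> b x) \<noteq> emeasure (count_space UNIV) {z\<in>inner_box. Phi z = v}"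
    and "v \<notin> Phi ` box_faces"
  note bij = Phi_bij[OF this(2)]
  have "emeasure (count_space UNIV) A = emeasure (count_space UNIV) B" if "bij_betw h A B" for h :: "real^'n::_ \<Rightarrow> (real^4) set" and A B
    using bij_betw_finite[OF that] bij_betw_same_card[OF that] by (cases "finite A") simp_all
  from this[OF bij] n show False by (simp add: lines_count_def)
qed

end

section \<open>The expected number of lines\<close>

interpretation lb: product_sigma_finite "\<lambda>_::nat. lborel :: real measure" by standard

interpretation snp: product_sigma_finite "\<lambda>_::nat. std_normal" by standard

lemma sets_PiM_std: "sets (\<Pi>\<^sub>M j\<in>I. std_normal) = sets (\<Pi>\<^sub>M j\<in>I. (lborel :: real measure))"
  by (rule sets_PiM_cong) auto

lemma nn_integral_PiM_std_normal:
  fixes I :: "nat set"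
  assumes "finite I" "F \<in> borel_measurable (\<Pi>\<^sub>M j\<in>I. (lborel :: real measure))"
  shows "(\<integral>\<^sup>+f. F f \<partial>(\<Pi>\<^sub>M j\<in>I. std_normal)) =
    (\<integral>\<^sup>+f. (\<Prod>j\<in>I. ennreal (std_normal_density (f j))) * F f \<partial>(\<Pi>\<^sub>M j\<in>I. lborel))"
  using assms
proof (induction I arbitrary: F rule: finite_induct)
  case empty
  then show ?case by (simp add: lb.nn_integral_empty snp.nn_integral_empty)
next
  case (insert i I)
  note [measurable] = insert.prems
  have F': "F \<in> borel_measurable (\<Pi>\<^sub>M j\<in>insert i I. std_normal)"
    using insert.prems by (subst measurable_cong_sets[OF sets_PiM_std refl])
  have upd: "(\<lambda>y. F (x(i := y))) \<in> borel_measurable borel" if "x \<in> space (\<Pi>\<^sub>M j\<in>I. (lborel :: real measure))" for x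
    using measurable_comp[OF measurable_component_update[OF that insert.hyps(2)] insert.prems] by (simp add: comp_def)
  let ?G = "\<lambda>x. \<integral>\<^sup>+y. ennreal (std_normal_density y) * F (x(i := y)) \<partial>lborel"
  have Gm: "?G \<in> borel_measurable (\<Pi>\<^sub>M j\<in>I. (lborel :: real measure))" by measurable
  have sp: "space (\<Pi>\<^sub>M j\<in>I. std_normal) = space (\<Pi>\<^sub>M j\<in>I. (lborel :: real measure))"
    by (simp add: space_PiM)
  have "(\<integral>\<^sup>+f. F f \<partial>(\<Pi>\<^sub>M j\<in>insert i I. std_normal)) =
      (\<integral>\<^sup>+x. (\<integral>\<^sup>+y. F (x(i := y)) \<partial>std_normal) \<partial>(\<Pi>\<^sub>M j\<in>I. std_normal))"
    by (rule snp.product_nn_integral_insert[OF insert.hyps F'])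
  also have "\<dots> = (\<integral>\<^sup>+x. ?G x \<partial>(\<Pi>\<^sub>M j\<in>I. std_normal))"
    using upd by (intro nn_integral_cong nn_integral_std_normal) (simp add: sp)
  also have "\<dots> = (\<integral>\<^sup>+x. (\<Prod>j\<in>I. ennreal (std_normal_density (x j))) * ?G x \<partial>(\<Pi>\<^sub>M j\<in>I. lborel))"
    by (rule insert.IH[OF Gm])
  also have "\<dots> = (\<integral>\<^sup>+x. (\<integral>\<^sup>+y. (\<Prod>j\<in>insert i I. ennreal (std_normal_density ((x(i := y)) j))) * F (x(i := y)) \<partial>lborel) \<partial>(\<Pi>\<^sub>M j\<in>I. lborel))"
  proof (intro nn_integral_cong)
    fix x assume x: "x \<in> space (\<Pi>\<^sub>M j\<in>I. (lborel :: real measure))"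
    have p: "(\<Prod>j\<in>insert i I. ennreal (std_normal_density ((x(i := y)) j))) =
        ennreal (std_normal_density y) * (\<Prod>j\<in>I. ennreal (std_normal_density (x j)))" for y
      using insert.hyps by (simp add: prod.insert cong: prod.cong) (intro arg_cong2[where f="(*)"] refl prod.cong, auto)
    show "(\<Prod>j\<in>I. ennreal (std_normal_density (x j))) * ?G x =
      (\<integral>\<^sup>+y. (\<Prod>j\<in>insert i I. ennreal (std_normal_density ((x(i := y)) j))) * F (x(i := y)) \<partial>lborel)"
      unfolding p using upd[OF x] by (subst nn_integral_cmult[symmetric]) (auto simp: mult_ac)
  qed
  also have "\<dots> = (\<integral>\<^sup>+f. (\<Prod>j\<in>insert i I. ennreal (std_normal_density (f j))) * F f \<partial>(\<Pi>\<^sub>M j\<in>insert i I. lborel))"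
  proof (rule lb.product_nn_integral_insert[OF insert.hyps, symmetric])
    have "(\<lambda>f. ennreal (std_normal_density (f j))) \<in> borel_measurable (\<Pi>\<^sub>M j\<in>insert i I. (lborel :: real measure))" if "j \<in> insert i I" for j
      using that by measurable
    with insert.prems show "(\<lambda>f. (\<Prod>j\<in>insert i I. ennreal (std_normal_density (f j))) * F f) \<in> borel_measurable (\<Pi>\<^sub>M j\<in>insert i I. (lborel :: real measure))"
      by (auto intro!: borel_measurable_times_ennreal borel_measurable_prod_ennreal)
  qed
  finally show ?case .
qed

lemma nn_integral_lborel_vec:
  fixes e :: "'n::finite \<Rightarrow> nat" and g :: "real^'n \<Rightarrow> ennreal"
  assumes e: "bij_betw e UNIV {..<N}" and g: "g \<in> borel_measurable borel"
  shows "(\<integral>\<^sup>+z. g z \<partial>lborel) = (\<integral>\<^sup>+f. g (\<chi> i. f (e i)) \<partial>(\<Pi>\<^sub>M j\<in>{..<N}. lborel))"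
proof -
  have "e i \<in> {..<N}" for i using e by (auto simp: bij_betw_def)
  then show ?thesis
    by (subst lborel_eq_distr_PiM[OF e], subst nn_integral_distr[OF measurable_vec_PiM]) (use g in auto)
qed

lemma nn_integral_PiM_extract:
  fixes I :: "nat set"
  assumes I: "finite I" "i \<in> I" and F: "F \<in> borel_measurable (\<Pi>\<^sub>M j\<in>I. std_normal)"
  shows "(\<integral>\<^sup>+f. F f \<partial>(\<Pi>\<^sub>M j\<in>I. std_normal)) =
    (\<integral>\<^sup>+y. (\<integral>\<^sup>+f. F (f(i := y)) \<partial>(\<Pi>\<^sub>M j\<in>I - {i}. std_normal)) \<partial>std_normal)"
proof -
  have e: "insert i (I - {i}) = I" using I by auto
  show ?thesis
    using snp.product_nn_integral_insert_rev[of "I - {i}" i F] I F unfolding e by auto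
qed

lemma measurable_coord_std[measurable]: "j \<in> I \<Longrightarrow> (\<lambda>f. f j) \<in> borel_measurable (\<Pi>\<^sub>M j\<in>I. std_normal)"
  using measurable_component_singleton[of j I "\<lambda>_. std_normal"] by (simp cong: measurable_cong_sets)

lemma borel_measurable_weighted_resultant:
  assumes "a \<in> borel_measurable M" "b \<in> borel_measurable M" "c \<in> borel_measurable M"
    "d \<in> borel_measurable M" "p \<in> borel_measurable M" "q \<in> borel_measurable M"
  shows "(\<lambda>x. ennreal \<bar>weighted_resultant A C (a x) (b x) (c x) (d x) (p x) (q x)\<bar>) \<in> borel_measurable M"
  using assms by measurable

text \<open>Coordinates are peeled off in the order 8, 9, 5, 7, 4, 6, which reproduces the nesting
  of \<open>expected_resultant\<close>; the coordinates left over carry total mass 1.\<close>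

lemma expected_resultant_PiM:
  fixes I :: "nat set" and A C :: real
  assumes I: "finite I" "{4,5,6,7,8,9} \<subseteq> I" and AC: "A > 0" "C > 0"
  shows "(\<integral>\<^sup>+f. ennreal \<bar>weighted_resultant A C (f 4) (f 6) (f 5) (f 7) (f 8) (f 9)\<bar> \<partial>(\<Pi>\<^sub>M j\<in>I. std_normal)) =
    ennreal (2 * (C - 2 * A + 4 * A * sqrt (A / (A + C))))"
proof -
  note m = borel_measurable_weighted_resultant measurable_coord_std borel_measurable_const
  have 1: "(\<integral>\<^sup>+f. ennreal \<bar>weighted_resultant A C (f 4) (f 6) (f 5) (f 7) (f 8) (f 9)\<bar> \<partial>(\<Pi>\<^sub>M j\<in>I. std_normal)) =
    (\<integral>\<^sup>+z. \<integral>\<^sup>+f. ennreal \<bar>weighted_resultant A C (f 4) (f 6) (f 5) (f 7) z (f 9)\<bar> \<partial>(\<Pi>\<^sub>M j\<in>I - {8}. std_normal) \<partial>std_normal)"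
    by (subst nn_integral_PiM_extract[of "I" 8]) (use I in \<open>auto intro!: m\<close>)
  have 2: "(\<integral>\<^sup>+f. ennreal \<bar>weighted_resultant A C (f 4) (f 6) (f 5) (f 7) z (f 9)\<bar> \<partial>(\<Pi>\<^sub>M j\<in>I - {8}. std_normal)) =
    (\<integral>\<^sup>+z'. \<integral>\<^sup>+f. ennreal \<bar>weighted_resultant A C (f 4) (f 6) (f 5) (f 7) z z'\<bar> \<partial>(\<Pi>\<^sub>M j\<in>I - {8} - {9}. std_normal) \<partial>std_normal)" for z
    by (subst nn_integral_PiM_extract[of "I - {8}" 9]) (use I in \<open>auto intro!: m\<close>)
  have 3: "(\<integral>\<^sup>+f. ennreal \<bar>weighted_resultant A C (f 4) (f 6) (f 5) (f 7) z z'\<bar> \<partial>(\<Pi>\<^sub>M j\<in>I - {8} - {9}. std_normal)) =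
    (\<integral>\<^sup>+y. \<integral>\<^sup>+f. ennreal \<bar>weighted_resultant A C (f 4) (f 6) y (f 7) z z'\<bar> \<partial>(\<Pi>\<^sub>M j\<in>I - {8} - {9} - {5}. std_normal) \<partial>std_normal)" for z z'
    by (subst nn_integral_PiM_extract[of "I - {8} - {9}" 5]) (use I in \<open>auto intro!: m\<close>)
  have 4: "(\<integral>\<^sup>+f. ennreal \<bar>weighted_resultant A C (f 4) (f 6) y (f 7) z z'\<bar> \<partial>(\<Pi>\<^sub>M j\<in>I - {8} - {9} - {5}. std_normal)) =
    (\<integral>\<^sup>+y'. \<integral>\<^sup>+f. ennreal \<bar>weighted_resultant A C (f 4) (f 6) y y' z z'\<bar> \<partial>(\<Pi>\<^sub>M j\<in>I - {8} - {9} - {5} - {7}. std_normal) \<partial>std_normal)" for z z' y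
    by (subst nn_integral_PiM_extract[of "I - {8} - {9} - {5}" 7]) (use I in \<open>auto intro!: m\<close>)
  have 5: "(\<integral>\<^sup>+f. ennreal \<bar>weighted_resultant A C (f 4) (f 6) y y' z z'\<bar> \<partial>(\<Pi>\<^sub>M j\<in>I - {8} - {9} - {5} - {7}. std_normal)) =
    (\<integral>\<^sup>+x. \<integral>\<^sup>+f. ennreal \<bar>weighted_resultant A C x (f 6) y y' z z'\<bar> \<partial>(\<Pi>\<^sub>M j\<in>I - {8} - {9} - {5} - {7} - {4}. std_normal) \<partial>std_normal)" for z z' y y'
    by (subst nn_integral_PiM_extract[of "I - {8} - {9} - {5} - {7}" 4]) (use I in \<open>auto intro!: m\<close>)
  have 6: "(\<integral>\<^sup>+f. ennreal \<bar>weighted_resultant A C x (f 6) y y' z z'\<bar> \<partial>(\<Pi>\<^sub>M j\<in>I - {8} - {9} - {5} - {7} - {4}. std_normal)) =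
    (\<integral>\<^sup>+x'. \<integral>\<^sup>+f. ennreal \<bar>weighted_resultant A C x x' y y' z z'\<bar> \<partial>(\<Pi>\<^sub>M j\<in>I - {8} - {9} - {5} - {7} - {4} - {6}. std_normal) \<partial>std_normal)" for z z' y y' x
    by (subst nn_integral_PiM_extract[of "I - {8} - {9} - {5} - {7} - {4}" 6]) (use I in \<open>auto intro!: m\<close>)
  have "emeasure (\<Pi>\<^sub>M j\<in>I - {8} - {9} - {5} - {7} - {4} - {6}. std_normal) (space (\<Pi>\<^sub>M j\<in>I - {8} - {9} - {5} - {7} - {4} - {6}. std_normal)) = 1"
    by (rule prob_space.emeasure_space_1) (intro prob_space_PiM sn.prob_space_axioms)
  then show ?thesis unfolding 1 2 3 4 5 6 by (simp add: expected_resultant[OF AC])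
qed

lemma nn_integral_sin_double:
  assumes "0 \<le> a" "a \<le> pi / 2"
  shows "(\<integral>\<^sup>+t. indicator {0<..<a} t * ennreal \<bar>sin (2 * t)\<bar> \<partial>lborel) = ennreal ((1 - cos (2 * a)) / 2)"
proof -
  have s: "0 \<le> sin (2 * t)" if "0 \<le> t" "t \<le> a" for t using that assms by (intro sin_ge_zero) auto
  have "(\<integral>\<^sup>+t. indicator {0<..<a} t * ennreal \<bar>sin (2 * t)\<bar> \<partial>lborel) =
    (\<integral>\<^sup>+t. ennreal (sin (2 * t)) * indicator {0..a} t \<partial>lborel)"
  proof (rule nn_integral_cong_AE, rule AE_I[where N="{0, a}"])
    show "{t \<in> space lborel. indicator {0<..<a} t * ennreal \<bar>sin (2 * t)\<bar> \<noteq> ennreal (sin (2 * t)) * indicator {0..a} t} \<subseteq> {0, a}"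
      using s by (auto split: split_indicator_asm simp: mult.commute)
    show "emeasure lborel {0, a} = 0" using finite_imp_null_set_lborel[of "{0, a}"] by auto
  qed auto
  also have "\<dots> = ennreal (- cos (2 * a) / 2 - (- cos (2 * 0) / 2))"
  proof (rule nn_integral_FTC_Icc[where F="\<lambda>t. - cos (2 * t) / 2" and a=0 and b=a and f="\<lambda>t. sin (2 * t)", OF _ _ _ assms(1)])
    fix t assume "t \<in> {0..a}"
    then show "0 \<le> sin (2 * t)" by (auto intro: s)
    show "((\<lambda>t. - cos (2 * t) / 2) has_real_derivative sin (2 * t)) (at t)"
      by (auto intro!: derivative_eq_intros)
  qed auto
  also have "\<dots> = ennreal ((1 - cos (2 * a)) / 2)" by (simp add: diff_divide_distrib)
  finally show ?thesis .
qed

context incidence begin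

lemma gauss_density_vec: "gauss_density (\<chi> i. f (e i)) = (\<Prod>j<N. std_normal_density (f j))"
  using prod.reindex_bij_betw[OF e, of "\<lambda>j. std_normal_density (f j)"] by (simp add: gauss_density_def)

lemma vec_idx: "j < N \<Longrightarrow> (\<chi> i. f (e i)) $ idx j = f j"
  by (simp add: e_idx)

lemma nn_integral_gauss_vec:
  fixes h :: "real^'n::_ \<Rightarrow> ennreal"
  assumes h: "h \<in> borel_measurable borel"
  shows "(\<integral>\<^sup>+f. h (\<chi> i. f (e i)) \<partial>(\<Pi>\<^sub>M j\<in>{..<N}. std_normal)) = (\<integral>\<^sup>+v. ennreal (gauss_density v) * h v \<partial>lborel)"
proof -
  have "(\<lambda>f. \<chi> i. f (e i)) \<in> measurable (\<Pi>\<^sub>M j\<in>{..<N}. (lborel :: real measure)) (borel :: (real^'n::_) measure)"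
    by (rule measurable_vec_PiM) (simp add: e_less)
  then have hm: "(\<lambda>f. h (\<chi> i. f (e i))) \<in> borel_measurable (\<Pi>\<^sub>M j\<in>{..<N}. (lborel :: real measure))"
    using h by (rule measurable_compose)
  have "(\<integral>\<^sup>+v. ennreal (gauss_density v) * h v \<partial>lborel) =
     (\<integral>\<^sup>+f. ennreal (gauss_density (\<chi> i. f (e i))) * h (\<chi> i. f (e i)) \<partial>(\<Pi>\<^sub>M j\<in>{..<N}. lborel))"
    using h by (intro nn_integral_lborel_vec[OF e]) measurable
  also have "\<dots> = (\<integral>\<^sup>+f. (\<Prod>j\<in>{..<N}. ennreal (std_normal_density (f j))) * h (\<chi> i. f (e i)) \<partial>(\<Pi>\<^sub>M j\<in>{..<N}. lborel))"
    by (simp add: gauss_density_vec prod_ennreal)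
  also have "\<dots> = (\<integral>\<^sup>+f. h (\<chi> i. f (e i)) \<partial>(\<Pi>\<^sub>M j\<in>{..<N}. std_normal))"
    by (rule nn_integral_PiM_std_normal[symmetric, OF _ hm]) simp
  finally show ?thesis ..
qed

lemma integrable_gauss_density: "integrable lborel (gauss_density :: real^'n::_ \<Rightarrow> real)"
proof (rule integrableI_nonneg)
  have "(\<integral>\<^sup>+v. ennreal (gauss_density (v :: real^'n::_)) \<partial>lborel) = (\<integral>\<^sup>+f. 1 \<partial>(\<Pi>\<^sub>M j\<in>{..<N}. std_normal))"
    using nn_integral_gauss_vec[of "\<lambda>_. 1"] by simp
  also have "\<dots> = 1"
  proof -
    have "prob_space (\<Pi>\<^sub>M j\<in>{..<N}. std_normal)" by (intro prob_space_PiM sn.prob_space_axioms)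
    from prob_space.emeasure_space_1[OF this] show ?thesis by simp
  qed
  finally show "(\<integral>\<^sup>+v. ennreal (gauss_density (v :: real^'n::_)) \<partial>lborel) < \<infinity>" by simp
  show "(gauss_density :: real^'n::_ \<Rightarrow> real) \<in> borel_measurable lborel"
    using gauss_density_borel by (subst measurable_cong_sets[OF sets_lborel refl])
  show "AE v in lborel. 0 \<le> gauss_density (v :: real^'n::_)" by (rule AE_I2) (rule gauss_density_nonneg)
qed

text \<open>The indicator of the parameter box and the angular part of the Jacobian, split into one
  factor per angle so that the integral over the angles is a product.\<close>

definition factor :: "nat \<Rightarrow> real \<Rightarrow> ennreal" where
  "factor j = (if j = 0 then (\<lambda>x. indicator {0<..<pi} x)
    else if j = 1 then (\<lambda>x. indicator {0<..<pi / 4} x * ennreal \<bar>sin (2 * x)\<bar>)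
    else if j = 2 then (\<lambda>x. indicator {0<..<pi} x)
    else (\<lambda>x. indicator {0<..<pi / 2} x * ennreal \<bar>sin (2 * x)\<bar>))"

lemma factor_borel[measurable]: "factor j \<in> borel_measurable borel"
proof -
  have "(\<lambda>x. indicator {0<..<a} x * ennreal \<bar>sin (2 * x)\<bar>) \<in> borel_measurable borel"
    "(\<lambda>x. indicator {0<..<a} x :: ennreal) \<in> borel_measurable borel" for a :: real
    by measurable
  then show ?thesis by (simp add: factor_def)
qed

definition wres :: "(nat \<Rightarrow> real) \<Rightarrow> real" where
  "wres f = weighted_resultant (wgt' l m) (12 * l\<^sup>2) (f 4) (f 6) (f 5) (f 7) (f 8) (f 9)"

text \<open>The integrand of the area formula in coordinates; \<open>1 / (4 * pi^2)\<close> is the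
  normal density at 0 to the fourth power, from the four coordinates that \<open>kap\<close> sets to
  zero.\<close>

definition dens :: "(nat \<Rightarrow> real) \<Rightarrow> ennreal" where
  "dens f = ennreal (6 / wgt l m * (1 / (4 * pi\<^sup>2))) * (\<Prod>j\<in>{..<4}. factor j (f j)) *
    ((\<Prod>j\<in>{4..<N}. ennreal (std_normal_density (f j))) * ennreal \<bar>wres f\<bar>)"

lemma wgt_pos: "wgt l m > 0" "wgt' l m > 0"
  using l by (auto simp: wgt_def wgt'_def intro!: add_pos_nonneg)

lemma gauss_density_Phi: "gauss_density (Phi z) = 1 / (4 * pi\<^sup>2) * (\<Prod>j\<in>{4..<N}. std_normal_density (z $ idx j))"
proof -
  have "gauss_density (Phi z) = gauss_density (kap z)" unfolding gauss_density_inner norm_Phi ..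
  also have "kap z = (\<chi> i. (\<lambda>j. if j < 4 then 0 else z $ idx j) (e i))" by (auto simp: kap_def idx_e vec_eq_iff)
  also have "gauss_density \<dots> = (\<Prod>j<N. std_normal_density (if j < 4 then 0 else z $ idx j))" by (rule gauss_density_vec)
  also have "{..<N} = {..<4} \<union> {4..<N}" using N by auto
  also have "(\<Prod>j\<in>{..<4} \<union> {4..<N}. std_normal_density (if j < 4 then 0 else z $ idx j)) =
      (\<Prod>j\<in>{..<4}. std_normal_density (if j < (4::nat) then 0 else z $ idx j)) * (\<Prod>j\<in>{4..<N}. std_normal_density (if j < 4 then 0 else z $ idx j))"
    by (rule prod.union_disjoint) auto
  also have "(\<Prod>j\<in>{..<4}. std_normal_density (if j < (4::nat) then 0 else z $ idx j)) = (\<Prod>j\<in>{..<4::nat}. std_normal_density 0)"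
    by (intro prod.cong) auto
  also have "\<dots> = 1 / (4 * pi\<^sup>2)" using std_normal_density_0_pow4 by simp
  also have "(\<Prod>j\<in>{4..<N}. std_normal_density (if j < 4 then 0 else z $ idx j)) = (\<Prod>j\<in>{4..<N}. std_normal_density (z $ idx j))"
    by (intro prod.cong) auto
  finally show ?thesis .
qed

lemma integrand_dens:
  "indicator inner_box z * ennreal (\<bar>det (matrix (Phi' z))\<bar> * gauss_density (Phi z)) = dens (\<lambda>j. z $ idx j)"
proof -
  let ?w = "wres (\<lambda>j. z $ idx j)" and ?P = "\<Prod>j\<in>{4..<N}. std_normal_density (z $ idx j)"
  have P: "(\<Prod>j\<in>{4..<N}. ennreal (std_normal_density (z $ idx j))) = ennreal ?P"
    by (simp add: prod_ennreal)
  have f: "(\<Prod>j\<in>{..<4::nat}. factor j (z $ idx j)) =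
     indicator inner_box z * ennreal (\<bar>sin (2 * z $ idx 1)\<bar> * \<bar>sin (2 * z $ idx 3)\<bar>)"
  proof -
    have s: "{..<4::nat} = {0, 1, 2, 3}" by auto
    have i: "indicator inner_box z = indicator {0<..<pi} (z $ idx 0) * indicator {0<..<pi / 4} (z $ idx 1) *
        (indicator {0<..<pi} (z $ idx 2) * indicator {0<..<pi / 2} (z $ idx 3) :: ennreal)"
      by (auto simp: inner_box_def split: split_indicator)
    show ?thesis unfolding s i
      by (simp add: factor_def ennreal_mult ac_simps del: One_nat_def)
  qed
  have "\<bar>det (matrix (Phi' z))\<bar> * gauss_density (Phi z) =
     (6 / wgt l m * (1 / (4 * pi\<^sup>2))) * (\<bar>sin (2 * z $ idx 1)\<bar> * \<bar>sin (2 * z $ idx 3)\<bar>) * (?P * \<bar>?w\<bar>)"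
    unfolding jacobian gauss_density_Phi wres_def by (simp only: ac_simps)
  moreover have "ennreal \<dots> = ennreal (6 / wgt l m * (1 / (4 * pi\<^sup>2))) * ennreal (\<bar>sin (2 * z $ idx 1)\<bar> * \<bar>sin (2 * z $ idx 3)\<bar>) * (ennreal ?P * ennreal \<bar>?w\<bar>)"
    using wgt_pos by (subst ennreal_mult, simp, simp add: prod_nonneg, subst ennreal_mult, simp, simp, subst ennreal_mult) (simp_all add: prod_nonneg)
  ultimately show ?thesis unfolding dens_def f P by (simp only: ac_simps)
qed

lemma measurable_coord_lborel: "j \<in> I \<Longrightarrow> (\<lambda>f. f j) \<in> borel_measurable (\<Pi>\<^sub>M j\<in>I. (lborel :: real measure))"
  using measurable_component_singleton[of j I "\<lambda>_. lborel :: real measure"] by simp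

lemma ennreal_density_borel: "(\<lambda>x. ennreal (std_normal_density x)) \<in> borel_measurable borel"
  by measurable

lemma dens_measurable: "dens \<in> borel_measurable (\<Pi>\<^sub>M j\<in>{..<N}. (lborel :: real measure))"
proof -
  have c: "j < N \<Longrightarrow> (\<lambda>f. f j) \<in> borel_measurable (\<Pi>\<^sub>M j\<in>{..<N}. (lborel :: real measure))" for j
    by (rule measurable_coord_lborel) simp
  have 1: "(\<lambda>f. factor j (f j)) \<in> borel_measurable (\<Pi>\<^sub>M j\<in>{..<N}. (lborel :: real measure))" if "j < N" for j
    using measurable_compose[OF c[OF that] factor_borel] .
  have 2: "(\<lambda>f. ennreal (std_normal_density (f j))) \<in> borel_measurable (\<Pi>\<^sub>M j\<in>{..<N}. (lborel :: real measure))" if "j < N" for j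
    using measurable_compose[OF c[OF that] ennreal_density_borel] .
  have 3: "(\<lambda>f. ennreal \<bar>wres f\<bar>) \<in> borel_measurable (\<Pi>\<^sub>M j\<in>{..<N}. (lborel :: real measure))"
    unfolding wres_def using N by (intro borel_measurable_weighted_resultant c) auto
  have A: "(\<lambda>f. \<Prod>j\<in>{..<4}. factor j (f j)) \<in> borel_measurable (\<Pi>\<^sub>M j\<in>{..<N}. (lborel :: real measure))"
    by (rule borel_measurable_prod_ennreal, rule 1) (use N in auto)
  have B: "(\<lambda>f. \<Prod>j\<in>{4..<N}. ennreal (std_normal_density (f j))) \<in> borel_measurable (\<Pi>\<^sub>M j\<in>{..<N}. (lborel :: real measure))"
    by (rule borel_measurable_prod_ennreal, rule 2) auto
  have "dens = (\<lambda>f. ennreal (6 / wgt l m * (1 / (4 * pi\<^sup>2))) * (\<Prod>j\<in>{..<4}. factor j (f j)) *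
    ((\<Prod>j\<in>{4..<N}. ennreal (std_normal_density (f j))) * ennreal \<bar>wres f\<bar>))"
    by (rule ext) (rule dens_def)
  then show ?thesis
    by (simp only: borel_measurable_times_ennreal borel_measurable_const A B 3)
qed

lemma nn_integral_factor: "(\<Prod>j\<in>{..<4}. \<integral>\<^sup>+x. factor j x \<partial>lborel) = ennreal (pi\<^sup>2 / 2)"
proof -
  have s: "{..<4::nat} = {0, 1, 2, 3}" by auto
  \<comment> \<open>The first left angle has length \<open>pi\<close>, the halved second one
    integrates to \<open>1 / 2\<close>, and the right angles give \<open>pi\<close> and 1.\<close>
  have "(\<Prod>j\<in>{..<4}. \<integral>\<^sup>+x. factor j x \<partial>lborel) = ennreal pi * (ennreal (1 / 2) * (ennreal pi * ennreal 1))"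
    unfolding s using nn_integral_sin_double[of "pi / 4"] nn_integral_sin_double[of "pi / 2"]
    by (simp add: factor_def del: One_nat_def)
  also have "\<dots> = ennreal (pi * (1 / 2 * (pi * 1)))"
    by (subst ennreal_mult', simp, subst ennreal_mult', simp, subst ennreal_mult') simp_all
  finally show ?thesis by (simp add: power2_eq_square)
qed

lemma nn_integral_dens:
  "(\<integral>\<^sup>+f. dens f \<partial>(\<Pi>\<^sub>M j\<in>{..<N}. lborel)) =
    ennreal (3 / (2 * wgt l m) * (12 * l\<^sup>2 - 2 * wgt' l m + 4 * wgt' l m * sqrt (wgt' l m / (wgt' l m + 12 * l\<^sup>2))))"
proof -
  let ?K = "6 / wgt l m * (1 / (4 * pi\<^sup>2))"
  let ?R = "2 * (12 * l\<^sup>2 - 2 * wgt' l m + 4 * wgt' l m * sqrt (wgt' l m / (wgt' l m + 12 * l\<^sup>2)))"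
  let ?A = "\<lambda>f. (\<Prod>j\<in>{..<4}. factor j (f j))"
  let ?B = "\<lambda>f. (\<Prod>j\<in>{4..<N}. ennreal (std_normal_density (f j))) * ennreal \<bar>wres f\<bar>"
  have U: "{..<4} \<union> {4..<N} = {..<N}" using N by auto
  have disj: "{..<4} \<inter> {4..<N} = {}" by auto
  have Am: "?A \<in> borel_measurable (\<Pi>\<^sub>M j\<in>{..<4}. (lborel :: real measure))"
    by (intro borel_measurable_prod_ennreal measurable_compose[OF measurable_coord_lborel factor_borel])
  have wm: "(\<lambda>f. ennreal \<bar>wres f\<bar>) \<in> borel_measurable (\<Pi>\<^sub>M j\<in>{4..<N}. (lborel :: real measure))"
    unfolding wres_def using N by (intro borel_measurable_weighted_resultant measurable_coord_lborel) auto
  have Bm: "?B \<in> borel_measurable (\<Pi>\<^sub>M j\<in>{4..<N}. (lborel :: real measure))"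
    by (intro borel_measurable_times_ennreal borel_measurable_prod_ennreal wm
        measurable_compose[OF measurable_coord_lborel ennreal_density_borel])
  have B: "(\<integral>\<^sup>+f. ?B f \<partial>(\<Pi>\<^sub>M j\<in>{4..<N}. lborel)) = ennreal ?R"
    unfolding nn_integral_PiM_std_normal[OF finite_atLeastLessThan wm, symmetric] unfolding wres_def
    using N l wgt_pos by (intro expected_resultant_PiM) auto
  have "(\<integral>\<^sup>+f. dens f \<partial>(\<Pi>\<^sub>M j\<in>{..<N}. lborel)) =
     (\<integral>\<^sup>+x. \<integral>\<^sup>+y. dens (merge {..<4} {4..<N} (x, y)) \<partial>(\<Pi>\<^sub>M j\<in>{4..<N}. lborel) \<partial>(\<Pi>\<^sub>M j\<in>{..<4}. lborel))"
    using lb.product_nn_integral_fold[of "{..<4}" "{4..<N}" dens, unfolded U, OF _ _ _ dens_measurable]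
    by (simp add: disj)
  also have "\<dots> = (\<integral>\<^sup>+x. \<integral>\<^sup>+y. (ennreal ?K * ?A x) * ?B y \<partial>(\<Pi>\<^sub>M j\<in>{4..<N}. lborel) \<partial>(\<Pi>\<^sub>M j\<in>{..<4}. lborel))"
  proof (intro nn_integral_cong)
    fix x y :: "nat \<Rightarrow> real"
    let ?g = "merge {..<4} {4..<N} (x, y)"
    have g: "?g j = (if j < 4 then x j else y j)" if "j < N" for j using that by (auto simp: merge_def)
    have "?A ?g = ?A x" using g N by (intro prod.cong) auto
    moreover have "(\<Prod>j\<in>{4..<N}. ennreal (std_normal_density (?g j))) = (\<Prod>j\<in>{4..<N}. ennreal (std_normal_density (y j)))"
      using g by (intro prod.cong) auto
    moreover have "wres ?g = wres y" using g N by (simp add: wres_def)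
    ultimately show "dens ?g = (ennreal ?K * ?A x) * ?B y" by (simp add: dens_def)
  qed
  also have "\<dots> = (\<integral>\<^sup>+x. (ennreal ?K * ?A x) * ennreal ?R \<partial>(\<Pi>\<^sub>M j\<in>{..<4}. lborel))"
    by (simp only: nn_integral_cmult[OF Bm] B)
  also have "\<dots> = ennreal ?K * (\<integral>\<^sup>+x. ?A x \<partial>(\<Pi>\<^sub>M j\<in>{..<4}. lborel)) * ennreal ?R"
    by (simp only: nn_integral_multc[OF borel_measurable_times_ennreal[OF borel_measurable_const Am]] nn_integral_cmult[OF Am])
  also have "(\<integral>\<^sup>+x. ?A x \<partial>(\<Pi>\<^sub>M j\<in>{..<4}. lborel)) = (\<Prod>j\<in>{..<4}. \<integral>\<^sup>+x. factor j x \<partial>lborel)"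
    by (rule lb.product_nn_integral_prod) auto
  also have "\<dots> = ennreal (pi\<^sup>2 / 2)" by (rule nn_integral_factor)
  also have "ennreal ?K * ennreal (pi\<^sup>2 / 2) * ennreal ?R = ennreal (?K * (pi\<^sup>2 / 2) * ?R)"
    using wgt_pos by (subst ennreal_mult', simp, subst ennreal_mult') simp_all
  also have "?K * (pi\<^sup>2 / 2) * ?R = 3 / (2 * wgt l m) * (?R / 2)"
    using wgt_pos by (simp add: field_simps)
  also have "?R / 2 = 12 * l\<^sup>2 - 2 * wgt' l m + 4 * wgt' l m * sqrt (wgt' l m / (wgt' l m + 12 * l\<^sup>2))"
    by (rule nonzero_mult_div_cancel_left) simp
  finally show ?thesis .
qed

text \<open>The measurable \<open>h\<close> stands in for the line count, whose own measurability is
  not established; almost everywhere equality is enough for the integral.\<close>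

theorem expected_lines:
  obtains h where "h \<in> borel_measurable (\<Pi>\<^sub>M j\<in>{..<N}. std_normal)"
    "AE f in (\<Pi>\<^sub>M j\<in>{..<N}. std_normal). lines_count (\<lambda>x. (\<chi> i. f (e i)) \<bullet> b x) = h f"
    "(\<integral>\<^sup>+f. h f \<partial>(\<Pi>\<^sub>M j\<in>{..<N}. std_normal)) = ennreal (3 / (2 * wgt l m) * (12 * l\<^sup>2 - 2 * wgt' l m + 4 * wgt' l m * sqrt (wgt' l m / (wgt' l m + 12 * l\<^sup>2))))"
proof -
  let ?X = "\<Pi>\<^sub>M j\<in>{..<N}. std_normal"
  let ?v = "\<lambda>f. (\<chi> i. f (e i)) :: real^'n::_"
  obtain Nf where Nf: "Nf \<in> borel_measurable lebesgue"
    "AE y in lebesgue. Nf y = emeasure (count_space UNIV) {z\<in>inner_box. Phi z = y}"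
    "(\<integral>\<^sup>+y. Nf y * ennreal (gauss_density y) \<partial>lebesgue) =
     (\<integral>\<^sup>+z. indicator inner_box z * ennreal (\<bar>det (matrix (Phi' z))\<bar> * gauss_density (Phi z)) \<partial>lborel)"
    using area_formula[where D=inner_box and f=Phi and f'=Phi' and g=gauss_density, OF inner_box_borel Phi'(1) Phi'(2) integrable_gauss_density gauss_density_nonneg] by blast
  \<comment> \<open>The multiplicity is Lebesgue measurable; a Borel version can be composed with
    the map from coefficient families to vectors.\<close>
  obtain Nb where Nb: "Nb \<in> borel_measurable lborel" "AE y in lborel. Nf y = Nb y"
    using completion_ex_borel_measurable[OF Nf(1)] by blast
  have "AE v in lborel. Nf v = emeasure (count_space UNIV) {z\<in>inner_box. Phi z = v}"
    using Nf(2) by (simp only: AE_completion_iff)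
  moreover have "AE v in lborel. lines_count (\<lambda>x. v \<bullet> b x) = emeasure (count_space UNIV) {z\<in>inner_box. Phi z = v}"
    using lines_count_AE by (simp only: AE_completion_iff)
  ultimately have AE: "AE v in lborel. lines_count (\<lambda>x. v \<bullet> b x) = Nb v"
    using Nb(2) by eventually_elim simp
  then obtain Z where Z: "{v \<in> space lborel. lines_count (\<lambda>x. v \<bullet> b x) \<noteq> Nb v} \<subseteq> Z" "emeasure lborel Z = 0" "Z \<in> sets lborel"
    by (rule AE_E)
  have vm: "?v \<in> measurable ?X borel"
    using measurable_vec_PiM[of e "{..<N}"] by (simp add: e_less measurable_cong_sets[OF sets_PiM_std refl])
  have AEv: "AE f in ?X. lines_count (\<lambda>x. ?v f \<bullet> b x) = Nb (?v f)"
  proof (rule AE_I[where N="?v -` Z \<inter> space ?X"])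
    show "{f \<in> space ?X. lines_count (\<lambda>x. ?v f \<bullet> b x) \<noteq> Nb (?v f)} \<subseteq> ?v -` Z \<inter> space ?X"
      using Z(1) by auto
    show s: "?v -` Z \<inter> space ?X \<in> sets ?X" using Z(3) by (intro measurable_sets[OF vm]) simp
    have "emeasure ?X (?v -` Z \<inter> space ?X) = (\<integral>\<^sup>+f. indicator Z (?v f) \<partial>?X)"
      unfolding nn_integral_indicator[OF s, symmetric] by (intro nn_integral_cong) (auto simp: indicator_def)
    also have "\<dots> = (\<integral>\<^sup>+v. ennreal (gauss_density v) * indicator Z v \<partial>lborel)"
      using Z(3) by (intro nn_integral_gauss_vec) auto
    also have "\<dots> = (\<integral>\<^sup>+v. 0 \<partial>(lborel :: (real^'n::_) measure))"
    proof (intro nn_integral_cong_AE)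
      have "AE v in lborel. v \<notin> Z" using Z(2,3) by (intro AE_not_in) auto
      then show "AE v in lborel. ennreal (gauss_density v) * indicator Z v = 0" by eventually_elim simp
    qed
    finally show "emeasure ?X (?v -` Z \<inter> space ?X) = 0" by simp
  qed
  have hm: "(\<lambda>f. Nb (?v f)) \<in> borel_measurable ?X"
    using measurable_compose[OF vm, of Nb borel] Nb(1) by simp
  have "(\<integral>\<^sup>+f. Nb (?v f) \<partial>?X) = (\<integral>\<^sup>+v. ennreal (gauss_density v) * Nb v \<partial>lborel)"
    using Nb(1) by (intro nn_integral_gauss_vec) simp
  also have "\<dots> = (\<integral>\<^sup>+v. Nf v * ennreal (gauss_density v) \<partial>lborel)"
    using Nb(2) by (intro nn_integral_cong_AE) (auto simp: mult.commute)
  also have "\<dots> = (\<integral>\<^sup>+z. dens (\<lambda>j. z $ idx j) \<partial>lborel)"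
    using Nf(3) unfolding nn_integral_completion integrand_dens .
  also have "\<dots> = (\<integral>\<^sup>+f. dens (\<lambda>j. ?v f $ idx j) \<partial>(\<Pi>\<^sub>M j\<in>{..<N}. lborel))"
  proof (rule nn_integral_lborel_vec[OF e])
    have c: "(\<lambda>z :: real^'n::_. z $ idx j) \<in> borel_measurable borel" for j :: nat by measurable
    have 1: "(\<lambda>z :: real^'n::_. factor j (z $ idx j)) \<in> borel_measurable borel" for j
      using measurable_compose[OF c factor_borel] .
    have 2: "(\<lambda>z :: real^'n::_. ennreal (std_normal_density (z $ idx j))) \<in> borel_measurable borel" for j by measurable
    have 3: "(\<lambda>z :: real^'n::_. ennreal \<bar>wres (\<lambda>j. z $ idx j)\<bar>) \<in> borel_measurable borel"
      unfolding wres_def by (intro borel_measurable_weighted_resultant c)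
    show "(\<lambda>z :: real^'n::_. dens (\<lambda>j. z $ idx j)) \<in> borel_measurable borel"
      unfolding dens_def
      by (rule borel_measurable_times_ennreal[OF borel_measurable_times_ennreal[OF borel_measurable_const
          borel_measurable_prod_ennreal[OF 1]] borel_measurable_times_ennreal[OF borel_measurable_prod_ennreal[OF 2] 3]])
  qed
  also have "\<dots> = (\<integral>\<^sup>+f. dens f \<partial>(\<Pi>\<^sub>M j\<in>{..<N}. lborel))"
  proof (intro nn_integral_cong)
    fix f
    have v: "?v f $ idx j = f j" if "j < N" for j using that by (rule vec_idx)
    have "(\<Prod>j\<in>{..<4}. factor j (?v f $ idx j)) = (\<Prod>j\<in>{..<4}. factor j (f j))"
      by (rule prod.cong[OF refl], subst v) (use N in auto)
    moreover have "(\<Prod>j\<in>{4..<N}. ennreal (std_normal_density (?v f $ idx j))) = (\<Prod>j\<in>{4..<N}. ennreal (std_normal_density (f j)))"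
      by (rule prod.cong[OF refl], subst v) auto
    moreover have "wres (\<lambda>j. ?v f $ idx j) = wres f"
    proof -
      have "4 < N" "5 < N" "6 < N" "7 < N" "8 < N" "9 < N" using N by auto
      then show ?thesis unfolding wres_def by (simp only: v)
    qed
    ultimately show "dens (\<lambda>j. ?v f $ idx j) = dens f" unfolding dens_def by (simp only:)
  qed
  also note nn_integral_dens
  finally show ?thesis by (rule that[OF hm AEv])
qed

end

section \<open>Dependence on the parameter\<close>

lemma line_in_RP3: "x \<noteq> 0 \<Longrightarrow> span {x} \<in> RP3"
  by (simp add: RP3_def dim_span dim_singleton del: span_singleton)

text \<open>A subspace is recovered from the projective points it contains, so lines as sets of
  points and planes as subspaces are in bijection.\<close>

lemma num_lines_eq: "num_lines P = lines_count P"
proof -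
  let ?L = "\<lambda>V. {p \<in> RP3. p \<subseteq> V}"
  let ?A = "{V. subspace V \<and> dim V = 2 \<and> (\<forall>x\<in>V. P x = 0)}"
  have mem: "x \<in> V \<longleftrightarrow> span {x} \<in> ?L V" if "subspace V" "x \<noteq> 0" for x V
  proof
    assume "x \<in> V"
    then have "span {x} \<subseteq> V" using that by (intro span_minimal) auto
    then show "span {x} \<in> ?L V" using line_in_RP3[OF that(2)] by simp
  next
    assume "span {x} \<in> ?L V"
    then show "x \<in> V" using span_base[of x "{x}"] by blast
  qed
  have inj: "inj_on ?L ?A"
  proof (rule inj_onI)
    fix V V' assume V: "V \<in> ?A" "V' \<in> ?A" "?L V = ?L V'"
    show "V = V'"
    proof (rule set_eqI)
      fix x
      show "x \<in> V \<longleftrightarrow> x \<in> V'"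
        using V mem[of V x] mem[of V' x] subspace_0[of V] subspace_0[of V'] by (cases "x = 0") auto
    qed
  qed
  have zero: "?L V \<subseteq> proj_zero_set P \<longleftrightarrow> (\<forall>x\<in>V. P x = 0)" if V: "subspace V" "dim V = 2" for V
  proof
    assume a: "?L V \<subseteq> proj_zero_set P"
    have nz: "P y = 0" if "x \<in> V" "x \<noteq> 0" "y \<in> span {x}" for x y
      using a mem[OF V(1) that(2)] that by (auto simp: proj_zero_set_def)
    \<comment> \<open>Every projective point contains the origin, so one nonzero vector of
      \<open>V\<close> already forces \<open>P 0 = 0\<close>.\<close>
    have "V \<noteq> {0}" using V(2) by auto
    then obtain w where "w \<in> V" "w \<noteq> 0" using subspace_0[OF V(1)] by blast
    then have "P 0 = 0" using nz[of w 0] span_zero by blast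
    moreover have "P x = 0" if "x \<in> V" "x \<noteq> 0" for x
      by (rule nz[OF that span_base]) simp
    ultimately show "\<forall>x\<in>V. P x = 0" by metis
  next
    assume "\<forall>x\<in>V. P x = 0"
    then show "?L V \<subseteq> proj_zero_set P" by (auto simp: proj_zero_set_def)
  qed
  have "{l \<in> proj_lines. l \<subseteq> proj_zero_set P} = ?L ` ?A"
  proof (intro set_eqI iffI)
    fix l assume "l \<in> {l \<in> proj_lines. l \<subseteq> proj_zero_set P}"
    then obtain V where "l = ?L V" "subspace V" "dim V = 2" "?L V \<subseteq> proj_zero_set P"
      unfolding proj_lines_def by blast
    then show "l \<in> ?L ` ?A" using zero[of V] by blast
  next
    fix l assume "l \<in> ?L ` ?A"
    then obtain V where V: "l = ?L V" "subspace V" "dim V = 2" "\<forall>x\<in>V. P x = 0" by blast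
    then have "l \<subseteq> proj_zero_set P" using zero[of V] by blast
    then show "l \<in> {l \<in> proj_lines. l \<subseteq> proj_zero_set P}" using V unfolding proj_lines_def by blast
  qed
  moreover have "emeasure (count_space UNIV) (?L ` ?A) = emeasure (count_space UNIV) ?A"
    using finite_image_iff[OF inj] card_image[OF inj] by (cases "finite ?A") simp_all
  ultimately show ?thesis by (simp add: num_lines_def lines_count_def)
qed

lemma lines_count_cmult:
  assumes "c \<noteq> 0" shows "lines_count (\<lambda>x. c * P x) = lines_count P"
  using assms by (simp add: lines_count_def)

text \<open>The value at 0 is 3. At \<open>1 / 6\<close>, which is \<open>mixing (1 / 3)\<close> and
  so the case of the Kostlan kernel, it is the known \<open>6 * sqrt 2 - 3\<close>.\<close>

definition lines_ratio :: "real \<Rightarrow> real" where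
  "lines_ratio x = 6 * sqrt ((1 + 6 * x) ^ 3 / (1 + 18 * x)) - 3"

text \<open>The quotient \<open>(1 + a)^3 / (1 + 3 a)\<close> has logarithmic derivative
  \<open>6 a / ((1 + a) (1 + 3 a))\<close>, which vanishes at \<open>a = 0\<close>. Cross
  multiplication with an explicit factor \<open>b - a\<close> gives strictness from 0 on without
  calculus.\<close>

lemma lines_ratio_mono:
  assumes "0 \<le> x" "x < y" shows "lines_ratio x < lines_ratio y"
proof -
  define a b where "a = 6 * x" and "b = 6 * y"
  have ab: "0 \<le> a" "a < b" using assms by (auto simp: a_def b_def)
  have "(1 + b) ^ 3 * (1 + 3 * a) - (1 + a) ^ 3 * (1 + 3 * b) =
    (b - a) * (3 * (b + a) + (b\<^sup>2 + a * b + a\<^sup>2) + 9 * (a * b) + 3 * (a * b) * (b + a))"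
    by algebra
  moreover have "\<dots> > 0" using ab by (intro mult_pos_pos add_pos_nonneg) (auto intro!: add_nonneg_nonneg mult_nonneg_nonneg)
  ultimately have "(1 + a) ^ 3 * (1 + 3 * b) < (1 + b) ^ 3 * (1 + 3 * a)" by simp
  then have "(1 + a) ^ 3 / (1 + 3 * a) < (1 + b) ^ 3 / (1 + 3 * b)"
    using ab by (simp add: divide_less_eq less_divide_eq mult.commute frac_less2 pos_divide_less_eq)
  then show ?thesis by (simp add: lines_ratio_def a_def b_def)
qed

text \<open>The quotient of \<open>l^2\<close> by \<open>wgt l (1 - l)\<close>, the only combination
  of the two weights on which the homogeneous expectation depends.\<close>

definition mixing :: "real \<Rightarrow> real" where
  "mixing l = l\<^sup>2 / (2 * l\<^sup>2 + (1 - l)\<^sup>2)"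

lemma mixing_denominator: "2 * l\<^sup>2 + (1 - l)\<^sup>2 > (0::real)"
  by (cases "l = 0") (auto intro: add_pos_nonneg)

text \<open>For \<open>l > 0\<close> the value is the reciprocal of
  \<open>2 + ((1 - l) / l)^2\<close>. Comparing \<open>l * (1 - k)\<close> with
  \<open>k * (1 - l)\<close> covers \<open>l = 0\<close> as well.\<close>

lemma mixing_mono:
  assumes "0 \<le> l" "l < k" "k \<le> 1" shows "mixing l < mixing k"
proof -
  have "l * (1 - k) < k * (1 - l)" using assms by (simp add: algebra_simps)
  moreover have "0 \<le> l * (1 - k)" using assms by simp
  ultimately have "(l * (1 - k))\<^sup>2 < (k * (1 - l))\<^sup>2" by (intro power_strict_mono) auto
  then have "l\<^sup>2 * (2 * k\<^sup>2 + (1 - k)\<^sup>2) < k\<^sup>2 * (2 * l\<^sup>2 + (1 - l)\<^sup>2)"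
    unfolding power_mult_distrib distrib_left by (simp only: mult.left_commute[of "l\<^sup>2"] mult.commute[of "l\<^sup>2" "k\<^sup>2"] mult.left_commute[of "k\<^sup>2" 2] add_less_cancel_left)
  then show ?thesis
    unfolding mixing_def using mixing_denominator[of l] mixing_denominator[of k]
    by (simp add: divide_less_eq less_divide_eq mult.commute)
qed

lemma mixing_nonneg: "0 \<le> mixing l"
  using mixing_denominator[of l] by (simp add: mixing_def)

text \<open>Dividing by \<open>w = wgt l (1 - l)\<close> leaves a function of
  \<open>x = l^2 / w\<close>. The terms in \<open>12 * x\<close> outside the root cancel, which
  leaves the constant -3.\<close>

lemma lines_ratio_eq:
  assumes l: "l > 0"
  shows "3 / (2 * wgt l (1 - l)) * (12 * l\<^sup>2 - 2 * wgt' l (1 - l) + 4 * wgt' l (1 - l) * sqrt (wgt' l (1 - l) / (wgt' l (1 - l) + 12 * l\<^sup>2)))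
    = lines_ratio (mixing l)"
proof -
  define w where "w = wgt l (1 - l)"
  have w: "w > 0" using mixing_denominator[of l] by (simp add: w_def wgt_def)
  have w': "wgt' l (1 - l) = w + 6 * l\<^sup>2" by (simp add: w_def wgt_def wgt'_def)
  define x where "x = mixing l"
  have x: "l\<^sup>2 = x * w" using w by (simp add: x_def mixing_def w_def wgt_def)
  have x0: "0 \<le> x" by (simp add: x_def mixing_nonneg)
  have q: "wgt' l (1 - l) = w * (1 + 6 * x)" "wgt' l (1 - l) + 12 * l\<^sup>2 = w * (1 + 18 * x)"
    unfolding w' x by (simp_all add: algebra_simps)
  have "sqrt ((1 + 6 * x) ^ 3 / (1 + 18 * x)) = (1 + 6 * x) * sqrt ((1 + 6 * x) / (1 + 18 * x))"
  proof -
    have "(1 + 6 * x) ^ 3 / (1 + 18 * x) = (1 + 6 * x)\<^sup>2 * ((1 + 6 * x) / (1 + 18 * x))"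
      by (simp add: power2_eq_square power3_eq_cube)
    moreover have "\<bar>1 + 6 * x\<bar> = 1 + 6 * x" using x0 by simp
    ultimately show ?thesis by (simp only: real_sqrt_mult real_sqrt_abs)
  qed
  moreover have "sqrt (wgt' l (1 - l) / (wgt' l (1 - l) + 12 * l\<^sup>2)) = sqrt ((1 + 6 * x) / (1 + 18 * x))"
    unfolding q(2) unfolding q(1) using w by simp
  ultimately show ?thesis
    unfolding lines_ratio_def x_def[symmetric] w_def[symmetric] unfolding q(1) x
    using w by (simp add: field_simps)
qed

lemma lines_ratio_1: "lines_ratio (mixing 1) = 24 * sqrt (2 / 5) - 3"
proof -
  have "(1 + 6 * (1 / 2)) ^ 3 / (1 + 18 * (1 / 2)) = 4\<^sup>2 * (2 / 5 :: real)" by simp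
  then have "sqrt ((1 + 6 * (1 / 2)) ^ 3 / (1 + 18 * (1 / 2))) = 4 * sqrt (2 / 5 :: real)"
    by (simp only: real_sqrt_mult real_sqrt_abs)
  moreover have "mixing 1 = 1 / 2" by (simp add: mixing_def)
  ultimately show ?thesis unfolding lines_ratio_def by (simp only:)
qed

lemma lines_ratio_mixing_mono: "0 \<le> l \<Longrightarrow> l < k \<Longrightarrow> k \<le> 1 \<Longrightarrow> lines_ratio (mixing l) < lines_ratio (mixing k)"
  by (intro lines_ratio_mono mixing_nonneg mixing_mono)

lemma lines_ratio_mixing_nonneg:
  assumes "0 \<le> l" "l \<le> 1" shows "0 \<le> lines_ratio (mixing l)"
proof -
  have "3 = lines_ratio (mixing 0)" by (simp add: lines_ratio_def mixing_def)
  also have "\<dots> \<le> lines_ratio (mixing l)"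
    using lines_ratio_mixing_mono[of 0 l] assms by (cases "l = 0") auto
  finally show ?thesis by simp
qed

lemma isCont_lines_ratio: "isCont (\<lambda>l. lines_ratio (mixing l)) 0"
  unfolding lines_ratio_def mixing_def by (intro continuous_intros) auto

section \<open>From independent Gaussian coefficients to the random cubic\<close>

lemma (in prob_space) indep_vars_reindex:
  assumes "inj_on f I" and "indep_vars M' X (f ` I)"
  shows "indep_vars (\<lambda>i. M' (f i)) (\<lambda>i. X (f i)) I"
proof -
  let ?F = "\<lambda>i. {X i -` A \<inter> space M |A. A \<in> sets (M' i)}"
  have F: "indep_sets ?F (f ` I)" and X: "\<And>i. i \<in> I \<Longrightarrow> random_variable (M' (f i)) (X (f i))"
    using assms(2) by (auto simp: indep_vars_def2)
  have "indep_sets (\<lambda>i. ?F (f i)) I"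
  proof (rule indep_setsI)
    fix i assume "i \<in> I"
    then show "?F (f i) \<subseteq> events" using X by (auto intro: measurable_sets)
  next
    fix A J assume J: "J \<noteq> {}" "J \<subseteq> I" "finite J" and A: "\<forall>j\<in>J. A j \<in> ?F (f j)"
    have inj: "inj_on f J" using inj_on_subset[OF assms(1) J(2)] .
    let ?A = "\<lambda>k. A (inv_into J f k)"
    have "prob (\<Inter>k\<in>f ` J. ?A k) = (\<Prod>k\<in>f ` J. prob (?A k))"
    proof (rule indep_setsD[OF F])
      show "\<forall>k\<in>f ` J. ?A k \<in> ?F k" using A inv_into_f_f[OF inj] by simp
    qed (use J in auto)
    moreover have "(\<Inter>k\<in>f ` J. ?A k) = (\<Inter>j\<in>J. A j)" using inv_into_f_f[OF inj] by simp
    moreover have "(\<Prod>k\<in>f ` J. prob (?A k)) = (\<Prod>j\<in>J. prob (A j))"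
      using inv_into_f_f[OF inj] by (simp add: prod.reindex[OF inj])
    ultimately show "prob (\<Inter>j\<in>J. A j) = (\<Prod>j\<in>J. prob (A j))" by simp
  qed
  then show ?thesis using X by (simp add: indep_vars_def2)
qed

lemma (in prob_space) distr_std_normal_family:
  assumes I: "finite I" "I \<noteq> {}" and ind: "indep_vars (\<lambda>_. borel) \<eta> I"
    and d: "\<And>j. j \<in> I \<Longrightarrow> distributed M lborel (\<eta> j) std_normal_density"
  shows "distr M (\<Pi>\<^sub>M j\<in>I. std_normal) (\<lambda>\<omega>. \<lambda>j\<in>I. \<eta> j \<omega>) = (\<Pi>\<^sub>M j\<in>I. std_normal)"
    and "(\<lambda>\<omega>. \<lambda>j\<in>I. \<eta> j \<omega>) \<in> measurable M (\<Pi>\<^sub>M j\<in>I. std_normal)"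
proof -
  have rv: "random_variable borel (\<eta> j)" if "j \<in> I" for j
    using ind that by (auto simp: indep_vars_def)
  have eq: "distr M borel (\<eta> j) = std_normal" if "j \<in> I" for j
  proof -
    have "distr M borel (\<eta> j) = distr M lborel (\<eta> j)" by (rule distr_cong) auto
    also have "\<dots> = std_normal" by (rule distributed_distr_eq_density[OF d[OF that]])
    finally show ?thesis .
  qed
  have s: "sets (\<Pi>\<^sub>M j\<in>I. borel) = sets (\<Pi>\<^sub>M j\<in>I. std_normal)"
    by (rule sets_PiM_cong) simp_all
  have "distr M (\<Pi>\<^sub>M j\<in>I. std_normal) (\<lambda>\<omega>. \<lambda>j\<in>I. \<eta> j \<omega>) = distr M (\<Pi>\<^sub>M j\<in>I. borel) (\<lambda>\<omega>. \<lambda>j\<in>I. \<eta> j \<omega>)"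
    by (rule distr_cong[OF refl s[symmetric] refl])
  also have "\<dots> = (\<Pi>\<^sub>M j\<in>I. distr M borel (\<eta> j))"
    using iffD1[OF indep_vars_iff_distr_eq_PiM'[where M' = "\<lambda>_. borel" and X = \<eta>, OF I(2) rv] ind] .
  also have "\<dots> = (\<Pi>\<^sub>M j\<in>I. std_normal)" by (rule PiM_cong[OF refl eq])
  finally show "distr M (\<Pi>\<^sub>M j\<in>I. std_normal) (\<lambda>\<omega>. \<lambda>j\<in>I. \<eta> j \<omega>) = (\<Pi>\<^sub>M j\<in>I. std_normal)" .
  show "(\<lambda>\<omega>. \<lambda>j\<in>I. \<eta> j \<omega>) \<in> measurable M (\<Pi>\<^sub>M j\<in>I. std_normal)"
    using rv by (intro measurable_restrict) auto
qed

lemma span_range_UNIV: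
  fixes b :: "'a \<Rightarrow> real^'n"
  assumes "\<And>v. (\<And>x. v \<bullet> b x = 0) \<Longrightarrow> v = 0"
  shows "span (range b) = UNIV"
proof (rule ccontr)
  assume "span (range b) \<noteq> UNIV"
  then obtain a where "a \<noteq> 0" "span (range b) \<subseteq> {x. a \<bullet> x = 0}"
    using span_not_univ_subset_hyperplane by blast
  then have "a \<bullet> b x = 0" for x using span_base[of "b x" "range b"] by blast
  with assms \<open>a \<noteq> 0\<close> show False by blast
qed

lemma (in incidence) mean_lines_family:
  assumes "prob_space M" and "prob_space.indep_vars M (\<lambda>_. borel) \<eta> {..<N}"
    and "\<And>j. j < N \<Longrightarrow> distributed M lborel (\<eta> j) std_normal_density"
    and m: "m = 1 - l"
  shows "(\<integral>\<^sup>+\<omega>. lines_count (\<lambda>x. (\<chi> i. \<eta> (e i) \<omega>) \<bullet> b x) \<partial>M) = ennreal (lines_ratio (mixing l))"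
proof -
  interpret prob_space M by fact
  let ?X = "\<Pi>\<^sub>M j\<in>{..<N}. std_normal" and ?f = "\<lambda>\<omega>. \<lambda>j\<in>{..<N}. \<eta> j \<omega>"
  have "0 \<in> {..<N}" using N by simp
  then have "{..<N} \<noteq> {}" by blast
  note law = distr_std_normal_family[OF finite_lessThan this assms(2)]
  have law: "distr M ?X ?f = ?X" "?f \<in> measurable M ?X"
    using assms(3) by (auto intro!: law)
  obtain h where h: "h \<in> borel_measurable ?X"
    "AE f in ?X. lines_count (\<lambda>x. (\<chi> i. f (e i)) \<bullet> b x) = h f"
    "(\<integral>\<^sup>+f. h f \<partial>?X) = ennreal (3 / (2 * wgt l m) * (12 * l\<^sup>2 - 2 * wgt' l m + 4 * wgt' l m * sqrt (wgt' l m / (wgt' l m + 12 * l\<^sup>2))))"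
    by (rule expected_lines)
  have "AE \<omega> in M. lines_count (\<lambda>x. (\<chi> i. ?f \<omega> (e i)) \<bullet> b x) = h (?f \<omega>)"
    by (rule AE_distrD[OF law(2)], subst law(1), rule h(2))
  moreover have "?f \<omega> (e i) = \<eta> (e i) \<omega>" for \<omega> i
    using bij_betwE[OF e] by simp
  ultimately have "AE \<omega> in M. lines_count (\<lambda>x. (\<chi> i. \<eta> (e i) \<omega>) \<bullet> b x) = h (?f \<omega>)"
    by (simp only:)
  then have "(\<integral>\<^sup>+\<omega>. lines_count (\<lambda>x. (\<chi> i. \<eta> (e i) \<omega>) \<bullet> b x) \<partial>M) = (\<integral>\<^sup>+\<omega>. h (?f \<omega>) \<partial>M)"
    by (rule nn_integral_cong_AE)
  also have "\<dots> = (\<integral>\<^sup>+f. h f \<partial>distr M ?X ?f)"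
    by (rule nn_integral_distr[OF law(2), symmetric]) (simp only: law(1) h(1))
  also have "\<dots> = ennreal (lines_ratio (mixing l))"
    unfolding law(1) h(3) m using lines_ratio_eq[OF l] by simp
  finally show ?thesis .
qed

text \<open>At \<open>m = 0\<close> four members of the adapted family vanish, so the sixteen
  remaining ones carry the whole kernel.\<close>

lemma cubic_pure:
  assumes "16 \<le> j" "j < 20" shows "cubic l 0 j x = 0"
proof -
  have "j = 16 \<or> j = 17 \<or> j = 18 \<or> j = 19" using assms by linarith
  then show ?thesis by (elim disjE) (simp_all add: cubic_def cubics_def Let_def nth_20)
qed

text \<open>Scaling the family by \<open>sqrt 96\<close> turns its covariance into
  \<open>kern\<close> and leaves the lines unchanged; linear independence makes the evaluation
  vectors span.\<close>

lemma mean_lines_orthonormal: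
  fixes e :: "'n::{finite,wellorder} \<Rightarrow> nat" and G :: "nat \<Rightarrow> real^4 \<Rightarrow> real"
  assumes "prob_space M" and "prob_space.indep_vars M (\<lambda>_. borel) \<eta> {..<N}"
    and "\<And>j. j < N \<Longrightarrow> distributed M lborel (\<eta> j) std_normal_density"
    and l: "0 < l" and N: "10 \<le> N" "N \<le> 20" and e: "bij_betw e UNIV {..<N}"
    and vanish: "\<And>j x. N \<le> j \<Longrightarrow> j < 20 \<Longrightarrow> cubic l (1 - l) j x = 0"
    and gram: "\<And>x y. 96 * (\<Sum>j<N. G j x * G j y) = kern l (1 - l) x y"
    and indep: "\<And>c j. (\<And>x. (\<Sum>j<N. c j * G j x) = 0) \<Longrightarrow> j < N \<Longrightarrow> c j = 0"
  shows "(\<integral>\<^sup>+\<omega>. num_lines (\<lambda>x. \<Sum>j<N. \<eta> j \<omega> * G j x) \<partial>M) = ennreal (lines_ratio (mixing l))"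
proof -
  define b where "b x = (\<chi> i. sqrt 96 * G (e i) x)" for x
  have re: "(\<Sum>i\<in>UNIV. g (e i)) = (\<Sum>j<N. g j)" for g :: "nat \<Rightarrow> real"
    by (rule sum.reindex_bij_betw[OF e])
  have comp: "(\<chi> i. c (e i)) \<bullet> b x = sqrt 96 * (\<Sum>j<N. c j * G j x)" for c x
  proof -
    have "(\<chi> i. c (e i)) \<bullet> b x = (\<Sum>i\<in>UNIV. sqrt 96 * (c (e i) * G (e i) x))"
      by (simp add: inner_vec_def b_def mult.left_commute)
    also have "\<dots> = (\<Sum>j<N. sqrt 96 * (c j * G j x))" by (rule re)
    finally show ?thesis by (simp add: sum_distrib_left)
  qed
  have gr: "b x \<bullet> b y = kern l (1 - l) x y" for x y
  proof -
    have "b x \<bullet> b y = sqrt 96 * (\<Sum>j<N. (sqrt 96 * G j x) * G j y)"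
      using comp[of "\<lambda>j. sqrt 96 * G j x" y] by (simp add: b_def[of x])
    also have "\<dots> = (sqrt 96 * sqrt 96) * (\<Sum>j<N. G j x * G j y)"
      by (simp only: sum_distrib_left mult.assoc)
    finally show ?thesis using gram by simp
  qed
  have sp: "span (range b) = UNIV"
  proof (rule span_range_UNIV)
    fix v :: "real^'n::_" assume v: "\<And>x. v \<bullet> b x = 0"
    define c where "c j = v $ inv_into UNIV e j" for j
    have inj: "inj e" using e by (simp add: bij_betw_def)
    have ce: "c (e i) = v $ i" for i by (simp add: c_def inv_f_f[OF inj])
    have "(\<Sum>j<N. c j * G j x) = 0" for x
    proof -
      have "(\<chi> i. c (e i)) = v" by (simp add: ce)
      then show ?thesis using comp[of c x] v[of x] by simp
    qed
    then have "c (e i) = 0" for i using indep[of c "e i"] bij_betwE[OF e] by blast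
    then show "v = 0" by (simp add: ce vec_eq_iff)
  qed
  interpret incidence l "1 - l" N e b
    by unfold_locales (fact l N e vanish gr sp)+
  have "num_lines (\<lambda>x. \<Sum>j<N. \<eta> j \<omega> * G j x) = lines_count (\<lambda>x. (\<chi> i. \<eta> (e i) \<omega>) \<bullet> b x)" for \<omega>
  proof -
    have "lines_count (\<lambda>x. sqrt 96 * (\<Sum>j<N. \<eta> j \<omega> * G j x)) = lines_count (\<lambda>x. \<Sum>j<N. \<eta> j \<omega> * G j x)"
      by (rule lines_count_cmult) simp
    then show ?thesis using comp[of "\<lambda>j. \<eta> j \<omega>"] by (simp only: num_lines_eq)
  qed
  then show ?thesis using mean_lines_family[OF assms(1-3)] by simp
qed

locale random_cubics = prob_space M for M :: "'w measure" +
  fixes H3 H1 :: "nat \<Rightarrow> real^4 \<Rightarrow> real" and \<xi>3 \<xi>1 :: "nat \<Rightarrow> 'w \<Rightarrow> real"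
  assumes basis: "basis_family (harmonic_poly 3) {1..16} H3" "basis_family (harmonic_poly 1) {1..4} H1"
    and orthonormal: "orthonormal_family {1..16} H3" "orthonormal_family {1..4} (\<lambda>j x. (norm x)\<^sup>2 * H1 j x)"
    and normal: "\<And>j. j \<in> {1..16} \<Longrightarrow> distributed M lborel (\<xi>3 j) std_normal_density"
      "\<And>j. j \<in> {1..4} \<Longrightarrow> distributed M lborel (\<xi>1 j) std_normal_density"
    and indep: "indep_vars (\<lambda>_. borel) (case_sum \<xi>3 \<xi>1) ({1..16} <+> {1..4})"
begin

text \<open>\<open>J\<close> indexes the radial members that are kept. At \<open>l = 1\<close> their
  coefficient \<open>1 - l\<close> is zero, and keeping them would destroy linear
  independence.\<close>

lemma mean_lines_index:
  fixes e :: "'n::{finite,wellorder} \<Rightarrow> nat" and J :: "nat set"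
  assumes l: "0 < l" and J: "J = {1..4} \<and> l \<noteq> 1 \<or> J = {} \<and> l = 1" and N: "N = 16 + card J"
    and e: "bij_betw e UNIV {..<N}"
  shows "mean_lines M (random_cubic H3 H1 \<xi>3 \<xi>1) l = ennreal (lines_ratio (mixing l))"
proof -
  let ?A = "{1..16::nat} <+> J"
  have fin: "finite J" "J \<subseteq> {1..4}" using J by auto
  have "card {..<N} = card ?A" using fin by (simp add: N card_Plus)
  then obtain \<rho> where \<rho>: "bij_betw \<rho> {..<N} ?A"
    using finite_same_card_bij[of "{..<N}" ?A] fin by auto
  have re: "(\<Sum>j<N. g (\<rho> j)) = (\<Sum>k\<in>{1..16}. g (Inl k)) + (\<Sum>k\<in>J. g (Inr k))" for g :: "nat + nat \<Rightarrow> real"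
    unfolding sum.reindex_bij_betw[OF \<rho>] using fin by (simp add: sum.Plus)
  define G where "G j x = case_sum (\<lambda>k. l * H3 k x) (\<lambda>k. (1 - l) * ((norm x)\<^sup>2 * H1 k x)) (\<rho> j)" for j x
  \<comment> \<open>For \<open>J\<close> empty both sides vanish through the factor
    \<open>1 - l\<close>, so sums over \<open>J\<close> agree with the sums over all four radial
    members.\<close>
  have J0: "(\<Sum>k\<in>J. (1 - l) * f k) = (\<Sum>k\<in>{1..4}. (1 - l) * f k)" for f :: "nat \<Rightarrow> real"
    using J by auto
  have P: "random_cubic H3 H1 \<xi>3 \<xi>1 l \<omega> x = (\<Sum>j<N. case_sum \<xi>3 \<xi>1 (\<rho> j) \<omega> * G j x)" for \<omega> x
  proof -
    have "(\<Sum>j<N. case_sum \<xi>3 \<xi>1 (\<rho> j) \<omega> * G j x) =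
      (\<Sum>k\<in>{1..16}. \<xi>3 k \<omega> * (l * H3 k x)) + (\<Sum>k\<in>J. \<xi>1 k \<omega> * ((1 - l) * ((norm x)\<^sup>2 * H1 k x)))"
      unfolding G_def
      using re[of "\<lambda>r. case_sum \<xi>3 \<xi>1 r \<omega> * case_sum (\<lambda>k. l * H3 k x) (\<lambda>k. (1 - l) * ((norm x)\<^sup>2 * H1 k x)) r"]
      by simp
    then show ?thesis
      using J0[of "\<lambda>k. \<xi>1 k \<omega> * ((norm x)\<^sup>2 * H1 k x)"]
      by (simp add: random_cubic_def sum_distrib_left mult.left_commute)
  qed
  have "(\<integral>\<^sup>+\<omega>. num_lines (\<lambda>x. \<Sum>j<N. case_sum \<xi>3 \<xi>1 (\<rho> j) \<omega> * G j x) \<partial>M) = ennreal (lines_ratio (mixing l))"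
  proof (rule mean_lines_orthonormal[OF prob_space_axioms _ _ l _ _ e])
    have "?A \<subseteq> {1..16} <+> {1..4}" using fin(2) by auto
    then have "indep_vars (\<lambda>_. borel) (case_sum \<xi>3 \<xi>1) (\<rho> ` {..<N})"
      using indep_vars_subset[OF indep] \<rho> by (simp add: bij_betw_def)
    then show "indep_vars (\<lambda>_. borel) (\<lambda>j. case_sum \<xi>3 \<xi>1 (\<rho> j)) {..<N}"
      using indep_vars_reindex[of \<rho> "{..<N}" "\<lambda>_. borel"] \<rho> by (simp add: bij_betw_def)
    show "distributed M lborel (case_sum \<xi>3 \<xi>1 (\<rho> j)) std_normal_density" if "j < N" for j
    proof -
      have "\<rho> j \<in> ?A" using bij_betwE[OF \<rho>] that by blast
      then show ?thesis using normal fin(2) by auto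
    qed
    show "10 \<le> N" "N \<le> 20" using J by (auto simp: N)
    show "cubic l (1 - l) j x = 0" if "N \<le> j" "j < 20" for j x
    proof -
      have "J = {}" "l = 1" using J that by (auto simp: N)
      moreover from this have "16 \<le> j" using that by (simp add: N)
      ultimately show ?thesis using that by (simp add: cubic_pure)
    qed
    show "96 * (\<Sum>j<N. G j x * G j y) = kern l (1 - l) x y" for x y
    proof -
      have "(\<Sum>j<N. G j x * G j y) =
        (\<Sum>k\<in>{1..16}. (l * H3 k x) * (l * H3 k y)) + (\<Sum>k\<in>J. ((1 - l) * ((norm x)\<^sup>2 * H1 k x)) * ((1 - l) * ((norm y)\<^sup>2 * H1 k y)))"
        unfolding G_def
        using re[of "\<lambda>r. case_sum (\<lambda>k. l * H3 k x) (\<lambda>k. (1 - l) * ((norm x)\<^sup>2 * H1 k x)) r *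
          case_sum (\<lambda>k. l * H3 k y) (\<lambda>k. (1 - l) * ((norm y)\<^sup>2 * H1 k y)) r"] by simp
      also have "\<dots> = l\<^sup>2 * (\<Sum>k\<in>{1..16}. H3 k x * H3 k y) +
        (1 - l)\<^sup>2 * (\<Sum>k\<in>{1..4}. ((norm x)\<^sup>2 * H1 k x) * ((norm y)\<^sup>2 * H1 k y))"
        using J0[of "\<lambda>k. (1 - l) * (((norm x)\<^sup>2 * H1 k x) * ((norm y)\<^sup>2 * H1 k y))"]
        by (simp add: sum_distrib_left power2_eq_square mult.left_commute mult.assoc)
      also have "\<dots> = l\<^sup>2 * ((2 * (x \<bullet> y) ^ 3 - (x \<bullet> y) * (x \<bullet> x) * (y \<bullet> y)) / 24) + (1 - l)\<^sup>2 * ((x \<bullet> y) * (x \<bullet> x) * (y \<bullet> y) / 96)"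
        unfolding kernel_harmonic_3[OF basis(1) orthonormal(1) finite_atLeastAtMost] kernel_radial[OF basis(2) orthonormal(2) finite_atLeastAtMost] ..
      finally show ?thesis unfolding kern_def by (simp add: field_simps)
    qed
    fix c :: "nat \<Rightarrow> real" and j
    assume z: "\<And>x. (\<Sum>j<N. c j * G j x) = 0" and j: "j < N"
    define d where "d r = c (inv_into {..<N} \<rho> r)" for r
    have d: "d (\<rho> j) = c j" if "j < N" for j
      using \<rho> that by (simp add: d_def bij_betw_def)
    have s: "(\<Sum>k\<in>{1..16}. d (Inl k) * (l * H3 k x)) + (\<Sum>k\<in>J. d (Inr k) * ((1 - l) * ((norm x)\<^sup>2 * H1 k x))) = 0" for x
    proof -
      have "(\<Sum>j<N. c j * G j x) = (\<Sum>j<N. d (\<rho> j) * G j x)" by (simp add: d)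
      also have "\<dots> = (\<Sum>k\<in>{1..16}. d (Inl k) * (l * H3 k x)) + (\<Sum>k\<in>J. d (Inr k) * ((1 - l) * ((norm x)\<^sup>2 * H1 k x)))"
        unfolding G_def using re[of "\<lambda>r. d r * case_sum (\<lambda>k. l * H3 k x) (\<lambda>k. (1 - l) * ((norm x)\<^sup>2 * H1 k x)) r"] by simp
      finally show ?thesis using z by simp
    qed
    have "(\<Sum>k\<in>{1..16}. (l * d (Inl k)) * H3 k x) + (\<Sum>k\<in>{1..4}. ((1 - l) * d (Inr k)) * ((norm x)\<^sup>2 * H1 k x)) = 0" for x
      using s[of x] J0[of "\<lambda>k. d (Inr k) * ((norm x)\<^sup>2 * H1 k x)"] by (simp add: mult_ac)
    note k0 = harmonic_decomposition_independent[OF basis this]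
    have l1: "l \<noteq> 1" if "r \<in> J" for r using J that by blast
    have "\<rho> j \<in> ?A" using bij_betwE[OF \<rho>] j by blast
    then have "d (\<rho> j) = 0"
      using k0 l l1 fin(2) by auto
    then show "c j = 0" using d[OF j] by simp
  qed
  moreover have "random_cubic H3 H1 \<xi>3 \<xi>1 l \<omega> = (\<lambda>x. \<Sum>j<N. case_sum \<xi>3 \<xi>1 (\<rho> j) \<omega> * G j x)" for \<omega>
    by (rule ext) (rule P)
  ultimately show ?thesis by (simp only: mean_lines_def)
qed

text \<open>The dimension is a type, so the two ranks of the kernel are treated with the numeral
  types 16 and 20.\<close>

lemma mean_lines_eq:
  assumes "0 < l" "l \<le> 1"
  shows "mean_lines M (random_cubic H3 H1 \<xi>3 \<xi>1) l = ennreal (lines_ratio (mixing l))"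
proof (cases "l = 1")
  case True
  obtain e :: "16 \<Rightarrow> nat" where "bij_betw e UNIV {..<16}"
    using finite_same_card_bij[of "UNIV :: 16 set" "{..<16::nat}"] by auto
  with True show ?thesis by (intro mean_lines_index[where J = "{}"]) auto
next
  case False
  obtain e :: "20 \<Rightarrow> nat" where "bij_betw e UNIV {..<20}"
    using finite_same_card_bij[of "UNIV :: 20 set" "{..<20::nat}"] by auto
  with False assms show ?thesis by (intro mean_lines_index[where J = "{1..4}"]) auto
qed

lemma mean_lines_tendsto:
  "(mean_lines M (random_cubic H3 H1 \<xi>3 \<xi>1) \<longlongrightarrow> ennreal (lines_ratio (mixing 0))) (at_right 0)"
proof (rule Lim_transform_eventually)
  have "((\<lambda>l. lines_ratio (mixing l)) \<longlongrightarrow> lines_ratio (mixing 0)) (at 0)"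
    using isCont_lines_ratio by (simp add: isCont_def)
  then show "((\<lambda>l. ennreal (lines_ratio (mixing l))) \<longlongrightarrow> ennreal (lines_ratio (mixing 0))) (at_right 0)"
    by (intro tendsto_ennrealI) (simp add: filterlim_at_split)
  show "\<forall>\<^sub>F l in at_right 0. ennreal (lines_ratio (mixing l)) = mean_lines M (random_cubic H3 H1 \<xi>3 \<xi>1) l"
    unfolding eventually_at_right_field by (intro exI[of _ 1]) (simp add: mean_lines_eq)
qed

lemma E_lines_eq:
  assumes "0 \<le> l" "l \<le> 1"
  shows "E_lines M (random_cubic H3 H1 \<xi>3 \<xi>1) l = ennreal (lines_ratio (mixing l))"
  using mean_lines_eq[of l] tendsto_Lim[OF _ mean_lines_tendsto] assms by (simp add: E_lines_def)

end

theorem corollary2: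
  fixes M :: "'w measure"
    and H3 H1 :: "nat \<Rightarrow> real^4 \<Rightarrow> real"
    and \<xi>3 \<xi>1 :: "nat \<Rightarrow> 'w \<Rightarrow> real"
  assumes "prob_space M"
    and "basis_family (harmonic_poly 3) {1..16} H3"
    and "basis_family (harmonic_poly 1) {1..4} H1"
    and "orthonormal_family {1..16} H3"
    and "orthonormal_family {1..4} (\<lambda>j x. (norm x)\<^sup>2 * H1 j x)"
    and "\<And>j. j \<in> {1..16} \<Longrightarrow> distributed M lborel (\<xi>3 j) std_normal_density"
    and "\<And>j. j \<in> {1..4} \<Longrightarrow> distributed M lborel (\<xi>1 j) std_normal_density"
    and "prob_space.indep_vars M (\<lambda>_. borel) (case_sum \<xi>3 \<xi>1) ({1..16} <+> {1..4})"
  defines "P \<equiv> random_cubic H3 H1 \<xi>3 \<xi>1"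
  shows "(mean_lines M P \<longlongrightarrow> E_lines M P 0) (at_right 0) \<and>
         strict_mono_on {0..1} (E_lines M P) \<and>
         (\<forall>lam\<in>{0..1}. E_lines M P lam \<le> E_lines M P 1) \<and>
         E_lines M P 1 = ennreal (24 * sqrt (2 / 5) - 3)"
proof -
  interpret random_cubics M H3 H1 \<xi>3 \<xi>1
    by (intro random_cubics.intro random_cubics_axioms.intro) (fact assms(1-8))+
  have E: "E_lines M P l = ennreal (lines_ratio (mixing l))" if "0 \<le> l" "l \<le> 1" for l
    unfolding P_def by (rule E_lines_eq[OF that])
  \<comment> \<open>Nonnegativity of \<open>lines_ratio\<close> is what lets a strict inequality of
    reals pass to \<open>ennreal\<close>.\<close>
  have less: "E_lines M P l < E_lines M P k" if "0 \<le> l" "l < k" "k \<le> 1" for l k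
    using lines_ratio_mixing_mono[OF that] lines_ratio_mixing_nonneg[of l] that
    by (simp add: E ennreal_less_iff)
  have "strict_mono_on {0..1} (E_lines M P)"
    by (rule strict_mono_onI) (simp add: less)
  moreover have "E_lines M P l \<le> E_lines M P 1" if "l \<in> {0..1}" for l
    using less[of l 1] that by (cases "l = 1") auto
  moreover have "E_lines M P 1 = ennreal (24 * sqrt (2 / 5) - 3)"
    by (simp add: E lines_ratio_1)
  moreover have "(mean_lines M P \<longlongrightarrow> E_lines M P 0) (at_right 0)"
    using mean_lines_tendsto by (simp add: E P_def[symmetric])
  ultimately show ?thesis by blast
qed

end
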